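(* Consider the price-of-information model for maximum weight bipartite matching (defined in the context), and assume each $Y_e$ is discrete with finite value set $V_e$, with $p_{e,v}>0$ for all $v\in V_e$ and $\sum_{v\in V_e}p_{e,v}<1$ for every edge $e$. Then the expected PoI utility of the algorithm Approx-PoI (defined in the context) is at least $(1-1/e)\cdot\mathrm{OPT}$, where $\mathrm{OPT}$ is the maximum expected PoI utility over all PoI algorithms.
   Context: PoI model: $G=(A\cup B,E)$ is a bipartite graph; each edge $e$ has an independent random nonnegative weight $X_e$ with known distribution and a query cost $\pi_e\ge0$; querying $e$ (paying $\pi_e$) reveals $X_e$. A PoI algorithm queries a set $Q$ of edges and outputs a matching $M\subseteq Q$; its expected PoI utility is $\mathbb{E}[\sum_{e\in M}X_e-\sum_{e\in Q}\pi_e]$, and $\mathrm{OPT}$ is its maximum over all PoI algorithms. For each $e$, $\tau_e$ solves $\mathbb{E}[\max\{X_e-\tau_e,0\}]=\pi_e$ and $Y_e=\min(X_e,\tau_e)$. $V_e$ is a finite set of values of $Y_e$, and $p_{e,v}=\Pr[Y_e=v]$ for $v\in V_e$. For $u\in A\cup B$ let $\delta(u)$ be its incident edges and $E^{all}_u=\{(e,v):e\in\delta(u),v\in V_e\}$; $E_{all}=\bigcup_{u\in A}E^{all}_u$. For a set $F$ of edge-value pairs, $f(F)=\Pr[Y_e=v\text{ for some }(e,v)\in F]$. $\mathrm{LP}_{PoI}$: maximize $\sum_{(e,v)\in E_{all}}x_{e,v}\,v$ subject to $\sum_{(e,v)\in F}x_{e,v}\le f(F)$ for all $u\in A\cup B$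 and $F\subseteq E^{all}_u$, and $x_{e,v}\ge0$. Let $x^\ast$ be an optimal solution. For $a\in A$, the single-vertex procedure $\mathcal{P}_a(\sigma)$ on a sequence $\sigma$ of distinct pairs of $E^{all}_a$ is: set $z_e=\mathrm{Null}$ for all $e\in\delta(a)$; for each $(e,v)$ in order of $\sigma$, if $z_e=\mathrm{Null}$ draw $z_e$ independently from the distribution of $Y_e$, and if $z_e=v$ output $e$ (with value $v$) and stop. $\mathcal{D}_a$ is a distribution over such sequences $\sigma$ such that: (1) if $(e,v)$ appears in $\sigma$, then every $(e,w)$ with $w\in V_e$, $w>v$ appears in $\sigma$ before $(e,v)$; (2) when $\sigma\sim\mathcal{D}_a$, $\mathcal{P}_a$ outputs $e$ with probability $\sum_{v\in V_e}x^\ast_{e,v}$ for every $e\in\delta(a)$; (3) for every $e\in\delta(a)$ and $w\ge0$, $\sum_{v\in V_e,v\ge w}\Pr[\mathcal{P}_a\text{ outputs }e\text{ with value }v]\cdot v\ge\sum_{v\in V_e,v\ge w}x^\ast_{e,v}\,v$. Algorithm Approx-PoI: compute $x^\ast$ and $\mathcal{D}_a$ for all $a\in A$; draw independent uniform arrival times $t_a\in[0,1]$ for $a\in A$; for $b\in B$ set $c_b=\sum_{(e,v)\in E^{all}_b}x^\ast_{e,v}v$; set $z_e=\mathrm{Null}$ for all $e\in E$ and $M=\emptyset$. For each $a\in A$ in increasing order of $t_a$: draw $\sigma\sim\mathcal{D}_a$; for each $(e=(a,b),v)$ in the order of $\sigma$: if $v\ge(1-e^{t_a-1})c_b$ and $b$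 is unmatched, then if $z_e=\mathrm{Null}$ pay $\pi_e$, query $e$ and set $z_e=X_e$; if $\min(z_e,\tau_e)=v$, add $e$ to $M$ and move to the next vertex of $A$. Otherwise, if $z_e=\mathrm{Null}$ draw $z_e$ independently from the distribution of $X_e$ (without querying), and if $\min(z_e,\tau_e)=v$ move to the next vertex of $A$. Return $M$.
   Formalization: Since the probabilities over V_e sum to less than 1, V_e cannot be the full value set of Y_e; the formal statement assumes that almost surely Y_e lies in V_e or Y_e ≤ 0, so the omitted mass is worthless. If V_e could omit positive values, the claim would fail. *)

theory Defs
  imports "HOL-Probability.Probability"
begin

text \<open>
  Vertices of the two sides live in two types, so an edge is a pair and the two sides are
  disjoint. Throughout, \<open>E\<close> is the edge set, \<open>D e\<close> the distribution of the weight \<open>X\<^sub>e\<close>,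
  \<open>cost e\<close> the query cost \<open>\<pi>\<^sub>e\<close>, \<open>tau e\<close> the cap \<open>\<tau>\<^sub>e\<close> and \<open>V e\<close> the finite value set \<open>V\<^sub>e\<close>.
  A vector of independent weights is a point of \<open>Pi\<^sub>M E D\<close>.
\<close>

definition deltaA :: "('a \<times> 'b) set \<Rightarrow> 'a \<Rightarrow> ('a \<times> 'b) set"
  where "deltaA E a = {e \<in> E. fst e = a}"

definition deltaB :: "('a \<times> 'b) set \<Rightarrow> 'b \<Rightarrow> ('a \<times> 'b) set"
  where "deltaB E b = {e \<in> E. snd e = b}"

definition matching :: "('a \<times> 'b) set \<Rightarrow> bool"
  where "matching M \<longleftrightarrow> inj_on fst M \<and> inj_on snd M"


subsection \<open>Price-of-information algorithms and their optimum\<close>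

definition poi_utility ::
    "('e \<Rightarrow> real) \<Rightarrow> ('e \<Rightarrow> real) \<Rightarrow> 'e set \<times> 'e set \<Rightarrow> real"
  where "poi_utility cost X = (\<lambda>(M, Q). (\<Sum>e\<in>M. X e) - (\<Sum>e\<in>Q. cost e))"

text \<open>
  A deterministic adaptive algorithm is a decision tree: it either outputs a set of edges, or
  queries an edge and continues depending on the revealed weight.
\<close>

datatype 'e query_tree = Output "'e set" | Query 'e "real \<Rightarrow> 'e query_tree"

text \<open>The result is the pair of the output set and the set of queried edges.\<close>

primrec run_tree :: "'e query_tree \<Rightarrow> ('e \<Rightarrow> real) \<Rightarrow> 'e set \<times> 'e set" where
  "run_tree (Output M) X = (M, {})"
| "run_tree (Query e k) X = (let (M, Q) = run_tree (k (X e)) X in (M, insert e Q))"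

text \<open>The last argument is the set of edges queried so far.\<close>

primrec valid_tree ::
    "('a \<times> 'b) set \<Rightarrow> ('a \<times> 'b) query_tree \<Rightarrow> ('a \<times> 'b) set \<Rightarrow> bool" where
  "valid_tree E (Output M) Q \<longleftrightarrow> M \<subseteq> Q \<and> matching M"
| "valid_tree E (Query e k) Q \<longleftrightarrow> e \<in> E - Q \<and> (\<forall>w. valid_tree E (k w) (insert e Q))"

text \<open>
  A randomized algorithm draws a seed from a probability space \<open>R\<close>, independently of the weights,
  and then follows the tree selected by the seed. Its outcome has to be a random variable.
\<close>

definition poi_algorithms ::
    "('a \<times> 'b) set \<Rightarrow> ('a \<times> 'b \<Rightarrow> real measure)
      \<Rightarrow> (real measure \<times> (real \<Rightarrow> ('a \<times> 'b) query_tree)) set"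
  where "poi_algorithms E D =
    {(R, T). prob_space R \<and>
       (\<forall>s\<in>space R. valid_tree E (T s) {}) \<and>
       (\<lambda>(s, X). run_tree (T s) X) \<in> R \<Otimes>\<^sub>M Pi\<^sub>M E D \<rightarrow>\<^sub>M count_space UNIV}"

definition expected_utility ::
    "('a \<times> 'b) set \<Rightarrow> ('a \<times> 'b \<Rightarrow> real measure) \<Rightarrow> ('a \<times> 'b \<Rightarrow> real)
      \<Rightarrow> real measure \<times> (real \<Rightarrow> ('a \<times> 'b) query_tree) \<Rightarrow> real"
  where "expected_utility E D cost = (\<lambda>(R, T).
    \<integral>(s, X). poi_utility cost X (run_tree (T s) X) \<partial>(R \<Otimes>\<^sub>M Pi\<^sub>M E D))"

text \<open>
  For weights with finite expectation and nonnegative costs, the supremum is over a set that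
  contains \<open>0\<close> (output the empty matching) and is bounded above by the sum of all expected weights.
\<close>

definition OPT ::
    "('a \<times> 'b) set \<Rightarrow> ('a \<times> 'b \<Rightarrow> real measure) \<Rightarrow> ('a \<times> 'b \<Rightarrow> real) \<Rightarrow> real"
  where "OPT E D cost = (SUP alg\<in>poi_algorithms E D. expected_utility E D cost alg)"


subsection \<open>The linear program\<close>

definition prob_value :: "('e \<Rightarrow> real measure) \<Rightarrow> ('e \<Rightarrow> real) \<Rightarrow> 'e \<Rightarrow> real \<Rightarrow> real"
  where "prob_value D tau e v = measure (D e) {w \<in> space (D e). min w (tau e) = v}"

definition prob_some ::
    "'e set \<Rightarrow> ('e \<Rightarrow> real measure) \<Rightarrow> ('e \<Rightarrow> real) \<Rightarrow> ('e \<times> real) set \<Rightarrow> real"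
  where "prob_some E D tau F =
    measure (Pi\<^sub>M E D) {X \<in> space (Pi\<^sub>M E D). \<exists>(e, v)\<in>F. min (X e) (tau e) = v}"

definition lp_feasible ::
    "'a set \<Rightarrow> 'b set \<Rightarrow> ('a \<times> 'b) set \<Rightarrow> ('a \<times> 'b \<Rightarrow> real measure) \<Rightarrow> ('a \<times> 'b \<Rightarrow> real)
      \<Rightarrow> ('a \<times> 'b \<Rightarrow> real set) \<Rightarrow> ('a \<times> 'b \<Rightarrow> real \<Rightarrow> real) \<Rightarrow> bool"
  where "lp_feasible A B E D tau V x \<longleftrightarrow>
    (\<forall>a\<in>A. \<forall>F \<subseteq> Sigma (deltaA E a) V. (\<Sum>(e, v)\<in>F. x e v) \<le> prob_some E D tau F) \<and>
    (\<forall>b\<in>B. \<forall>F \<subseteq> Sigma (deltaB E b) V. (\<Sum>(e, v)\<in>F. x e v) \<le> prob_some E D tau F) \<and>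
    (\<forall>(e, v)\<in>Sigma E V. 0 \<le> x e v)"

definition lp_value ::
    "'e set \<Rightarrow> ('e \<Rightarrow> real set) \<Rightarrow> ('e \<Rightarrow> real \<Rightarrow> real) \<Rightarrow> real"
  where "lp_value E V x = (\<Sum>(e, v)\<in>Sigma E V. x e v * v)"

definition lp_optimal ::
    "'a set \<Rightarrow> 'b set \<Rightarrow> ('a \<times> 'b) set \<Rightarrow> ('a \<times> 'b \<Rightarrow> real measure) \<Rightarrow> ('a \<times> 'b \<Rightarrow> real)
      \<Rightarrow> ('a \<times> 'b \<Rightarrow> real set) \<Rightarrow> ('a \<times> 'b \<Rightarrow> real \<Rightarrow> real) \<Rightarrow> bool"
  where "lp_optimal A B E D tau V x \<longleftrightarrow>
    lp_feasible A B E D tau V x \<and>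
    (\<forall>x'. lp_feasible A B E D tau V x' \<longrightarrow> lp_value E V x' \<le> lp_value E V x)"


subsection \<open>The single-vertex procedure and the sequence distributions\<close>

text \<open>
  The fresh draws are supplied in advance as \<open>y\<close>, with independent coordinates; \<open>y e\<close> is looked
  at only when \<open>z e\<close> is still \<open>None\<close>, hence at most once.
\<close>

fun single_vertex ::
    "('e \<Rightarrow> real) \<Rightarrow> ('e \<Rightarrow> real option) \<Rightarrow> ('e \<times> real) list \<Rightarrow> ('e \<times> real) option" where
  "single_vertex y z [] = None"
| "single_vertex y z ((e, v) # \<sigma>) =
    (let z' = (if z e = None then z(e \<mapsto> y e) else z)
     in if z' e = Some v then Some (e, v) else single_vertex y z' \<sigma>)"

text \<open>
  Probability that the result of the procedure satisfies \<open>P\<close> when the sequence is drawn from \<open>S\<close>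
  and, independently, each \<open>y e\<close> from the distribution of \<open>Y\<^sub>e\<close>.
\<close>

definition prob_single_vertex ::
    "('a \<times> 'b) set \<Rightarrow> ('a \<times> 'b \<Rightarrow> real measure) \<Rightarrow> ('a \<times> 'b \<Rightarrow> real) \<Rightarrow> 'a
      \<Rightarrow> (('a \<times> 'b) \<times> real) list pmf \<Rightarrow> ((('a \<times> 'b) \<times> real) option \<Rightarrow> bool) \<Rightarrow> real"
  where "prob_single_vertex E D tau a S P =
    (let Y = Pi\<^sub>M (deltaA E a) (\<lambda>e. distr (D e) borel (\<lambda>w. min w (tau e)))
     in measure_pmf.expectation S
          (\<lambda>\<sigma>. measure Y {y \<in> space Y. P (single_vertex y Map.empty \<sigma>)}))"

definition sequence_distribution ::
    "('a \<times> 'b) set \<Rightarrow> ('a \<times> 'b \<Rightarrow> real measure) \<Rightarrow> ('a \<times> 'b \<Rightarrow> real) \<Rightarrow> ('a \<times> 'b \<Rightarrow> real set)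
      \<Rightarrow> ('a \<times> 'b \<Rightarrow> real \<Rightarrow> real) \<Rightarrow> 'a \<Rightarrow> (('a \<times> 'b) \<times> real) list pmf \<Rightarrow> bool"
  where "sequence_distribution E D tau V x a S \<longleftrightarrow>
    (\<forall>\<sigma>\<in>set_pmf S. distinct \<sigma> \<and> set \<sigma> \<subseteq> Sigma (deltaA E a) V) \<and>
    (\<forall>\<sigma>\<in>set_pmf S. \<forall>i<length \<sigma>. \<forall>e v w.
       \<sigma> ! i = (e, v) \<and> w \<in> V e \<and> w > v \<longrightarrow> (\<exists>j<i. \<sigma> ! j = (e, w))) \<and>
    (\<forall>e\<in>deltaA E a.
       prob_single_vertex E D tau a S (\<lambda>r. \<exists>v. r = Some (e, v)) = (\<Sum>v\<in>V e. x e v)) \<and>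
    (\<forall>e\<in>deltaA E a. \<forall>w\<ge>0.
       (\<Sum>v\<in>{v \<in> V e. v \<ge> w}. prob_single_vertex E D tau a S (\<lambda>r. r = Some (e, v)) * v)
         \<ge> (\<Sum>v\<in>{v \<in> V e. v \<ge> w}. x e v * v))"


subsection \<open>The algorithm Approx-PoI\<close>

definition load ::
    "('a \<times> 'b) set \<Rightarrow> ('a \<times> 'b \<Rightarrow> real set) \<Rightarrow> ('a \<times> 'b \<Rightarrow> real \<Rightarrow> real) \<Rightarrow> 'b \<Rightarrow> real"
  where "load E V x b = (\<Sum>(e, v)\<in>Sigma (deltaB E b) V. x e v * v)"

text \<open>
  Processing one vertex with arrival time \<open>t\<close> along its sequence. The state consists of the values
  \<open>z\<close>, the current matching \<open>M\<close> and the set \<open>Q\<close> of edges queried (and paid for) so far. \<open>X\<close> are the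
  true weights, \<open>X'\<close> the values drawn without querying, and \<open>c\<close> gives the constants \<open>c\<^sub>b\<close>.
\<close>

fun process_vertex ::
    "('a \<times> 'b \<Rightarrow> real) \<Rightarrow> ('b \<Rightarrow> real) \<Rightarrow> ('a \<times> 'b \<Rightarrow> real) \<Rightarrow> ('a \<times> 'b \<Rightarrow> real) \<Rightarrow> real
      \<Rightarrow> (('a \<times> 'b) \<times> real) list
      \<Rightarrow> ('a \<times> 'b \<Rightarrow> real option) \<times> ('a \<times> 'b) set \<times> ('a \<times> 'b) set
      \<Rightarrow> ('a \<times> 'b \<Rightarrow> real option) \<times> ('a \<times> 'b) set \<times> ('a \<times> 'b) set" where
  "process_vertex tau c X X' t [] state = state"
| "process_vertex tau c X X' t ((e, v) # \<sigma>) (z, M, Q) =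
    (if v \<ge> (1 - exp (t - 1)) * c (snd e) \<and> snd e \<notin> snd ` M then
       let (z', Q') = (if z e = None then (z(e \<mapsto> X e), insert e Q) else (z, Q))
       in if min (the (z' e)) (tau e) = v then (z', insert e M, Q')
          else process_vertex tau c X X' t \<sigma> (z', M, Q')
     else
       let z' = (if z e = None then z(e \<mapsto> X' e) else z)
       in if min (the (z' e)) (tau e) = v then (z', M, Q)
          else process_vertex tau c X X' t \<sigma> (z', M, Q))"

text \<open>
  Vertices with equal arrival times, which almost surely do not exist, are processed in the order
  of an arbitrary fixed enumeration.
\<close>

definition arrival_order :: "'a set \<Rightarrow> ('a \<Rightarrow> real) \<Rightarrow> 'a list"
  where "arrival_order A t = sort_key t (SOME as. distinct as \<and> set as = A)"

definition approx_poi ::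
    "'a set \<Rightarrow> ('a \<times> 'b) set \<Rightarrow> ('a \<times> 'b \<Rightarrow> real) \<Rightarrow> ('a \<times> 'b \<Rightarrow> real set)
      \<Rightarrow> ('a \<times> 'b \<Rightarrow> real \<Rightarrow> real) \<Rightarrow> ('a \<Rightarrow> (('a \<times> 'b) \<times> real) list) \<Rightarrow> ('a \<Rightarrow> real)
      \<Rightarrow> ('a \<times> 'b \<Rightarrow> real) \<Rightarrow> ('a \<times> 'b \<Rightarrow> real) \<Rightarrow> ('a \<times> 'b) set \<times> ('a \<times> 'b) set"
  where "approx_poi A E tau V x \<sigma> t X X' =
    snd (fold (\<lambda>a. process_vertex tau (load E V x) X X' (t a) (\<sigma> a))
           (arrival_order A t) (Map.empty, {}, {}))"

text \<open>
  The sequences \<open>\<sigma>\<close>, the arrival times \<open>t\<close>, the weights \<open>X\<close> and the simulated weights \<open>X'\<close> are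
  mutually independent, with independent coordinates.
\<close>

definition approx_poi_utility ::
    "'a set \<Rightarrow> ('a \<times> 'b) set \<Rightarrow> ('a \<times> 'b \<Rightarrow> real measure) \<Rightarrow> ('a \<times> 'b \<Rightarrow> real)
      \<Rightarrow> ('a \<times> 'b \<Rightarrow> real) \<Rightarrow> ('a \<times> 'b \<Rightarrow> real set) \<Rightarrow> ('a \<times> 'b \<Rightarrow> real \<Rightarrow> real)
      \<Rightarrow> ('a \<Rightarrow> (('a \<times> 'b) \<times> real) list pmf) \<Rightarrow> real"
  where "approx_poi_utility A E D cost tau V x S =
    measure_pmf.expectation (Pi_pmf A [] S) (\<lambda>\<sigma>.
      \<integral>(t, X, X'). poi_utility cost X (approx_poi A E tau V x \<sigma> t X X')
        \<partial>(Pi\<^sub>M A (\<lambda>_. uniform_measure lborel {0..1}) \<Otimes>\<^sub>M (Pi\<^sub>M E D \<Otimes>\<^sub>M Pi\<^sub>M E D)))"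

end

theory Submission
  imports Defs
begin

text \<open>
  Since \<open>cost e\<close> is the expected excess of the weight of \<open>e\<close> over \<open>tau e\<close>, the utility of any
  algorithm is at most the expected sum of the capped weights \<open>min (X e) (tau e)\<close> of its matching, with
  equality if every queried edge whose weight exceeds the cap is taken. The probabilities that \<open>e\<close> is
  matched with capped weight \<open>v\<close> are feasible for the linear program, so its value bounds the optimum.

  For \<open>Approx-PoI\<close> the equality holds, because the first pair of an edge in a sequence carries the
  largest value. Whether the true weight or the simulated one is read on an edge depends only on the
  outcomes of earlier vertices. Hence, for fixed arrival times, the outcomes of the vertices are jointly
  distributed like independent runs of the single-vertex procedure, and a vertex \<open>b\<close> is free at time
  \<open>s\<close> unless some earlier outcome is an acceptable edge at \<open>b\<close>. With \<open>r s\<close> the probability of being free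
  and load \<open>c\<close>, accepted values above the threshold \<open>(1 - exp (s - 1)) * c\<close> contribute at least
  \<open>exp (s - 1) * c * r s\<close> to the gain rate, and the threshold itself contributes
  \<open>- (1 - exp (s - 1)) * c * r' s\<close>; the sum is the derivative of \<open>- c * (1 - exp (s - 1)) * r s\<close>.
\<close>

subsection \<open>Runs of the algorithm\<close>

text \<open>The obstacle is that true and simulated weights are read adaptively, so the vector of
  weights actually read is not a fixed selection of coordinates. The way around it is to fix the
  outcome vector \<open>r\<close> of all vertices beforehand. For fixed \<open>r\<close>,
  \<open>queried\<close> is a fixed set of edges; taking \<open>X\<close> on it and
  \<open>X'\<close> off it gives a vector with the law of \<open>X\<close>, and
  \<open>consistent\<close> says that looking up the sequences in this vector returns
  \<open>r\<close>. Each sample has exactly one consistent \<open>r\<close> on \<open>A\<close>, so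
  finitely many events split the sample space, and each has the probability it has for independent
  runs. This works because the source read on an edge is settled by the test for its largest value,
  wherever the edge stands in the sequence.

  The function h(s) = 1 - exp (s - 1) solves h' = h - 1 with h(1) = 0. The equation balances the
  gain rate against the derivative of h times the probability of being free, h(1) = 0 removes the
  boundary term at time 1, and h(0) = 1 - 1/e is the ratio.\<close>

lemma single_vertex_eq_find:
  assumes "\<forall>e. z e = None \<or> z e = Some (y e)"
  shows "single_vertex y z \<sigma> = find (\<lambda>(e, v). y e = v) \<sigma>"
  using assms
proof (induction \<sigma> arbitrary: z)
  case (Cons p \<sigma>)
  obtain e v where p: "p = (e, v)" by force
  define z' where "z' = (if z e = None then z(e \<mapsto> y e) else z)"
  have "z e = None \<or> z e = Some (y e)" using Cons.prems by blast
  then have "\<forall>e. z' e = None \<or> z' e = Some (y e)" "z' e = Some (y e)"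
    using Cons.prems by (simp_all add: z'_def) (metis option.distinct(1))+
  with Cons.IH[of z'] show ?case by (simp add: p z'_def Let_def)
qed simp

text \<open>What survives of the descending order of values once a prefix of the sequence has been
  processed; \<open>z\<close> records the edges already met. The test at the first meeting with an
  edge is therefore the test for its largest value, so the choice between querying and simulating
  does not depend on the sequence.\<close>

definition leads_with_max ::
    "('e \<Rightarrow> real set) \<Rightarrow> ('e \<Rightarrow> real option) \<Rightarrow> ('e \<times> real) list \<Rightarrow> bool"
  where "leads_with_max V z \<sigma> \<longleftrightarrow>
    (\<forall>\<sigma>1 e v \<sigma>2. \<sigma> = \<sigma>1 @ (e, v) # \<sigma>2 \<longrightarrow> e \<notin> fst ` set \<sigma>1 \<longrightarrow> z e = None \<longrightarrow> v = Max (V e))"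

lemma leads_with_max_Cons:
  assumes "leads_with_max V z ((e, v) # \<sigma>)"
  shows "z e = None \<Longrightarrow> v = Max (V e)" "leads_with_max V (z(e \<mapsto> y)) \<sigma>"
    "z e \<noteq> None \<Longrightarrow> leads_with_max V z \<sigma>"
proof -
  show "z e = None \<Longrightarrow> v = Max (V e)"
    using assms unfolding leads_with_max_def by force
  have *: "v' = Max (V e')" if "\<sigma> = \<sigma>1 @ (e', v') # \<sigma>2" "e' \<notin> fst ` set \<sigma>1" "e' \<noteq> e" "z e' = None"
    for \<sigma>1 e' v' \<sigma>2
    using assms[unfolded leads_with_max_def, rule_format, of "(e, v) # \<sigma>1" e' v' \<sigma>2] that by auto
  show "leads_with_max V (z(e \<mapsto> y)) \<sigma>"
    unfolding leads_with_max_def using * by (auto split: if_splits)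
  show "leads_with_max V z \<sigma>" if "z e \<noteq> None"
    unfolding leads_with_max_def using * that by metis
qed

definition accepts :: "('b \<Rightarrow> real) \<Rightarrow> real \<Rightarrow> ('a \<times> 'b) \<times> real \<Rightarrow> bool"
  where "accepts c t = (\<lambda>(e, v). (1 - exp (t - 1)) * c (snd e) \<le> v)"

definition matches :: "('e \<Rightarrow> real) \<Rightarrow> ('e \<Rightarrow> real) \<Rightarrow> 'e \<times> real \<Rightarrow> bool"
  where "matches tau X = (\<lambda>(e, v). min (X e) (tau e) = v)"

text \<open>\<open>Z\<close> is the weight that will be read on each edge. It can be named in
  advance because \<open>M\<close> changes only in the last step of a run, so every first meeting
  with an edge is decided by the same test at \<open>Max (V e)\<close>. Processing a vertex is then
  a plain lookup in \<open>Z\<close>. A weight above the cap has the capped value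
  \<open>Max (V e)\<close>, which the first pair of the edge carries, so such an edge is taken as
  soon as it is queried; this is the invariant on \<open>Q\<close>.\<close>

lemma process_vertex_eq:
  assumes "process_vertex tau c X X' t \<sigma> (z, M, Q) = (z', M', Q')"
    and "\<And>e. e \<in> fst ` set \<sigma> \<Longrightarrow> z e = None \<or> z e = Some (Z e)"
    and "\<And>e. e \<in> fst ` set \<sigma> \<Longrightarrow>
      Z e = (if accepts c t (e, Max (V e)) \<and> snd e \<notin> snd ` M then X e else X' e)"
    and "leads_with_max V z \<sigma>"
    and "\<And>e v. (e, v) \<in> set \<sigma> \<Longrightarrow> v \<le> Max (V e)"
    and "\<And>e. e \<in> fst ` set \<sigma> \<Longrightarrow> X e > tau e \<Longrightarrow> Max (V e) = tau e"
    and "\<And>e. e \<in> Q \<Longrightarrow> X e > tau e \<Longrightarrow> e \<in> M"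
  shows "M' = (case find (matches tau Z) \<sigma> of None \<Rightarrow> M
        | Some (e, v) \<Rightarrow> if accepts c t (e, v) \<and> snd e \<notin> snd ` M then insert e M else M)
      \<and> (\<forall>e\<in>Q'. X e > tau e \<longrightarrow> e \<in> M')
      \<and> (\<forall>e. e \<notin> fst ` set \<sigma> \<longrightarrow> z' e = z e)
      \<and> Q' \<subseteq> Q \<union> fst ` set \<sigma>"
  using assms
proof (induction \<sigma> arbitrary: z Q)
  case Nil
  then show ?case by auto
next
  case (Cons p \<sigma>)
  obtain e v where p: "p = (e, v)" by (cases p)
  have Ze: "Z e = (if accepts c t (e, Max (V e)) \<and> snd e \<notin> snd ` M then X e else X' e)"
    using Cons.prems(3)[of e] by (simp add: p)
  have vmax: "v \<le> Max (V e)" using Cons.prems(5) by (simp add: p)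
  note lead = leads_with_max_Cons[OF Cons.prems(4)[unfolded p]]
  have ze: "z e = None \<or> z e = Some (Z e)" using Cons.prems(2)[of e] by (simp add: p)
  let ?b = "accepts c t (e, v) \<and> snd e \<notin> snd ` M"
  define z1 where "z1 = (if z e = None then z(e \<mapsto> Z e) else z)"
  define Q1 where "Q1 = (if ?b \<and> z e = None then insert e Q else Q)"
  have Zb: "Z e = (if ?b then X e else X' e)" if "z e = None"
    using lead(1)[OF that] Ze by simp
  have z1e: "z1 e = Some (Z e)" using ze by (auto simp: z1_def)
  have step: "(z', M', Q') = (if min (Z e) (tau e) = v then (z1, if ?b then insert e M else M, Q1)
      else process_vertex tau c X X' t \<sigma> (z1, M, Q1))"
    using Cons.prems(1) Zb ze unfolding p accepts_def z1_def Q1_def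
    by (auto simp: Let_def split: if_splits)
  have l1: "leads_with_max V z1 \<sigma>" unfolding z1_def using lead(2,3) by auto
  have Q1: "Q1 \<subseteq> insert e Q" by (auto simp: Q1_def)
  have z1o: "z1 e' = z e'" if "e' \<noteq> e" for e' using that by (simp add: z1_def)
  show ?case
  proof (cases "min (Z e) (tau e) = v")
    case True
    then have f: "find (matches tau Z) (p # \<sigma>) = Some (e, v)" by (simp add: p matches_def)
    have "z' = z1" "M' = (if ?b then insert e M else M)" "Q' = Q1" using step True by auto
    then show ?thesis
      using f Cons.prems(7) z1o by (auto simp: p Q1_def)
  next
    case False
    \<comment> \<open>Only the edge met in this step can be new in \<open>Q1\<close>. It was tested
      at its largest value and failed, whereas a weight above the cap would have matched
      there.\<close>
    have q: "e' \<in> M" if "e' \<in> Q1" "X e' > tau e'" for e'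
    proof (cases "e' \<in> Q")
      case True then show ?thesis using Cons.prems(7) that by auto
    next
      case nQ: False
      then have "e' = e" "?b" "z e = None" using that(1) by (auto simp: Q1_def split: if_splits)
      moreover have "Max (V e) = tau e" using Cons.prems(6)[of e] that \<open>e' = e\<close> by (simp add: p)
      ultimately have "v = tau e" "Z e = X e" "X e > tau e" using lead(1) Zb that by auto
      then show ?thesis using False by simp
    qed
    have f: "find (matches tau Z) (p # \<sigma>) = find (matches tau Z) \<sigma>"
      using False by (simp add: p matches_def)
    have pv: "process_vertex tau c X X' t \<sigma> (z1, M, Q1) = (z', M', Q')" using step False by simp
    have p2: "z1 e' = None \<or> z1 e' = Some (Z e')" if "e' \<in> fst ` set \<sigma>" for e'
      using Cons.prems(2)[of e'] that z1e z1o[of e'] by (cases "e' = e") auto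
    have p3: "Z e' = (if accepts c t (e', Max (V e')) \<and> snd e' \<notin> snd ` M then X e' else X' e')"
      if "e' \<in> fst ` set \<sigma>" for e'
      using Cons.prems(3)[of e'] that by simp
    have p5: "v' \<le> Max (V e')" if "(e', v') \<in> set \<sigma>" for e' v'
      using Cons.prems(5)[of e' v'] that by simp
    have p6: "Max (V e') = tau e'" if "e' \<in> fst ` set \<sigma>" "X e' > tau e'" for e'
      using Cons.prems(6)[of e'] that by simp
    note IH = Cons.IH[OF pv p2 p3 l1 p5 p6 q]
    note ih = IH[THEN conjunct2, THEN conjunct2, THEN conjunct1]
      IH[THEN conjunct2, THEN conjunct2, THEN conjunct2]
    have "z' e' = z e'" if "e' \<notin> fst ` set (p # \<sigma>)" for e'
      using ih(1)[rule_format, of e'] z1o[of e'] that by (simp add: p)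
    then have z'z: "\<forall>e'. e' \<notin> fst ` set (p # \<sigma>) \<longrightarrow> z' e' = z e'" by blast
    have "Q1 \<union> fst ` set \<sigma> \<subseteq> Q \<union> fst ` set (p # \<sigma>)"
      unfolding p Q1_def by simp blast
    then have Q: "Q' \<subseteq> Q \<union> fst ` set (p # \<sigma>)" using ih(2) by (rule subset_trans[rotated])
    show ?thesis
      unfolding f using conjI[OF IH[THEN conjunct1] conjI[OF IH[THEN conjunct2, THEN conjunct1]
        conjI[OF z'z Q]]] .
  qed
qed

section \<open>Outcome vectors and complete runs\<close>

definition hits :: "('b \<Rightarrow> real) \<Rightarrow> real \<Rightarrow> (('a \<times> 'b) \<times> real) option \<Rightarrow> 'b \<Rightarrow> bool"
  where "hits c t r b \<longleftrightarrow> (\<exists>e v. r = Some (e, v) \<and> snd e = b \<and> accepts c t (e, v))"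

definition earlier :: "'a list \<Rightarrow> 'a \<Rightarrow> 'a set"
  where "earlier as a = set (takeWhile (\<lambda>a'. a' \<noteq> a) as)"

lemma earlier_append: "a \<notin> set pre \<Longrightarrow> earlier (pre @ a # post) a = set pre"
  unfolding earlier_def by (auto simp: takeWhile_append)

definition taken ::
    "('b \<Rightarrow> real) \<Rightarrow> ('a \<Rightarrow> real) \<Rightarrow> ('a \<Rightarrow> (('a \<times> 'b) \<times> real) option) \<Rightarrow> 'a set \<Rightarrow> 'b set"
  where "taken c t r A = {b. \<exists>a\<in>A. hits c (t a) (r a) b}"

definition served ::
    "('b \<Rightarrow> real) \<Rightarrow> ('a \<Rightarrow> real) \<Rightarrow> 'a list \<Rightarrow> ('a \<Rightarrow> (('a \<times> 'b) \<times> real) option)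
      \<Rightarrow> ('a \<times> 'b) \<times> real \<Rightarrow> bool"
  where "served c t as r = (\<lambda>(e, v). r (fst e) = Some (e, v) \<and> accepts c (t (fst e)) (e, v) \<and>
    snd e \<notin> taken c t r (earlier as (fst e)))"

text \<open>Neither weights nor sequences enter: outcomes of earlier vertices alone decide which
  source is read, so for fixed \<open>r\<close> this is a fixed set of edges. An edge in it need not
  be reached by the run.\<close>

definition queried ::
    "('a \<times> 'b \<Rightarrow> real set) \<Rightarrow> ('b \<Rightarrow> real) \<Rightarrow> ('a \<Rightarrow> real) \<Rightarrow> 'a list
      \<Rightarrow> ('a \<Rightarrow> (('a \<times> 'b) \<times> real) option) \<Rightarrow> ('a \<times> 'b) \<Rightarrow> bool"
  where "queried V c t as r e \<longleftrightarrow> accepts c (t (fst e)) (e, Max (V e)) \<and>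
    snd e \<notin> taken c t r (earlier as (fst e))"

definition merged :: "('e \<Rightarrow> bool) \<Rightarrow> ('e \<Rightarrow> real) \<Rightarrow> ('e \<Rightarrow> real) \<Rightarrow> 'e \<Rightarrow> real"
  where "merged P X X' e = (if P e then X e else X' e)"

text \<open>Outcomes determine the sources, and the sources determine the outcomes; a run is a fixed
  point of this loop. An equation is used instead of a recursion so that for each given
  \<open>r\<close> the event concerns one merged vector with a fixed selection of sources.\<close>

definition consistent ::
    "('a \<times> 'b \<Rightarrow> real) \<Rightarrow> ('a \<times> 'b \<Rightarrow> real set) \<Rightarrow> ('b \<Rightarrow> real) \<Rightarrow> ('a \<Rightarrow> real)
      \<Rightarrow> ('a \<Rightarrow> (('a \<times> 'b) \<times> real) list) \<Rightarrow> 'a list \<Rightarrow> ('a \<times> 'b \<Rightarrow> real) \<Rightarrow> ('a \<times> 'b \<Rightarrow> real)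
      \<Rightarrow> ('a \<Rightarrow> (('a \<times> 'b) \<times> real) option) \<Rightarrow> bool"
  where "consistent tau V c t \<sigma> as X X' r \<longleftrightarrow>
    (\<forall>a\<in>set as. r a = find (matches tau (merged (queried V c t as r) X X')) (\<sigma> a))"

definition proper_sequence ::
    "('a \<times> 'b \<Rightarrow> real set) \<Rightarrow> 'a \<Rightarrow> (('a \<times> 'b) \<times> real) list \<Rightarrow> bool"
  where "proper_sequence V a \<sigma> \<longleftrightarrow> leads_with_max V Map.empty \<sigma> \<and>
    (\<forall>(e, v)\<in>set \<sigma>. v \<le> Max (V e) \<and> fst e = a)"

lemma find_cong_set: "(\<And>x. x \<in> set xs \<Longrightarrow> P x = P' x) \<Longrightarrow> find P xs = find P' xs"
  by (induction xs) auto

lemma find_in_set: "find P xs = Some x \<Longrightarrow> x \<in> set xs \<and> P x"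
  by (induction xs) (auto split: if_splits)

text \<open>When \<open>a\<close> comes right after the prefix \<open>pre\<close>, its earlier
  vertices are exactly \<open>set pre\<close>, and the matched vertices of the other side are
  \<open>taken c t r (set pre)\<close>. Edges of \<open>a\<close> occur only in its own sequence,
  hence nothing is stored for them yet, and \<open>process_vertex_eq\<close> applies with the merged
  weights as \<open>Z\<close>.\<close>

lemma fold_process_vertex:
  fixes r :: "'a \<Rightarrow> (('a \<times> 'b) \<times> real) option"
  assumes "distinct as"
    and proper: "\<And>a. a \<in> set as \<Longrightarrow> proper_sequence V a (\<sigma> a)"
    and cons: "consistent tau V c t \<sigma> as X X' r"
    and cap: "\<And>a e v. a \<in> set as \<Longrightarrow> (e, v) \<in> set (\<sigma> a) \<Longrightarrow> X e > tau e \<Longrightarrow> Max (V e) = tau e"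
    and "as = pre @ post"
    and "fold (\<lambda>a. process_vertex tau c X X' (t a) (\<sigma> a)) pre (Map.empty, {}, {}) = (z, M, Q)"
  shows "(\<forall>e. fst e \<notin> set pre \<longrightarrow> z e = None)
      \<and> M = {e. fst e \<in> set pre \<and> (\<exists>v. served c t as r (e, v))}
      \<and> snd ` M = taken c t r (set pre)
      \<and> (\<forall>e\<in>Q. X e > tau e \<longrightarrow> e \<in> M)
      \<and> Q \<subseteq> (\<Union>a\<in>set pre. fst ` set (\<sigma> a))"
  using assms(5,6)
proof (induction pre arbitrary: post z M Q rule: rev_induct)
  case Nil
  then show ?case by (auto simp: taken_def)
next
  case (snoc a pre)
  obtain z0 M0 Q0 where f0:
    "fold (\<lambda>a. process_vertex tau c X X' (t a) (\<sigma> a)) pre (Map.empty, {}, {}) = (z0, M0, Q0)"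
    by (rule prod_cases3)
  have as: "as = pre @ a # post" using snoc.prems(1) by simp
  have a: "a \<in> set as" "a \<notin> set pre" using as \<open>distinct as\<close> by auto
  note IH0 = snoc.IH[OF as f0]
  have IH: "\<forall>e. fst e \<notin> set pre \<longrightarrow> z0 e = None"
    "M0 = {e. fst e \<in> set pre \<and> (\<exists>v. served c t as r (e, v))}"
    "snd ` M0 = taken c t r (set pre)"
    "\<forall>e\<in>Q0. X e > tau e \<longrightarrow> e \<in> M0"
    "Q0 \<subseteq> (\<Union>a\<in>set pre. fst ` set (\<sigma> a))"
    subgoal using IH0[THEN conjunct1] .
    subgoal using IH0[THEN conjunct2, THEN conjunct1] .
    subgoal using IH0[THEN conjunct2, THEN conjunct2, THEN conjunct1] .
    subgoal using IH0[THEN conjunct2, THEN conjunct2, THEN conjunct2, THEN conjunct1] .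
    subgoal using IH0[THEN conjunct2, THEN conjunct2, THEN conjunct2, THEN conjunct2] .
    done
  have pv: "process_vertex tau c X X' (t a) (\<sigma> a) (z0, M0, Q0) = (z, M, Q)"
    using snoc.prems(2) by (simp only: fold_append comp_apply f0 fold_simps)
  have ear: "earlier as a = set pre" using as a earlier_append by metis
  let ?Z = "merged (queried V c t as r) X X'"
  have fa: "fst e = a" if "e \<in> fst ` set (\<sigma> a)" for e
    using proper[OF a(1)] that unfolding proper_sequence_def by force
  have z0: "z0 e = None" if "e \<in> fst ` set (\<sigma> a)" for e
    using fa[OF that] IH(1) a by blast
  have lead: "leads_with_max V z0 (\<sigma> a)"
    using proper[OF a(1)] unfolding proper_sequence_def leads_with_max_def by auto
  have "M = (case find (matches tau ?Z) (\<sigma> a) of None \<Rightarrow> M0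
        | Some (e, v) \<Rightarrow> if accepts c (t a) (e, v) \<and> snd e \<notin> snd ` M0 then insert e M0 else M0)
      \<and> (\<forall>e\<in>Q. X e > tau e \<longrightarrow> e \<in> M)
      \<and> (\<forall>e. e \<notin> fst ` set (\<sigma> a) \<longrightarrow> z e = z0 e)
      \<and> Q \<subseteq> Q0 \<union> fst ` set (\<sigma> a)"
  proof (rule process_vertex_eq[where Z = "?Z" and V = V])
    show "process_vertex tau c X X' (t a) (\<sigma> a) (z0, M0, Q0) = (z, M, Q)" by (fact pv)
    show "z0 e = None \<or> z0 e = Some (?Z e)" if "e \<in> fst ` set (\<sigma> a)" for e
      using z0[OF that] by simp
    show "?Z e = (if accepts c (t a) (e, Max (V e)) \<and> snd e \<notin> snd ` M0 then X e else X' e)"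
      if "e \<in> fst ` set (\<sigma> a)" for e
      using fa[OF that] by (simp add: merged_def queried_def IH(3) ear)
    show "v \<le> Max (V e)" if "(e, v) \<in> set (\<sigma> a)" for e v
      using proper[OF a(1)] that unfolding proper_sequence_def by auto
    show "Max (V e) = tau e" if "e \<in> fst ` set (\<sigma> a)" "X e > tau e" for e
      using cap[OF a(1)] that by fastforce
    show "leads_with_max V z0 (\<sigma> a)" by (fact lead)
    show "\<And>e. e \<in> Q0 \<Longrightarrow> X e > tau e \<Longrightarrow> e \<in> M0" using IH(4) by blast
  qed
  moreover have "find (matches tau ?Z) (\<sigma> a) = r a"
    using cons a(1) unfolding consistent_def by simp
  ultimately have new:
    "M = (case r a of None \<Rightarrow> M0
        | Some (e, v) \<Rightarrow> if accepts c (t a) (e, v) \<and> snd e \<notin> snd ` M0 then insert e M0 else M0)"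
    "\<forall>e\<in>Q. X e > tau e \<longrightarrow> e \<in> M" "\<forall>e. e \<notin> fst ` set (\<sigma> a) \<longrightarrow> z e = z0 e"
    "Q \<subseteq> Q0 \<union> fst ` set (\<sigma> a)" by auto
  have ra: "fst e = a" if "r a = Some (e, v)" for e v
  proof -
    have "(e, v) \<in> set (\<sigma> a)"
      using cons a(1) that find_in_set unfolding consistent_def by metis
    then show ?thesis using fa[OF image_eqI[of e fst "(e, v)"]] by simp
  qed
  define S where "S = snd ` M0"
  have MS: "M = (case r a of None \<Rightarrow> M0
        | Some (e, v) \<Rightarrow> if accepts c (t a) (e, v) \<and> snd e \<notin> S then insert e M0 else M0)"
    using new(1) unfolding S_def .
  have S: "S = taken c t r (set pre)" using IH(3) by (simp add: S_def)
  have M: "M = {e. fst e \<in> set (pre @ [a]) \<and> (\<exists>v. served c t as r (e, v))}"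
  proof (rule set_eqI)
    fix e
    have "e \<in> M \<longleftrightarrow> e \<in> M0 \<or> (\<exists>v. r a = Some (e, v) \<and> accepts c (t a) (e, v) \<and> snd e \<notin> S)"
      unfolding MS by (auto split: option.splits)
    also have "\<dots> \<longleftrightarrow> e \<in> M0 \<or> (fst e = a \<and> (\<exists>v. served c t as r (e, v)))"
      using ra[of e] ear by (auto simp: served_def S)
    also have "\<dots> \<longleftrightarrow> (fst e \<in> set pre \<or> fst e = a) \<and> (\<exists>v. served c t as r (e, v))"
      unfolding IH(2) by blast
    finally show "e \<in> M \<longleftrightarrow> e \<in> {e. fst e \<in> set (pre @ [a]) \<and> (\<exists>v. served c t as r (e, v))}"
      by (simp add: disj_commute)
  qed
  have "snd ` M = S \<union> {b. hits c (t a) (r a) b}"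
    unfolding MS by (auto simp: hits_def S_def split: option.splits)
  then have sM: "snd ` M = taken c t r (set (pre @ [a]))"
    by (simp add: S taken_def) blast
  have ze: "\<forall>e. fst e \<notin> set (pre @ [a]) \<longrightarrow> z e = None"
  proof (intro allI impI)
    fix e :: "'a \<times> 'b"
    assume e: "fst e \<notin> set (pre @ [a])"
    then have "e \<notin> fst ` set (\<sigma> a)" using fa[of e] by auto
    then show "z e = None" using new(3)[rule_format, of e] IH(1)[rule_format, of e] e by simp
  qed
  have Q: "Q \<subseteq> (\<Union>a\<in>set (pre @ [a]). fst ` set (\<sigma> a))"
    using new(4) IH(5) by auto
  show ?case by (intro conjI; fact)
qed

text \<open>The selection of sources at a vertex refers to \<open>r\<close> only through earlier
  vertices, so agreement spreads along the order from the left.\<close>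

lemma consistent_unique:
  assumes "distinct as" "\<And>a. a \<in> set as \<Longrightarrow> proper_sequence V a (\<sigma> a)"
    and "consistent tau V c t \<sigma> as X X' r" "consistent tau V c t \<sigma> as X X' r'"
    and "a \<in> set as"
  shows "r a = r' a"
proof -
  have "\<forall>a\<in>set pre. r a = r' a" if "as = pre @ post" for pre post
    using that
  proof (induction pre arbitrary: post rule: rev_induct)
    case (snoc a pre)
    have as: "as = pre @ a # post" using snoc.prems by simp
    then have a: "a \<in> set as" "a \<notin> set pre" using \<open>distinct as\<close> by auto
    have ear: "earlier as a = set pre" using as a earlier_append by metis
    have IH: "\<forall>a\<in>set pre. r a = r' a" using snoc.IH as by blast
    then have tk: "taken c t r (set pre) = taken c t r' (set pre)" unfolding taken_def by auto
    have "find (matches tau (merged (queried V c t as r) X X')) (\<sigma> a) =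
        find (matches tau (merged (queried V c t as r') X X')) (\<sigma> a)"
    proof (rule find_cong_set)
      fix p assume p: "p \<in> set (\<sigma> a)"
      then have "fst (fst p) = a"
        using assms(2)[OF a(1)] unfolding proper_sequence_def by force
      then show "matches tau (merged (queried V c t as r) X X') p =
          matches tau (merged (queried V c t as r') X X') p"
        by (auto simp: matches_def merged_def queried_def ear tk split: prod.split)
    qed
    then have "r a = r' a" using assms(3,4) a(1) unfolding consistent_def by auto
    with IH show ?case by auto
  qed simp
  from this[of as "[]"] assms(5) show ?thesis by auto
qed

text \<open>Until \<open>e\<close> is queried, its weight has not been looked at.\<close>

lemma process_vertex_query_indep:
  assumes "s = s' \<or> (e \<in> snd (snd s) \<and> e \<in> snd (snd s'))"
  shows "process_vertex tau c X X' t \<sigma> s = process_vertex tau c (X(e := w)) X' t \<sigma> s' \<or>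
    (e \<in> snd (snd (process_vertex tau c X X' t \<sigma> s)) \<and>
     e \<in> snd (snd (process_vertex tau c (X(e := w)) X' t \<sigma> s')))"
  using assms
proof -
  have mono: "e \<in> snd (snd s) \<Longrightarrow> e \<in> snd (snd (process_vertex tau c X X' t \<sigma> s))" for X s \<sigma>
  proof (induction \<sigma> arbitrary: s)
    case (Cons p \<sigma>)
    then show ?case by (cases p; cases s) (auto simp: Let_def)
  qed simp
  \<comment> \<open>The weight of \<open>e\<close> is read only in a branch that inserts
    \<open>e\<close> into the queried set, and that set never shrinks. Having \<open>e\<close> in
    both sets is thus an absorbing alternative to equality of the states.\<close>
  have same: "process_vertex tau c X X' t \<sigma> s = process_vertex tau c (X(e := w)) X' t \<sigma> s \<or>
    (e \<in> snd (snd (process_vertex tau c X X' t \<sigma> s)) \<and>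
     e \<in> snd (snd (process_vertex tau c (X(e := w)) X' t \<sigma> s)))" for s
  proof (induction \<sigma> arbitrary: s)
    case (Cons p \<sigma>)
    obtain f v where p: "p = (f, v)" by (cases p)
    obtain z M Q where s: "s = (z, M, Q)" by (rule prod_cases3)
    show ?case
    proof (cases "f = e \<and> z e = None \<and> (1 - exp (t - 1)) * c (snd f) \<le> v \<and> snd f \<notin> snd ` M")
      case True
      then have fe: "f = e" and *: "z e = None" "(1 - exp (t - 1)) * c (snd e) \<le> v"
        "snd e \<notin> snd ` M" by auto
      have "e \<in> snd (snd (process_vertex tau c Y X' t (p # \<sigma>) s))" for Y
        using mono[of "(z(e \<mapsto> Y e), M, insert e Q)" Y] * by (auto simp: p s fe Let_def)
      then show ?thesis by blast
    next
      case False
      let ?z = "if z f = None then z(f \<mapsto> X' f) else z"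
      consider "(1 - exp (t - 1)) * c (snd f) \<le> v" "snd f \<notin> snd ` M" "z f = None" "f \<noteq> e"
        | "(1 - exp (t - 1)) * c (snd f) \<le> v" "snd f \<notin> snd ` M" "z f \<noteq> None"
        | "\<not> (1 - exp (t - 1)) * c (snd f) \<le> v" | "snd f \<in> snd ` M"
        using False by metis
      then show ?thesis
      proof cases
        case 1
        then show ?thesis
          using Cons.IH[of "(z(f \<mapsto> X f), M, insert f Q)"] by (simp add: p s Let_def)
      next
        case 2
        then obtain y where "z f = Some y" by auto
        with 2 show ?thesis
          using Cons.IH[of "(z, M, Q)"] by (simp add: p s Let_def del: fun_upd_apply)
      next
        case 3
        then show ?thesis
          using Cons.IH[of "(?z, M, Q)"]
          by (cases "z f") (simp_all add: p s Let_def del: fun_upd_apply)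
      next
        case 4
        then show ?thesis
          using Cons.IH[of "(?z, M, Q)"]
          by (cases "z f") (simp_all add: p s Let_def del: fun_upd_apply)
      qed
    qed
  qed simp
  show ?thesis
    using assms
  proof (elim disjE)
    assume "s = s'"
    then show ?thesis using same[of s] by (simp del: fun_upd_apply)
  next
    assume "e \<in> snd (snd s) \<and> e \<in> snd (snd s')"
    then show ?thesis using mono by blast
  qed
qed

text \<open>This makes the decision to query \<open>e\<close> independent of the weight of
  \<open>e\<close>, and hence the expected cost of queries equal to the expected excess on queried
  edges.\<close>

lemma approx_poi_query_indep:
  "e \<in> snd (approx_poi A E tau V x \<sigma> t X X') \<longleftrightarrow> e \<in> snd (approx_poi A E tau V x \<sigma> t (X(e := w)) X')"
proof -
  let ?P = "\<lambda>X a. process_vertex tau (load E V x) X X' (t a) (\<sigma> a)"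
  let ?eq = "\<lambda>s s'. s = s' \<or> (e \<in> snd (snd s) \<and> e \<in> snd (snd s'))"
  have "?eq (fold (?P X) as s) (fold (?P (X(e := w))) as s')" if "?eq s s'" for as s s'
    using that
  proof (induction as arbitrary: s s')
    case (Cons a as)
    have "?eq (?P X a s) (?P (X(e := w)) a s')"
      by (rule process_vertex_query_indep[OF Cons.prems])
    from Cons.IH[OF this] show ?case by (simp only: fold_simps)
  qed (simp only: fold_simps)
  from this[OF disjI1[OF refl], of "arrival_order A t" "(Map.empty, {}, {})"]
  show ?thesis unfolding approx_poi_def by (elim disjE) (simp_all only:)
qed

lemma arrival_order:
  assumes "finite A"
  shows "distinct (arrival_order A t)" "set (arrival_order A t) = A" "sorted (map t (arrival_order A t))"
proof -
  have "\<exists>as. distinct as \<and> set as = A" using finite_distinct_list[OF assms] by blast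
  from someI_ex[OF this]
  show "distinct (arrival_order A t)" "set (arrival_order A t) = A" "sorted (map t (arrival_order A t))"
    unfolding arrival_order_def by auto
qed

lemma earlier_arrival:
  assumes "finite A" "a \<in> A" "a' \<in> earlier (arrival_order A t) a"
  shows "a' \<in> A" "a' \<noteq> a" "t a' \<le> t a"
proof -
  note ao = arrival_order[OF assms(1), of t]
  obtain pre post where as: "arrival_order A t = pre @ a # post"
    using ao(2) assms(2) by (metis split_list)
  then have "a' \<in> set pre" using assms(3) earlier_append ao(1) by fastforce
  then show "a' \<in> A" "a' \<noteq> a" "t a' \<le> t a" using ao as by (auto simp: sorted_append)
qed

subsection \<open>The linear program bounds the optimum\<close>

lemma distr_pair_snd:
  assumes "prob_space M" "prob_space N"
  shows "distr (M \<Otimes>\<^sub>M N) N snd = N"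
proof (intro measure_eqI)
  interpret M: prob_space M by fact
  interpret N: prob_space N by fact
  fix A assume A: "A \<in> sets (distr (M \<Otimes>\<^sub>M N) N snd)"
  then have "emeasure (distr (M \<Otimes>\<^sub>M N) N snd) A = emeasure (M \<Otimes>\<^sub>M N) (space M \<times> A)"
    by (auto simp: emeasure_distr space_pair_measure dest: sets.sets_into_space
        intro!: arg_cong2[where f = emeasure])
  with A show "emeasure (distr (M \<Otimes>\<^sub>M N) N snd) A = emeasure N A"
    by (simp add: N.emeasure_pair_measure_Times M.emeasure_space_1)
qed simp

text \<open>Since \<open>f\<close> ignores coordinate \<open>i\<close>, integrating this coordinate
  first pulls \<open>f\<close> out of the inner integral. Invariance under updates is the form in
  which the algorithms supply the independence.\<close>

lemma (in product_prob_space) integral_indep_coordinate: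
  fixes f :: "('i \<Rightarrow> 'a) \<Rightarrow> real" and g :: "'a \<Rightarrow> real"
  assumes I: "finite I" "i \<in> I"
    and f[measurable]: "f \<in> borel_measurable (PiM I M)" and bound: "\<And>X. \<bar>f X\<bar> \<le> C"
    and g: "integrable (M i) g"
    and inv: "\<And>X w. f (X(i := w)) = f X"
  shows "(\<integral>X. f X * g (X i) \<partial>PiM I M) = (\<integral>X. f X \<partial>PiM I M) * (\<integral>w. g w \<partial>M i)"
proof -
  define J where "J = I - {i}"
  have J: "finite J" "i \<notin> J" "insert i J = I" using I by (auto simp: J_def)
  have gi: "integrable (PiM I M) (\<lambda>X. g (X i))"
    using integrable_distr[of "\<lambda>X. X i" "PiM I M" "M i" g] I g
    by (simp add: PiM_component)
  have ifg: "integrable (PiM I M) (\<lambda>X. f X * g (X i))"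
  proof (rule Bochner_Integration.integrable_bound[OF integrable_mult_right[OF gi, of C]])
    show "(\<lambda>X. f X * g (X i)) \<in> borel_measurable (PiM I M)" using gi by measurable
    show "AE X in PiM I M. norm (f X * g (X i)) \<le> norm (C * g (X i))"
    proof (intro AE_I2)
      fix X
      have "\<bar>f X\<bar> \<le> \<bar>C\<bar>" using bound[of X] by linarith
      then show "norm (f X * g (X i)) \<le> norm (C * g (X i))"
        by (simp add: abs_mult mult_right_mono)
    qed
  qed
  have fi: "integrable (PiM I M) f"
    using bound by (intro P.integrable_const_bound[of f C]) simp_all
  have "(\<integral>X. f X * g (X i) \<partial>PiM I M) = (\<integral>X. (\<integral>w. f X * g w \<partial>M i) \<partial>PiM J M)"
    using product_integral_insert[OF J(1,2), of "\<lambda>X. f X * g (X i)"] ifg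
    by (simp add: J(3) inv del: integral_mult_right_zero)
  also have "\<dots> = (\<integral>X. f X \<partial>PiM J M) * (\<integral>w. g w \<partial>M i)" by simp
  \<comment> \<open>On the smaller product \<open>f\<close> is evaluated at points whose coordinate
    \<open>i\<close> is \<open>undefined\<close>; \<open>inv\<close> identifies this with the value
    at any extension.\<close>
  also have "(\<integral>X. f X \<partial>PiM J M) = (\<integral>X. f X \<partial>PiM I M)"
    using product_integral_insert[OF J(1,2), of f] fi by (simp add: J(3) inv M.prob_space)
  finally show ?thesis .
qed

text \<open>A run cannot branch on the weight of \<open>e\<close> before the node that queries
  \<open>e\<close>, and from that node on membership is settled.\<close>

lemma run_tree_query_indep:
  "e \<in> snd (run_tree T X) \<longleftrightarrow> e \<in> snd (run_tree T (X(e := w)))"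
  by (induction T) (auto simp: case_prod_unfold Let_def)

lemma run_tree_valid:
  "valid_tree E T Q \<Longrightarrow> fst (run_tree T X) \<subseteq> Q \<union> snd (run_tree T X) \<and>
    matching (fst (run_tree T X)) \<and> snd (run_tree T X) \<subseteq> E"
proof (induction T arbitrary: Q)
  case (Query e k)
  then have "valid_tree E (k (X e)) (insert e Q)" by simp
  from Query.IH[OF _ this] Query.prems show ?case by (auto simp: case_prod_unfold Let_def)
qed simp

text \<open>\<open>prob_D\<close> and \<open>sets_D\<close> range over all pairs and not only over
  \<open>E\<close>, because the product locale asks this of the whole family;
  \<open>theorem2\<close> arranges it by replacing \<open>D\<close> outside \<open>E\<close>. In
  \<open>cap_in_V\<close>, nonpositive capped weights may lie outside \<open>V e\<close>; they
  account for the mass missing in \<open>prob_value_sum\<close>.\<close>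

locale poi_instance =
  fixes A :: "'a set" and B :: "'b set" and E :: "('a \<times> 'b) set"
    and D :: "'a \<times> 'b \<Rightarrow> real measure"
    and cost tau :: "'a \<times> 'b \<Rightarrow> real"
    and V :: "'a \<times> 'b \<Rightarrow> real set"
  assumes finite_A: "finite A" and finite_B: "finite B" and E_subset: "E \<subseteq> A \<times> B"
    and prob_D: "\<And>e. prob_space (D e)"
    and sets_D[measurable_cong]: "\<And>e. sets (D e) = sets borel"
    and nonneg_D: "\<And>e. e \<in> E \<Longrightarrow> AE w in D e. 0 \<le> w"
    and cost_nonneg: "\<And>e. e \<in> E \<Longrightarrow> 0 \<le> cost e"
    and cost_eq: "\<And>e. e \<in> E \<Longrightarrow> has_bochner_integral (D e) (\<lambda>w. max (w - tau e) 0) (cost e)"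
    and finite_V: "\<And>e. e \<in> E \<Longrightarrow> finite (V e)"
    and cap_in_V: "\<And>e. e \<in> E \<Longrightarrow> AE w in D e. min w (tau e) \<in> V e \<or> min w (tau e) \<le> 0"
    and prob_value_pos: "\<And>e v. e \<in> E \<Longrightarrow> v \<in> V e \<Longrightarrow> prob_value D tau e v > 0"
    and prob_value_sum: "\<And>e. e \<in> E \<Longrightarrow> (\<Sum>v\<in>V e. prob_value D tau e v) < 1"
begin

sublocale product_prob_space D E
  by (rule product_prob_spaceI) (rule prob_D)

lemma finite_E: "finite E"
  using finite_subset[OF E_subset] finite_A finite_B by simp

lemma finite_Sigma_V: "finite (Sigma E V)"
  using finite_E finite_V by auto

lemma space_D[simp]: "space (D e) = UNIV"
  using sets_eq_imp_space_eq[OF sets_D[of e]] by simp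

text \<open>Every value in \<open>V e\<close> is attained, which gives the upper bound. A
  nonpositive value in \<open>V e\<close> would, by nonnegativity of the weight, be the only
  possible nonpositive capped weight, so \<open>V e\<close> would carry the whole mass, against
  \<open>prob_value_sum\<close>.\<close>

lemma V_bounds:
  assumes e: "e \<in> E" and v: "v \<in> V e"
  shows "0 < v" "v \<le> tau e"
proof -
  have AE_ex: "\<exists>w. min w (tau e) = u \<and> P w" if "u \<in> V e" "AE w in D e. P w" for u P
  proof (rule ccontr)
    assume "\<not> ?thesis"
    then have "AE w in D e. \<not> min w (tau e) = u" using that(2) by (auto elim!: eventually_mono)
    then have "prob_value D tau e u = 0"
      unfolding prob_value_def by (subst M.prob_Collect_eq_0) auto
    then show False using prob_value_pos[OF e that(1)] by simp
  qed
  from AE_ex[OF v, of "\<lambda>_. True"] show "v \<le> tau e" by auto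
  show "0 < v"
  proof (rule ccontr)
    assume v0: "\<not> 0 < v"
    from AE_ex[OF v nonneg_D[OF e]] obtain w where w: "min w (tau e) = v" "0 \<le> w" by auto
    have "AE w in D e. min w (tau e) \<in> V e"
      using cap_in_V[OF e] nonneg_D[OF e]
    proof eventually_elim
      case (elim w')
      then have "min w' (tau e) = v" if "min w' (tau e) \<le> 0"
        using that w v0 by (auto simp: min_def split: if_splits)
      then show ?case using elim v by auto
    qed
    moreover have "(\<Sum>u\<in>V e. prob_value D tau e u) = measure (D e) (\<Union>u\<in>V e. {w. min w (tau e) = u})"
      unfolding prob_value_def
      by (subst M.finite_measure_finite_Union) (auto simp: disjoint_family_on_def finite_V[OF e])
    moreover have "(\<Union>u\<in>V e. {w. min w (tau e) = u}) = {w \<in> space (D e). min w (tau e) \<in> V e}" by auto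
    moreover have "{w \<in> space (D e). min w (tau e) \<in> V e} \<in> sets (D e)"
      using measurable_sets[of "\<lambda>w. min w (tau e)" "D e" borel "V e"] finite_V[OF e]
      by (simp add: vimage_def borel_closed finite_imp_closed)
    ultimately have "(\<Sum>u\<in>V e. prob_value D tau e u) = 1"
      by (subst (asm) M.prob_Collect_eq_1[symmetric]) auto
    then show False using prob_value_sum[OF e] by simp
  qed
qed

lemma integrable_D:
  assumes "e \<in> E"
  shows "integrable (D e) (\<lambda>w. w)" "integrable (D e) (\<lambda>w. max (w - tau e) 0)"
    "(\<integral>w. max (w - tau e) 0 \<partial>D e) = cost e"
proof -
  show i: "integrable (D e) (\<lambda>w. max (w - tau e) 0)" "(\<integral>w. max (w - tau e) 0 \<partial>D e) = cost e"
    using cost_eq[OF assms] by (auto simp: has_bochner_integral_iff)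
  \<comment> \<open>A nonnegative weight is at most its excess plus the absolute value of the
    cap.\<close>
  have "integrable (D e) (\<lambda>w. max (w - tau e) 0 + \<bar>tau e\<bar>)"
    using i by simp
  then show "integrable (D e) (\<lambda>w. w)"
  proof (rule Bochner_Integration.integrable_bound)
    show "AE w in D e. norm w \<le> norm (max (w - tau e) 0 + \<bar>tau e\<bar>)"
      using nonneg_D[OF assms] by eventually_elim auto
  qed simp
qed

lemma integrable_weight:
  assumes e: "e \<in> E" and Y: "Y \<in> borel_measurable W" and d: "distr W (D e) Y = D e"
  shows "integrable W Y" "integrable W (\<lambda>\<omega>. max (Y \<omega> - tau e) 0)"
proof -
  have m: "Y \<in> W \<rightarrow>\<^sub>M D e" using Y by (simp cong: measurable_cong_sets add: sets_D)
  show "integrable W Y" "integrable W (\<lambda>\<omega>. max (Y \<omega> - tau e) 0)"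
    using integrable_distr[OF m, of "\<lambda>w. w"] integrable_distr[OF m, of "\<lambda>w. max (w - tau e) 0"]
      integrable_D[OF e] d by auto
qed

lemma integral_excess_indep:
  assumes e: "e \<in> E" and P: "(\<lambda>X. of_bool (P X) :: real) \<in> borel_measurable (PiM E D)"
    and inv: "\<And>X w. P (X(e := w)) = P X"
  shows "(\<integral>X. of_bool (P X) * max (X e - tau e) 0 \<partial>PiM E D) = (\<integral>X. of_bool (P X) \<partial>PiM E D) * cost e"
  using integral_indep_coordinate[OF finite_E e P, of 1 "\<lambda>w. max (w - tau e) 0"]
    integrable_D[OF e] inv by simp

lemma poi_utility_eq_sum:
  assumes "fst r \<subseteq> E" "snd r \<subseteq> E"
  shows "poi_utility cost X r = (\<Sum>e\<in>E. of_bool (e \<in> fst r) * X e - of_bool (e \<in> snd r) * cost e)"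
proof -
  have *: "sum g S = (\<Sum>e\<in>E. of_bool (e \<in> S) * g e)" if "S \<subseteq> E" for S and g :: "_ \<Rightarrow> real"
    using finite_E that by (intro sum.mono_neutral_cong_left) auto
  show ?thesis
    using assms
    by (simp add: poi_utility_def case_prod_unfold sum_subtractf *[of "fst r"] *[of "snd r"])
qed

text \<open>The weights are random variables on an arbitrary space \<open>W\<close>, because the
  same facts serve seeds with weights, true with simulated weights, and arrival times with
  both.\<close>

lemma integrable_utility:
  assumes "prob_space W"
    and X: "\<And>e. e \<in> E \<Longrightarrow> (\<lambda>\<omega>. X \<omega> e) \<in> borel_measurable W"
      "\<And>e. e \<in> E \<Longrightarrow> distr W (D e) (\<lambda>\<omega>. X \<omega> e) = D e"
    and res: "res \<in> W \<rightarrow>\<^sub>M count_space UNIV"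
      "\<And>\<omega>. \<omega> \<in> space W \<Longrightarrow> fst (res \<omega>) \<subseteq> E \<and> snd (res \<omega>) \<subseteq> E"
  shows "\<And>e. e \<in> E \<Longrightarrow> integrable W (\<lambda>\<omega>. of_bool (e \<in> fst (res \<omega>)) * X \<omega> e)"
    and "\<And>e. e \<in> E \<Longrightarrow> integrable W (\<lambda>\<omega>. of_bool (e \<in> snd (res \<omega>)) * cost e)"
    and "\<And>e. e \<in> E \<Longrightarrow> integrable W (\<lambda>\<omega>. of_bool (e \<in> snd (res \<omega>)) * max (X \<omega> e - tau e) 0)"
    and "integrable W (\<lambda>\<omega>. poi_utility cost (X \<omega>) (res \<omega>))"
proof -
  interpret W: prob_space W by fact
  have b: "(\<lambda>\<omega>. of_bool (P (res \<omega>)) :: real) \<in> borel_measurable W" for P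
    by (rule measurable_compose[OF res(1)]) simp
  have iX: "integrable W (\<lambda>\<omega>. X \<omega> e)" "integrable W (\<lambda>\<omega>. max (X \<omega> e - tau e) 0)"
    if "e \<in> E" for e
    using integrable_weight[OF that X(1)[OF that] X(2)[OF that]] .
  have bd: "integrable W (\<lambda>\<omega>. of_bool (P (res \<omega>)) * g \<omega> :: real)" if "integrable W g" for P g
    using that b[of P] by (rule_tac Bochner_Integration.integrable_bound[of W g]) auto
  show i1: "integrable W (\<lambda>\<omega>. of_bool (e \<in> fst (res \<omega>)) * X \<omega> e)"
    "integrable W (\<lambda>\<omega>. of_bool (e \<in> snd (res \<omega>)) * cost e)"
    "integrable W (\<lambda>\<omega>. of_bool (e \<in> snd (res \<omega>)) * max (X \<omega> e - tau e) 0)" if e: "e \<in> E" for e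
    using bd[OF iX(1)[OF e], of "\<lambda>r. e \<in> fst r"] bd[of "\<lambda>_. cost e" "\<lambda>r. e \<in> snd r"]
      bd[OF iX(2)[OF e], of "\<lambda>r. e \<in> snd r"] by simp_all
  have "integrable W (\<lambda>\<omega>. \<Sum>e\<in>E. of_bool (e \<in> fst (res \<omega>)) * X \<omega> e - of_bool (e \<in> snd (res \<omega>)) * cost e)"
    using i1 by auto
  then show "integrable W (\<lambda>\<omega>. poi_utility cost (X \<omega>) (res \<omega>))"
    by (rule Bochner_Integration.integrable_cong[THEN iffD2, rotated 2])
      (use res(2) in \<open>auto simp: poi_utility_eq_sum\<close>)
qed

text \<open>Paying \<open>cost e\<close> for a query is, in expectation, giving up the excess of the weight over the cap.\<close>

lemma expected_utility_excess:
  assumes "prob_space W"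
    and X: "\<And>e. e \<in> E \<Longrightarrow> (\<lambda>\<omega>. X \<omega> e) \<in> borel_measurable W"
      "\<And>e. e \<in> E \<Longrightarrow> distr W (D e) (\<lambda>\<omega>. X \<omega> e) = D e"
    and res: "res \<in> W \<rightarrow>\<^sub>M count_space UNIV"
      "\<And>\<omega>. \<omega> \<in> space W \<Longrightarrow> fst (res \<omega>) \<subseteq> E \<and> snd (res \<omega>) \<subseteq> E"
    and indep: "\<And>e. e \<in> E \<Longrightarrow> (\<integral>\<omega>. of_bool (e \<in> snd (res \<omega>)) * max (X \<omega> e - tau e) 0 \<partial>W) =
      cost e * (\<integral>\<omega>. of_bool (e \<in> snd (res \<omega>)) \<partial>W)"
  shows "integrable W (\<lambda>\<omega>. \<Sum>e\<in>E. of_bool (e \<in> fst (res \<omega>)) * X \<omega> e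
        - of_bool (e \<in> snd (res \<omega>)) * max (X \<omega> e - tau e) 0)"
    and "(\<integral>\<omega>. poi_utility cost (X \<omega>) (res \<omega>) \<partial>W) =
      (\<integral>\<omega>. (\<Sum>e\<in>E. of_bool (e \<in> fst (res \<omega>)) * X \<omega> e
        - of_bool (e \<in> snd (res \<omega>)) * max (X \<omega> e - tau e) 0) \<partial>W)"
proof -
  note i1 = integrable_utility(1-3)[where W = W and X = X and res = res, OF assms(1-5)]
  show "integrable W (\<lambda>\<omega>. \<Sum>e\<in>E. of_bool (e \<in> fst (res \<omega>)) * X \<omega> e
        - of_bool (e \<in> snd (res \<omega>)) * max (X \<omega> e - tau e) 0)"
    using i1 by auto
  have "(\<integral>\<omega>. poi_utility cost (X \<omega>) (res \<omega>) \<partial>W) =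
      (\<integral>\<omega>. (\<Sum>e\<in>E. of_bool (e \<in> fst (res \<omega>)) * X \<omega> e - of_bool (e \<in> snd (res \<omega>)) * cost e) \<partial>W)"
    by (rule Bochner_Integration.integral_cong) (use res(2) in \<open>auto simp: poi_utility_eq_sum\<close>)
  also have "\<dots> = (\<Sum>e\<in>E. (\<integral>\<omega>. of_bool (e \<in> fst (res \<omega>)) * X \<omega> e \<partial>W)
      - (\<integral>\<omega>. of_bool (e \<in> snd (res \<omega>)) * cost e \<partial>W))"
    using i1 by simp
  also have "\<dots> = (\<Sum>e\<in>E. (\<integral>\<omega>. of_bool (e \<in> fst (res \<omega>)) * X \<omega> e \<partial>W)
      - (\<integral>\<omega>. of_bool (e \<in> snd (res \<omega>)) * max (X \<omega> e - tau e) 0 \<partial>W))"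
    using indep by (simp add: mult.commute)
  also have "\<dots> = (\<integral>\<omega>. (\<Sum>e\<in>E. of_bool (e \<in> fst (res \<omega>)) * X \<omega> e
        - of_bool (e \<in> snd (res \<omega>)) * max (X \<omega> e - tau e) 0) \<partial>W)"
    using i1 by simp
  finally show "(\<integral>\<omega>. poi_utility cost (X \<omega>) (res \<omega>) \<partial>W) =
      (\<integral>\<omega>. (\<Sum>e\<in>E. of_bool (e \<in> fst (res \<omega>)) * X \<omega> e
        - of_bool (e \<in> snd (res \<omega>)) * max (X \<omega> e - tau e) 0) \<partial>W)" .
qed

text \<open>The events on the left are disjoint: at most one edge of \<open>F\<close> is matched,
  and its weight fixes the value. Their union lies in the event on the right. When \<open>F\<close>
  sits at one vertex, \<open>uniq\<close> is the matching property and the claim becomes a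
  constraint of the linear program.\<close>

lemma matching_sum_le:
  assumes "prob_space W"
    and [measurable]: "\<And>e. e \<in> E \<Longrightarrow> (\<lambda>\<omega>. X \<omega> e) \<in> borel_measurable W"
    and res: "res \<in> W \<rightarrow>\<^sub>M count_space UNIV"
    and "F \<subseteq> Sigma E V"
    and uniq: "\<And>\<omega> e v e' v'. \<omega> \<in> space W \<Longrightarrow> (e, v) \<in> F \<Longrightarrow> (e', v') \<in> F \<Longrightarrow>
      e \<in> fst (res \<omega>) \<Longrightarrow> e' \<in> fst (res \<omega>) \<Longrightarrow> e = e'"
  shows "(\<Sum>(e, v)\<in>F. measure W {\<omega> \<in> space W. e \<in> fst (res \<omega>) \<and> min (X \<omega> e) (tau e) = v})
    \<le> measure W {\<omega> \<in> space W. \<exists>(e, v)\<in>F. min (X \<omega> e) (tau e) = v}"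
proof -
  interpret W: prob_space W by fact
  have F: "finite F" using finite_subset[OF assms(4) finite_Sigma_V] .
  have FE: "e \<in> E" if "(e, v) \<in> F" for e v using that assms(4) by auto
  let ?S = "\<lambda>(e, v). {\<omega> \<in> space W. e \<in> fst (res \<omega>) \<and> min (X \<omega> e) (tau e) = v}"
  have m1: "{\<omega> \<in> space W. min (X \<omega> e) (tau e) = v} \<in> sets W" if "(e, v) \<in> F" for e v
    using FE[OF that] by measurable
  have m2: "{\<omega> \<in> space W. P (res \<omega>)} \<in> sets W" for P
    using measurable_sets[OF res, of "Collect P"] by (simp add: vimage_def Int_def conj_commute)
  have m: "?S p \<in> sets W" if "p \<in> F" for p
  proof (cases p)
    case (Pair e v)
    then have "?S p = {\<omega> \<in> space W. e \<in> fst (res \<omega>)} \<inter> {\<omega> \<in> space W. min (X \<omega> e) (tau e) = v}" by auto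
    then show ?thesis using m1 m2[of "\<lambda>r. e \<in> fst r"] that Pair by auto
  qed
  have "disjoint_family_on ?S F"
    unfolding disjoint_family_on_def using uniq by fastforce
  then have "(\<Sum>p\<in>F. measure W (?S p)) = measure W (\<Union>p\<in>F. ?S p)"
    using m by (intro W.finite_measure_finite_Union[symmetric] F) blast+
  also have "\<dots> \<le> measure W {\<omega> \<in> space W. \<exists>(e, v)\<in>F. min (X \<omega> e) (tau e) = v}"
  proof (rule W.finite_measure_mono)
    have "{\<omega> \<in> space W. \<exists>(e, v)\<in>F. min (X \<omega> e) (tau e) = v} =
        (\<Union>(e, v)\<in>F. {\<omega> \<in> space W. min (X \<omega> e) (tau e) = v})" by auto
    then show "{\<omega> \<in> space W. \<exists>(e, v)\<in>F. min (X \<omega> e) (tau e) = v} \<in> sets W"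
      using F m1 by (auto intro!: sets.finite_UN)
  qed auto
  finally show ?thesis by (simp add: case_prod_unfold)
qed

lemma expected_utility_le_lp:
  assumes alg: "(R, T) \<in> poi_algorithms E D"
    and opt: "lp_optimal A B E D tau V x"
  shows "expected_utility E D cost (R, T) \<le> lp_value E V x"
proof -
  let ?N = "PiM E D" let ?W = "R \<Otimes>\<^sub>M PiM E D"
  define res where "res = (\<lambda>(s, X). run_tree (T s) X)"
  have R: "prob_space R" and valid: "\<And>s. s \<in> space R \<Longrightarrow> valid_tree E (T s) {}"
    and res[measurable]: "res \<in> ?W \<rightarrow>\<^sub>M count_space UNIV"
    using alg by (auto simp: poi_algorithms_def res_def)
  interpret R: prob_space R by fact
  interpret W: pair_prob_space R ?N ..
  have valid_res: "fst (res \<omega>) \<subseteq> snd (res \<omega>)" "matching (fst (res \<omega>))" "snd (res \<omega>) \<subseteq> E"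
    if "\<omega> \<in> space ?W" for \<omega>
    using run_tree_valid[OF valid, of "fst \<omega>" "snd \<omega>"] that
    by (auto simp: res_def space_pair_measure case_prod_unfold)
  have Xm[measurable]: "(\<lambda>\<omega>. snd \<omega> e) \<in> borel_measurable ?W" if "e \<in> E" for e
    using that by measurable
  have Xd: "distr ?W (D e) (\<lambda>\<omega>. snd \<omega> e) = D e" if "e \<in> E" for e
  proof -
    have "distr ?W (D e) (\<lambda>\<omega>. snd \<omega> e) = distr (distr ?W ?N snd) (D e) (\<lambda>X. X e)"
      using that by (subst distr_distr) (auto simp: comp_def)
    then show ?thesis
      using that by (simp add: distr_pair_snd[OF R P.prob_space_axioms] PiM_component)
  qed
  have indep: "(\<integral>\<omega>. of_bool (e \<in> snd (res \<omega>)) * max (snd \<omega> e - tau e) 0 \<partial>?W) =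
      cost e * (\<integral>\<omega>. of_bool (e \<in> snd (res \<omega>)) \<partial>?W)" if e: "e \<in> E" for e
  proof -
    have b[measurable]: "(\<lambda>\<omega>. of_bool (e \<in> snd (res \<omega>)) :: real) \<in> borel_measurable ?W"
      by (rule measurable_compose[OF res]) simp
    have "integrable ?W (\<lambda>\<omega>. max (snd \<omega> e - tau e) 0)"
      by (rule integrable_weight[OF e Xm[OF e] Xd[OF e]])
    then have i: "integrable ?W (\<lambda>\<omega>. of_bool (e \<in> snd (res \<omega>)) * max (snd \<omega> e - tau e) 0)"
    proof (rule Bochner_Integration.integrable_bound)
      show "(\<lambda>\<omega>. of_bool (e \<in> snd (res \<omega>)) * max (snd \<omega> e - tau e) 0) \<in> borel_measurable ?W"
        using Xm[OF e] b by simp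
    qed auto
    have i': "integrable ?W (\<lambda>\<omega>. of_bool (e \<in> snd (res \<omega>)) :: real)"
      by (rule W.P.integrable_const_bound[where B = 1]) (use b in simp_all)
    \<comment> \<open>For a fixed seed the tree is deterministic, and its decision to query
      \<open>e\<close> ignores the weight of \<open>e\<close>; the seed is averaged last.\<close>
    have "(\<integral>\<omega>. of_bool (e \<in> snd (res \<omega>)) * max (snd \<omega> e - tau e) 0 \<partial>?W) =
        (\<integral>s. (\<integral>X. of_bool (e \<in> snd (res (s, X))) * max (X e - tau e) 0 \<partial>?N) \<partial>R)"
      using W.integral_fst'[OF i] by simp
    also have "\<dots> = (\<integral>s. (\<integral>X. of_bool (e \<in> snd (res (s, X))) \<partial>?N) * cost e \<partial>R)"
    proof (rule Bochner_Integration.integral_cong[OF refl])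
      fix s assume s: "s \<in> space R"
      have "(\<lambda>X. of_bool (e \<in> snd (res (s, X))) :: real) \<in> borel_measurable ?N"
        using measurable_compose[OF measurable_Pair1'[OF s] b] by simp
      then show "(\<integral>X. of_bool (e \<in> snd (res (s, X))) * max (X e - tau e) 0 \<partial>?N) =
          (\<integral>X. of_bool (e \<in> snd (res (s, X))) \<partial>?N) * cost e"
        by (rule integral_excess_indep[OF e]) (simp add: res_def run_tree_query_indep[symmetric])
    qed
    also have "\<dots> = cost e * (\<integral>\<omega>. of_bool (e \<in> snd (res \<omega>)) \<partial>?W)"
      using W.integral_fst'[OF i'] by (simp add: mult.commute)
    finally show ?thesis .
  qed
  have sub: "fst (res \<omega>) \<subseteq> E \<and> snd (res \<omega>) \<subseteq> E" if "\<omega> \<in> space ?W" for \<omega>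
    using valid_res[OF that] by auto
  note acc = expected_utility_excess[OF W.P.prob_space_axioms Xm Xd res sub indep]
  let ?p = "\<lambda>e v. measure ?W {\<omega> \<in> space ?W. e \<in> fst (res \<omega>) \<and> min (snd \<omega> e) (tau e) = v}"
  have ms: "{\<omega> \<in> space ?W. e \<in> fst (res \<omega>) \<and> min (snd \<omega> e) (tau e) = v} \<in> sets ?W" if "e \<in> E" for e v
  proof -
    have "Measurable.pred ?W (\<lambda>\<omega>. e \<in> fst (res \<omega>))"
      by (rule measurable_compose[OF res]) simp
    then show ?thesis using Xm[OF that] by measurable
  qed
  have ii: "integrable ?W (indicat_real {\<omega> \<in> space ?W. e \<in> fst (res \<omega>) \<and> min (snd \<omega> e) (tau e) = v})"
    if "e \<in> E" for e v
    by (intro integrable_real_indicator ms that) (simp add: W.P.emeasure_finite less_top[symmetric])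
  have "expected_utility E D cost (R, T) = (\<integral>\<omega>. poi_utility cost (snd \<omega>) (res \<omega>) \<partial>?W)"
    by (simp add: expected_utility_def res_def case_prod_unfold)
  also have "\<dots> = (\<integral>\<omega>. (\<Sum>e\<in>E. of_bool (e \<in> fst (res \<omega>)) * snd \<omega> e
        - of_bool (e \<in> snd (res \<omega>)) * max (snd \<omega> e - tau e) 0) \<partial>?W)"
    by (rule acc(2))
  \<comment> \<open>A matched edge has been queried, so its weight minus its excess is the capped
    weight; a queried edge that is not matched only loses its excess.\<close>
  also have "\<dots> \<le> (\<integral>\<omega>. (\<Sum>(e, v)\<in>Sigma E V. v * indicator {\<omega> \<in> space ?W. e \<in> fst (res \<omega>) \<and> min (snd \<omega> e) (tau e) = v} \<omega>) \<partial>?W)"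
  proof (rule integral_mono_AE[OF acc(1)])
    show "integrable ?W (\<lambda>\<omega>. \<Sum>(e, v)\<in>Sigma E V. v * indicator {\<omega> \<in> space ?W. e \<in> fst (res \<omega>) \<and> min (snd \<omega> e) (tau e) = v} \<omega>)"
      by (auto intro!: Bochner_Integration.integrable_sum ii simp: case_prod_unfold)
    have "AE \<omega> in ?W. \<forall>e\<in>E. min (snd \<omega> e) (tau e) \<in> V e \<or> min (snd \<omega> e) (tau e) \<le> 0"
    proof (rule AE_finite_allI[OF finite_E])
      fix e assume e: "e \<in> E"
      have m: "(\<lambda>\<omega>. snd \<omega> e) \<in> ?W \<rightarrow>\<^sub>M D e" using Xm[OF e] by (simp cong: measurable_cong_sets add: sets_D)
      show "AE \<omega> in ?W. min (snd \<omega> e) (tau e) \<in> V e \<or> min (snd \<omega> e) (tau e) \<le> 0"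
        using AE_distrD[OF m, unfolded Xd[OF e], OF cap_in_V[OF e]] .
    qed
    then show "AE \<omega> in ?W. (\<Sum>e\<in>E. of_bool (e \<in> fst (res \<omega>)) * snd \<omega> e
        - of_bool (e \<in> snd (res \<omega>)) * max (snd \<omega> e - tau e) 0) \<le>
        (\<Sum>(e, v)\<in>Sigma E V. v * indicator {\<omega> \<in> space ?W. e \<in> fst (res \<omega>) \<and> min (snd \<omega> e) (tau e) = v} \<omega>)"
      using AE_space
    proof eventually_elim
      case (elim \<omega>)
      have "of_bool (e \<in> fst (res \<omega>)) * snd \<omega> e - of_bool (e \<in> snd (res \<omega>)) * max (snd \<omega> e - tau e) 0
          \<le> (\<Sum>v\<in>V e. v * indicator {\<omega> \<in> space ?W. e \<in> fst (res \<omega>) \<and> min (snd \<omega> e) (tau e) = v} \<omega>)"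
        if e: "e \<in> E" for e
      proof (cases "e \<in> fst (res \<omega>)")
        case True
        then have "e \<in> snd (res \<omega>)" using valid_res(1)[OF elim(2)] by auto
        then have "of_bool (e \<in> fst (res \<omega>)) * snd \<omega> e - of_bool (e \<in> snd (res \<omega>)) * max (snd \<omega> e - tau e) 0
            = min (snd \<omega> e) (tau e)" using True by auto
        \<comment> \<open>A capped weight outside \<open>V e\<close> is nonpositive, and then the
          sum is 0.\<close>
        also have "\<dots> \<le> (\<Sum>v\<in>V e. if v = min (snd \<omega> e) (tau e) then v else 0)"
          using elim(1) e finite_V[OF e] by (auto simp: sum.delta)
        also have "\<dots> = (\<Sum>v\<in>V e. v * indicator {\<omega> \<in> space ?W. e \<in> fst (res \<omega>) \<and> min (snd \<omega> e) (tau e) = v} \<omega>)"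
          using True elim(2) by (intro sum.cong) (auto simp: indicator_def)
        finally show ?thesis .
      next
        case False
        then show ?thesis using V_bounds(1)[OF e] by (auto intro!: sum_nonneg less_imp_le)
      qed
      then show ?case
        using finite_E finite_V by (subst sum.Sigma[symmetric]) (auto intro!: sum_mono)
    qed
  qed
  also have "\<dots> = (\<Sum>(e, v)\<in>Sigma E V. v * ?p e v)"
    using ii by (subst Bochner_Integration.integral_sum)
      (auto intro!: sum.cong arg_cong[where f = "measure ?W"] simp: case_prod_unfold)
  also have "\<dots> = lp_value E V ?p"
    by (simp add: lp_value_def mult.commute)
  also have "lp_feasible A B E D tau V ?p"
  proof -
    have ps: "prob_some E D tau F = measure ?W {\<omega> \<in> space ?W. \<exists>(e, v)\<in>F. min (snd \<omega> e) (tau e) = v}"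
      if F: "F \<subseteq> Sigma E V" for F
    proof -
      let ?S = "{X \<in> space ?N. \<exists>(e, v)\<in>F. min (X e) (tau e) = v}"
      have "?S = (\<Union>(e, v)\<in>F. {X \<in> space ?N. min (X e) (tau e) = v})" by auto
      moreover have "{X \<in> space ?N. min (X e) (tau e) = v} \<in> sets ?N" if "(e, v) \<in> F" for e v
      proof -
        have "e \<in> E" using F that by auto
        then show ?thesis by measurable
      qed
      ultimately have "?S \<in> sets ?N"
        using finite_subset[OF F finite_Sigma_V] by (auto intro!: sets.finite_UN)
      then have "measure (distr ?W ?N snd) ?S = measure ?W (snd -` ?S \<inter> space ?W)"
        by (intro measure_distr) auto
      also have "snd -` ?S \<inter> space ?W = {\<omega> \<in> space ?W. \<exists>(e, v)\<in>F. min (snd \<omega> e) (tau e) = v}"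
        by (auto simp: space_pair_measure)
      finally show ?thesis
        by (simp add: prob_some_def distr_pair_snd[OF R P.prob_space_axioms])
    qed
    have sumA: "(\<Sum>(e, v)\<in>F. ?p e v) \<le> prob_some E D tau F" if F: "F \<subseteq> Sigma (deltaA E a) V" for a F
    proof -
      have FE: "F \<subseteq> Sigma E V" using F by (auto simp: deltaA_def)
      show ?thesis unfolding ps[OF FE]
      proof (rule matching_sum_le[OF W.P.prob_space_axioms Xm res FE])
        fix \<omega> e v e' v' assume "\<omega> \<in> space ?W" "(e, v) \<in> F" "(e', v') \<in> F"
          "e \<in> fst (res \<omega>)" "e' \<in> fst (res \<omega>)"
        moreover from this have "fst e = fst e'" using F by (auto simp: deltaA_def)
        ultimately show "e = e'"
          using valid_res(2)[of \<omega>] by (auto simp: matching_def dest: inj_onD)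
      qed
    qed
    have sumB: "(\<Sum>(e, v)\<in>F. ?p e v) \<le> prob_some E D tau F" if F: "F \<subseteq> Sigma (deltaB E b) V" for b F
    proof -
      have FE: "F \<subseteq> Sigma E V" using F by (auto simp: deltaB_def)
      show ?thesis unfolding ps[OF FE]
      proof (rule matching_sum_le[OF W.P.prob_space_axioms Xm res FE])
        fix \<omega> e v e' v' assume "\<omega> \<in> space ?W" "(e, v) \<in> F" "(e', v') \<in> F"
          "e \<in> fst (res \<omega>)" "e' \<in> fst (res \<omega>)"
        moreover from this have "snd e = snd e'" using F by (auto simp: deltaB_def)
        ultimately show "e = e'"
          using valid_res(2)[of \<omega>] by (auto simp: matching_def dest: inj_onD)
      qed
    qed
    show ?thesis unfolding lp_feasible_def using sumA sumB by simp
  qed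
  then have "lp_value E V ?p \<le> lp_value E V x"
    using opt unfolding lp_optimal_def by blast
  finally show ?thesis .
qed

lemma OPT_le_lp_value:
  assumes opt: "lp_optimal A B E D tau V x"
  shows "OPT E D cost \<le> lp_value E V x"
  unfolding OPT_def
proof (rule cSUP_least)
  have "(return borel 0, \<lambda>_. Output {}) \<in> poi_algorithms E D"
    by (simp add: poi_algorithms_def matching_def prob_space_return case_prod_unfold)
  then show "poi_algorithms E D \<noteq> {}" by blast
  show "expected_utility E D cost alg \<le> lp_value E V x" if "alg \<in> poi_algorithms E D" for alg
    using expected_utility_le_lp[OF _ opt] that by (cases alg) auto
qed

end

subsection \<open>Independence and measurability\<close>

text \<open>Outcomes are filled in along the order. Setting the value at the new vertex
  \<open>a\<close> disturbs no equation obtained so far, since \<open>a\<close> is earlier than no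
  vertex of the prefix.\<close>

lemma consistent_exists:
  assumes "distinct as" "\<And>a. a \<in> set as \<Longrightarrow> proper_sequence V a (\<sigma> a)"
  shows "\<exists>r. consistent tau V c t \<sigma> as X X' r"
proof -
  have "\<exists>r. \<forall>a\<in>set pre. r a = find (matches tau (merged (queried V c t as r) X X')) (\<sigma> a)"
    if "as = pre @ post" for pre post
    using that
  proof (induction pre arbitrary: post rule: rev_induct)
    case (snoc a pre)
    have as: "as = pre @ a # post" using snoc.prems by simp
    then obtain r where r:
      "\<forall>a\<in>set pre. r a = find (matches tau (merged (queried V c t as r) X X')) (\<sigma> a)"
      using snoc.IH by blast
    define r' where "r' = r(a := find (matches tau (merged (queried V c t as r) X X')) (\<sigma> a))"
    have "r' a' = find (matches tau (merged (queried V c t as r') X X')) (\<sigma> a')"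
      if a': "a' \<in> set (pre @ [a])" for a'
    proof -
      \<comment> \<open>This covers \<open>a' = a\<close> as well: no vertex precedes itself, so the
        new equation may be read with \<open>r\<close> or with \<open>r'\<close>.\<close>
      have "a \<notin> earlier as a'"
      proof -
        obtain p q where pq: "pre @ [a] = p @ a' # q" using a' by (metis split_list)
        then have eq: "as = p @ a' # (q @ post)" using as by simp
        then have "a' \<notin> set p" using \<open>distinct as\<close> by simp
        then have "earlier as a' = set p" using earlier_append eq by metis
        moreover have "a \<notin> set p"
        proof
          assume "a \<in> set p"
          then have "\<not> distinct (p @ a' # q)"
            using pq by (cases q rule: rev_cases) auto
          then show False using \<open>distinct as\<close> eq by auto
        qed
        ultimately show ?thesis by simp
      qed
      then have tk: "taken c t r' (earlier as a') = taken c t r (earlier as a')"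
        by (auto simp: taken_def r'_def)
      have "r' a' = find (matches tau (merged (queried V c t as r) X X')) (\<sigma> a')"
        using a' r by (auto simp: r'_def)
      also have "\<dots> = find (matches tau (merged (queried V c t as r') X X')) (\<sigma> a')"
      proof (rule find_cong_set)
        fix p assume p: "p \<in> set (\<sigma> a')"
        have "a' \<in> set as" using a' as by auto
        then have "fst (fst p) = a'"
          using assms(2) p unfolding proper_sequence_def by force
        then show "matches tau (merged (queried V c t as r) X X') p =
            matches tau (merged (queried V c t as r') X X') p"
          by (auto simp: matches_def merged_def queried_def tk split: prod.split)
      qed
      finally show ?thesis .
    qed
    then show ?case by blast
  qed simp
  from this[of as "[]"] show ?thesis by (simp add: consistent_def)
qed

section \<open>Measurability through finitely many tests, and laws of product measures\<close>

lemma find_measurable: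
  "(\<And>x. x \<in> set xs \<Longrightarrow> Measurable.pred M (\<lambda>\<omega>. P \<omega> x)) \<Longrightarrow>
    (\<lambda>\<omega>. find (P \<omega>) xs) \<in> M \<rightarrow>\<^sub>M count_space UNIV"
proof (induction xs)
  case (Cons x xs)
  have [measurable]: "Measurable.pred M (\<lambda>\<omega>. P \<omega> x)"
    "(\<lambda>\<omega>. find (P \<omega>) xs) \<in> M \<rightarrow>\<^sub>M count_space UNIV"
    using Cons by auto
  show ?case unfolding find.simps by measurable
qed simp

text \<open>Such an \<open>f\<close> factors through the finite table of the predicates that hold,
  and every function on a finite discrete space is measurable. For the algorithm this replaces a
  measurability argument along its recursion.\<close>

lemma measurable_finite_factor:
  assumes Ps: "finite Ps" "\<And>P. P \<in> Ps \<Longrightarrow> Measurable.pred M P"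
    and f: "\<And>\<omega> \<omega>'. (\<forall>P\<in>Ps. P \<omega> = P \<omega>') \<Longrightarrow> f \<omega> = f \<omega>'"
  shows "f \<in> M \<rightarrow>\<^sub>M count_space UNIV"
proof -
  define tab where "tab \<omega> = {P \<in> Ps. P \<omega>}" for \<omega>
  have tab: "tab \<in> M \<rightarrow>\<^sub>M count_space (Pow Ps)"
  proof (subst measurable_count_space_eq2)
    show "finite (Pow Ps)" using Ps by simp
    have "tab -` {S} \<inter> space M \<in> sets M" if "S \<subseteq> Ps" for S
    proof -
      have "tab \<omega> = S \<longleftrightarrow> (\<forall>P\<in>Ps. P \<omega> = (P \<in> S))" for \<omega>
        unfolding tab_def using that by blast
      then have "tab -` {S} \<inter> space M = {\<omega> \<in> space M. \<forall>P\<in>Ps. P \<omega> = (P \<in> S)}"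
        by (simp add: vimage_def Int_def conj_commute)
      also have "\<dots> \<in> sets M"
      proof (rule sets.sets_Collect_finite_All[OF _ Ps(1)])
        fix P assume "P \<in> Ps"
        then have "{\<omega> \<in> space M. P \<omega>} \<in> sets M" using predE[OF Ps(2)] by blast
        then show "{\<omega> \<in> space M. P \<omega> = (P \<in> S)} \<in> sets M"
          using sets.sets_Collect_neg by (cases "P \<in> S") auto
      qed
      finally show ?thesis .
    qed
    then show "tab \<in> space M \<rightarrow> Pow Ps \<and> (\<forall>a\<in>Pow Ps. tab -` {a} \<inter> space M \<in> sets M)"
      by (auto simp: tab_def)
  qed
  \<comment> \<open>Any sample with the same table can stand for it, since \<open>f\<close> is
    constant on tables.\<close>
  have "f = (\<lambda>S. f (SOME \<omega>. tab \<omega> = S)) \<circ> tab"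
  proof
    fix \<omega>
    have "tab (SOME \<omega>'. tab \<omega>' = tab \<omega>) = tab \<omega>" by (rule someI) simp
    then have "f (SOME \<omega>'. tab \<omega>' = tab \<omega>) = f \<omega>" by (intro f) (auto simp: tab_def)
    then show "f \<omega> = ((\<lambda>S. f (SOME \<omega>. tab \<omega> = S)) \<circ> tab) \<omega>" by simp
  qed
  also have "\<dots> \<in> M \<rightarrow>\<^sub>M count_space UNIV"
    by (rule measurable_comp[OF tab]) simp
  finally show ?thesis .
qed

text \<open>Insertion only compares keys. The arrival order is thus determined by finitely many
  comparisons of times.\<close>

lemma sort_key_cong_le:
  assumes "\<And>x y. x \<in> set xs \<Longrightarrow> y \<in> set xs \<Longrightarrow> (f x \<le> f y) = (g x \<le> g y)"
  shows "sort_key f xs = sort_key g xs"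
  using assms
proof (induction xs)
  case (Cons x xs)
  have *: "insort_key f x ys = insort_key g x ys" if "set ys \<subseteq> set (x # xs)" for ys
    using that
  proof (induction ys)
    case (Cons y ys)
    then show ?case using Cons.prems \<open>\<And>x' y. x' \<in> set (x # xs) \<Longrightarrow> y \<in> set (x # xs) \<Longrightarrow> (f x' \<le> f y) = (g x' \<le> g y)\<close> by auto
  qed simp
  have "sort_key f xs = sort_key g xs" using Cons by auto
  then show ?case using *[of "sort_key g xs"] by (simp add: subset_insertI)
qed simp

text \<open>Checked on boxes, with the coordinates outside \<open>J\<close> left unconstrained. It
  presents the capped weights around one vertex as an image of the weights of all edges.\<close>

lemma (in product_prob_space) distr_PiM_coordinatewise:
  assumes "finite I" "J \<subseteq> I" and f[measurable]: "\<And>i. f i \<in> M i \<rightarrow>\<^sub>M N i"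
  shows "distr (PiM I M) (PiM J N) (\<lambda>Z. \<lambda>i\<in>J. f i (Z i)) = PiM J (\<lambda>i. distr (M i) (N i) (f i))"
proof -
  interpret N: product_prob_space "\<lambda>i. distr (M i) (N i) (f i)" J
    by (rule product_prob_spaceI) (rule M.prob_space_distr, rule f)
  have fin: "finite J" using assms finite_subset by blast
  interpret I: finite_product_prob_space M I
    by standard fact
  show ?thesis
  proof (rule N.PiM_eqI[OF fin])
    show "sets (distr (PiM I M) (PiM J N) (\<lambda>Z. \<lambda>i\<in>J. f i (Z i))) = sets (PiM J (\<lambda>i. distr (M i) (N i) (f i)))"
      by (simp cong: sets_PiM_cong)
    fix A assume "\<And>i. i \<in> J \<Longrightarrow> A i \<in> sets (distr (M i) (N i) (f i))"
    then have A: "A i \<in> sets (N i)" if "i \<in> J" for i using that by simp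
    let ?B = "\<lambda>i. if i \<in> J then f i -` A i \<inter> space (M i) else space (M i)"
    have m: "(\<lambda>Z. \<lambda>i\<in>J. f i (Z i)) \<in> PiM I M \<rightarrow>\<^sub>M PiM J N"
    proof (rule measurable_restrict)
      fix i assume "i \<in> J"
      then have "(\<lambda>Z. Z i) \<in> PiM I M \<rightarrow>\<^sub>M M i" using assms(2) by (intro measurable_component_singleton) auto
      then show "(\<lambda>Z. f i (Z i)) \<in> PiM I M \<rightarrow>\<^sub>M N i" by (rule measurable_compose) (rule f)
    qed
    have "emeasure (distr (PiM I M) (PiM J N) (\<lambda>Z. \<lambda>i\<in>J. f i (Z i))) (Pi\<^sub>E J A) =
        emeasure (PiM I M) ((\<lambda>Z. \<lambda>i\<in>J. f i (Z i)) -` Pi\<^sub>E J A \<inter> space (PiM I M))"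
      using A fin by (intro emeasure_distr m sets_PiM_I_finite) auto
    also have "(\<lambda>Z. \<lambda>i\<in>J. f i (Z i)) -` Pi\<^sub>E J A \<inter> space (PiM I M) = Pi\<^sub>E I ?B"
      using assms(2) by (auto simp: space_PiM PiE_iff split: if_splits) blast
    also have "emeasure (PiM I M) (Pi\<^sub>E I ?B) = (\<Prod>i\<in>I. emeasure (M i) (?B i))"
      using A f by (intro I.measure_times) (auto intro: measurable_sets)
    also have "\<dots> = (\<Prod>i\<in>J. emeasure (M i) (?B i))"
      using assms(1,2) M.emeasure_space_1 by (intro prod.mono_neutral_right) auto
    also have "\<dots> = (\<Prod>i\<in>J. emeasure (distr (M i) (N i) (f i)) (A i))"
      using A by (intro prod.cong) (auto simp: emeasure_distr)
    finally show "emeasure (distr (PiM I M) (PiM J N) (\<lambda>Z. \<lambda>i\<in>J. f i (Z i))) (Pi\<^sub>E J A) =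
        (\<Prod>i\<in>J. emeasure (distr (M i) (N i) (f i)) (A i))" .
  qed
qed

text \<open>The selection \<open>P\<close> is fixed, so the preimage of a box is a product of two
  boxes: each coordinate constrains one copy and leaves the other free, and the factors multiply
  back to those of the box. For a selection that varies with the sample this can fail, which is why
  outcome vectors are fixed beforehand.\<close>

lemma (in product_prob_space) distr_merged:
  assumes "finite I"
  shows "distr (PiM I M \<Otimes>\<^sub>M PiM I M) (PiM I M) (\<lambda>\<omega>. \<lambda>i\<in>I. if P i then fst \<omega> i else snd \<omega> i) = PiM I M"
proof (rule PiM_eqI[OF assms])
  interpret I: finite_product_prob_space M I
    by standard fact
  interpret II: pair_prob_space "PiM I M" "PiM I M" ..
  fix A assume A: "\<And>i. i \<in> I \<Longrightarrow> A i \<in> sets (M i)"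
  let ?W = "PiM I M \<Otimes>\<^sub>M PiM I M"
  let ?f = "\<lambda>\<omega>. \<lambda>i\<in>I. if P i then fst \<omega> i else snd \<omega> i"
  let ?B = "\<lambda>i. if P i then A i else space (M i)" and ?C = "\<lambda>i. if P i then space (M i) else A i"
  have m: "?f \<in> ?W \<rightarrow>\<^sub>M PiM I M" by (intro measurable_restrict) auto
  have "emeasure (distr ?W (PiM I M) ?f) (Pi\<^sub>E I A) = emeasure ?W (?f -` Pi\<^sub>E I A \<inter> space ?W)"
    using A assms by (intro emeasure_distr m sets_PiM_I_finite) auto
  also have "?f -` Pi\<^sub>E I A \<inter> space ?W = Pi\<^sub>E I ?B \<times> Pi\<^sub>E I ?C"
  proof (rule set_eqI)
    fix \<omega> :: "('i \<Rightarrow> 'a) \<times> ('i \<Rightarrow> 'a)"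
    have "u \<in> space (M i)" if "i \<in> I" "u \<in> A i" for i u
      using sets.sets_into_space[OF A[OF that(1)]] that by auto
    then show "\<omega> \<in> ?f -` Pi\<^sub>E I A \<inter> space ?W \<longleftrightarrow> \<omega> \<in> Pi\<^sub>E I ?B \<times> Pi\<^sub>E I ?C"
      unfolding space_pair_measure space_PiM vimage_eq Int_iff mem_Times_iff PiE_iff by (simp; meson)
  qed
  also have "emeasure ?W (Pi\<^sub>E I ?B \<times> Pi\<^sub>E I ?C) = emeasure (PiM I M) (Pi\<^sub>E I ?B) * emeasure (PiM I M) (Pi\<^sub>E I ?C)"
    using A assms by (intro P.emeasure_pair_measure_Times sets_PiM_I_finite) auto
  also have "\<dots> = (\<Prod>i\<in>I. emeasure (M i) (?B i)) * (\<Prod>i\<in>I. emeasure (M i) (?C i))"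
    using A by (intro arg_cong2[where f = times] I.measure_times) auto
  also have "\<dots> = (\<Prod>i\<in>I. emeasure (M i) (A i))"
    using M.emeasure_space_1 by (auto simp: prod.distrib[symmetric] intro!: prod.cong)
  finally show "emeasure (distr ?W (PiM I M) ?f) (Pi\<^sub>E I A) = (\<Prod>i\<in>I. emeasure (M i) (A i))" .
qed simp

text \<open>Coordinates of a product are independent, and so are disjoint blocks of them. The blocks
  will be the edge sets of the vertices of \<open>A\<close>.\<close>

lemma (in product_prob_space) measure_block_indep:
  assumes "finite I" "finite A" "\<And>a. a \<in> A \<Longrightarrow> K a \<subseteq> I" "disjoint_family_on K A"
    and S: "\<And>a. a \<in> A \<Longrightarrow> S a \<in> sets (PiM (K a) M)"
  shows "measure (PiM I M) {Z \<in> space (PiM I M). \<forall>a\<in>A. restrict Z (K a) \<in> S a} =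
    (\<Prod>a\<in>A. measure (PiM I M) {Z \<in> space (PiM I M). restrict Z (K a) \<in> S a})"
proof (cases "A = {}")
  case True
  then show ?thesis by (simp add: P.prob_space)
next
  case False
  have "P.indep_vars M (\<lambda>i Z. Z i) I"
  proof (cases "I = {}")
    case True
    then show ?thesis unfolding P.indep_vars_def P.indep_sets_def by auto
  next
    case False
    \<comment> \<open>Restriction to \<open>I\<close> is the identity on the product space, so the
      product measure is the joint law of its own coordinates.\<close>
    have "distr (PiM I M) (PiM I M) (\<lambda>x. \<lambda>i\<in>I. x i) = distr (PiM I M) (PiM I M) (\<lambda>x. x)"
      by (intro distr_cong) (auto simp: space_PiM PiE_iff extensional_restrict)
    then have "distr (PiM I M) (PiM I M) (\<lambda>x. \<lambda>i\<in>I. x i) = PiM I (\<lambda>i. distr (PiM I M) (M i) (\<lambda>x. x i))"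
      by (simp add: PiM_component cong: PiM_cong)
    then show ?thesis
      using False by (subst P.indep_vars_iff_distr_eq_PiM') auto
  qed
  then have "P.indep_vars (\<lambda>a. PiM (K a) M) (\<lambda>a Z. restrict (\<lambda>i. Z i) (K a)) A"
    by (rule P.indep_vars_restrict) (use assms in auto)
  from P.indep_varsD_finite[OF this False \<open>finite A\<close> S]
  have "measure (PiM I M) (\<Inter>a\<in>A. (\<lambda>Z. restrict Z (K a)) -` S a \<inter> space (PiM I M)) =
      (\<Prod>a\<in>A. measure (PiM I M) ((\<lambda>Z. restrict Z (K a)) -` S a \<inter> space (PiM I M)))"
    by simp
  moreover have "(\<Inter>a\<in>A. (\<lambda>Z. restrict Z (K a)) -` S a \<inter> space (PiM I M)) =
      {Z \<in> space (PiM I M). \<forall>a\<in>A. restrict Z (K a) \<in> S a}"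
    using False by auto
  moreover have "(\<lambda>Z. restrict Z (K a)) -` S a \<inter> space (PiM I M) =
      {Z \<in> space (PiM I M). restrict Z (K a) \<in> S a}" for a by auto
  ultimately show ?thesis by simp
qed

subsection \<open>Accounting along a run\<close>

lemma process_vertex_subset:
  "fst (snd (process_vertex tau c X X' t l s)) \<subseteq> fst (snd s) \<union> fst ` set l \<and>
   snd (snd (process_vertex tau c X X' t l s)) \<subseteq> snd (snd s) \<union> fst ` set l"
proof (induction l arbitrary: s)
  case (Cons p l)
  obtain e v where p: "p = (e, v)" by (cases p)
  obtain z M Q where s: "s = (z, M, Q)" by (rule prod_cases3)
  define z1 where "z1 = (if z e = None then z(e \<mapsto> X e) else z)"
  define Q1 where "Q1 = (if z e = None then insert e Q else Q)"
  define z2 where "z2 = (if z e = None then z(e \<mapsto> X' e) else z)"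
  have "process_vertex tau c X X' t (p # l) s \<in> {(z1, insert e M, Q1), (z2, M, Q),
      process_vertex tau c X X' t l (z1, M, Q1), process_vertex tau c X X' t l (z2, M, Q)}"
    by (simp add: p s Let_def z1_def z2_def Q1_def)
  moreover have "Q1 \<subseteq> insert e Q" by (auto simp: Q1_def)
  moreover have "fst (snd (process_vertex tau c X X' t l (z1, M, Q1))) \<subseteq> M \<union> fst ` set l"
    "snd (snd (process_vertex tau c X X' t l (z1, M, Q1))) \<subseteq> Q1 \<union> fst ` set l"
    "fst (snd (process_vertex tau c X X' t l (z2, M, Q))) \<subseteq> M \<union> fst ` set l"
    "snd (snd (process_vertex tau c X X' t l (z2, M, Q))) \<subseteq> Q \<union> fst ` set l"
    using Cons.IH[of "(z1, M, Q1)"] Cons.IH[of "(z2, M, Q)"] by simp_all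
  ultimately have "fst (snd (process_vertex tau c X X' t (p # l) s)) \<subseteq> insert e M \<union> fst ` set l \<and>
      snd (snd (process_vertex tau c X X' t (p # l) s)) \<subseteq> insert e Q \<union> fst ` set l"
    by (elim insertE emptyE) (simp_all only: fst_conv snd_conv, blast+)
  then show ?case by (simp add: p s)
qed simp

text \<open>The stored weights themselves may differ: a run only asks whether an edge has a stored
  weight and whether its capped weight hits the value of a pair, so agreement of these answers on
  \<open>S\<close> is enough.\<close>

definition similar ::
    "('e \<Rightarrow> real) \<Rightarrow> ('e \<times> real) set \<Rightarrow> ('e \<Rightarrow> real option) \<Rightarrow> ('e \<Rightarrow> real option) \<Rightarrow> bool"
  where "similar tau S z z' \<longleftrightarrow> (\<forall>e. (z e = None) = (z' e = None)) \<and>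
    (\<forall>(e, v)\<in>S. z e \<noteq> None \<longrightarrow> (min (the (z e)) (tau e) = v) = (min (the (z' e)) (tau e) = v))"

lemma similarD:
  assumes "similar tau S z z'"
  shows "(z e = None) = (z' e = None)"
    "(e, v) \<in> S \<Longrightarrow> z e \<noteq> None \<Longrightarrow> (min (the (z e)) (tau e) = v) = (min (the (z' e)) (tau e) = v)"
  using assms by (auto simp: similar_def)

text \<open>Both runs take the same branches, so matchings and queried sets stay equal while the
  stored weights are only \<open>similar\<close>.\<close>

lemma process_vertex_cong:
  assumes "set l \<subseteq> S"
    and acc: "\<And>p. p \<in> S \<Longrightarrow> accepts c t p = accepts c t2 p"
    and X: "\<And>p. p \<in> S \<Longrightarrow> matches tau X p = matches tau X2 p"
    and X': "\<And>p. p \<in> S \<Longrightarrow> matches tau X' p = matches tau X2' p"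
    and "similar tau S z z2"
  shows "similar tau S (fst (process_vertex tau c X X' t l (z, M, Q))) (fst (process_vertex tau c X2 X2' t2 l (z2, M, Q)))
    \<and> snd (process_vertex tau c X X' t l (z, M, Q)) = snd (process_vertex tau c X2 X2' t2 l (z2, M, Q))"
  using assms(1,5)
proof (induction l arbitrary: z z2 Q)
  case (Cons p l)
  obtain e v where p: "p = (e, v)" by (cases p)
  have ev: "(e, v) \<in> S" and l: "set l \<subseteq> S" using Cons.prems p by auto
  note none = similarD(1)[OF Cons.prems(2), of e]
  define b where "b \<longleftrightarrow> (1 - exp (t - 1)) * c (snd e) \<le> v \<and> snd e \<notin> snd ` M"
  have b2: "((1 - exp (t2 - 1)) * c (snd e) \<le> v \<and> snd e \<notin> snd ` M) = b"
    using acc[OF ev] by (simp add: accepts_def b_def)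
  define Y where "Y = (if b then X else X')"
  define Y2 where "Y2 = (if b then X2 else X2')"
  define z' where "z' = (if z e = None then z(e \<mapsto> Y e) else z)"
  define z2' where "z2' = (if z2 e = None then z2(e \<mapsto> Y2 e) else z2)"
  define Q' where "Q' = (if b \<and> z e = None then insert e Q else Q)"
  have s1: "process_vertex tau c X X' t (p # l) (z, M, Q) =
      (if min (the (z' e)) (tau e) = v then (z', if b then insert e M else M, Q')
       else process_vertex tau c X X' t l (z', M, Q'))"
    unfolding p process_vertex.simps b_def[symmetric]
    by (simp add: z'_def Y_def Q'_def Let_def)
  have s2: "process_vertex tau c X2 X2' t2 (p # l) (z2, M, Q) =
      (if min (the (z2' e)) (tau e) = v then (z2', if b then insert e M else M, Q')
       else process_vertex tau c X2 X2' t2 l (z2', M, Q'))"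
    unfolding p process_vertex.simps b2 using none
    by (simp add: z2'_def Y2_def Q'_def Let_def)
  have YY: "(min (Y e') (tau e') = v') = (min (Y2 e') (tau e') = v')" if "(e', v') \<in> S" for e' v'
    using X[OF that] X'[OF that] by (simp add: Y_def Y2_def matches_def)
  have sim: "similar tau S z' z2'"
    unfolding similar_def
  proof (intro conjI allI ballI)
    show "(z' e' = None) = (z2' e' = None)" for e'
      using similarD(1)[OF Cons.prems(2), of e'] none by (simp add: z'_def z2'_def)
    fix q assume q: "q \<in> S"
    obtain e' v' where q': "q = (e', v')" by (cases q)
    have old: "z e' \<noteq> None \<longrightarrow> (min (the (z e')) (tau e') = v') = (min (the (z2 e')) (tau e') = v')"
      using similarD(2)[OF Cons.prems(2), of e' v'] q q' by simp
    show "case q of (e, v) \<Rightarrow> z' e \<noteq> None \<longrightarrow> (min (the (z' e)) (tau e) = v) = (min (the (z2' e)) (tau e) = v)"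
      using old YY[of e' v'] q none by (cases "e' = e") (simp_all add: q' z'_def z2'_def)
  qed
  have z'e: "z' e \<noteq> None" by (simp add: z'_def)
  then have eq: "(min (the (z' e)) (tau e) = v) = (min (the (z2' e)) (tau e) = v)"
    using similarD(2)[OF sim ev] by simp
  show ?case
    unfolding s1 s2 eq[symmetric] using Cons.IH[OF l sim] sim by (simp only: split: if_split) simp
qed simp

lemma consistent_cong:
  assumes "\<And>a. a \<in> set as \<Longrightarrow> r a = r' a"
  shows "consistent tau V c t \<sigma> as X X' r = consistent tau V c t \<sigma> as X X' r'"
proof -
  have "r a' = r' a'" if "a' \<in> earlier as a" for a a'
    using that assms by (auto simp: earlier_def dest: set_takeWhileD)
  then have "taken c t r (earlier as a) = taken c t r' (earlier as a)" for a
    by (simp add: taken_def cong: bex_cong)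
  then have "queried V c t as r e = queried V c t as r' e" for e by (simp add: queried_def)
  then have "queried V c t as r = queried V c t as r'" by (rule ext)
  then show ?thesis using assms by (simp add: consistent_def)
qed

text \<open>Given the times, each vertex gets a condition on its own outcome alone, so the joint
  event is a product. The comparison with \<le> lets ties block too, whatever the order of
  processing; membership at all vertices then implies that \<open>p\<close> is served, the direction
  a lower bound needs.\<close>

definition target ::
    "('b \<Rightarrow> real) \<Rightarrow> ('a \<Rightarrow> real) \<Rightarrow> ('a \<times> 'b) \<times> real \<Rightarrow> 'a \<Rightarrow> (('a \<times> 'b) \<times> real) option set"
  where "target c t p a = (if a = fst (fst p)
    then {r. r = Some p \<and> accepts c (t a) p}
    else {r. \<not> (t a \<le> t (fst (fst p)) \<and> hits c (t a) r (snd (fst p)))})"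

context poi_instance
begin

section \<open>Valid sequences and the gain of a single run\<close>

definition valid_sequence :: "'a \<Rightarrow> (('a \<times> 'b) \<times> real) list \<Rightarrow> bool"
  where "valid_sequence a l \<longleftrightarrow> set l \<subseteq> Sigma (deltaA E a) V \<and>
    (\<forall>i<length l. \<forall>e v w. l ! i = (e, v) \<and> w \<in> V e \<and> w > v \<longrightarrow> (\<exists>j<i. l ! j = (e, w)))"

definition single_prob ::
    "'a \<Rightarrow> (('a \<times> 'b) \<times> real) list \<Rightarrow> (('a \<times> 'b) \<times> real) option set \<Rightarrow> real"
  where "single_prob a l K =
    (let Y = Pi\<^sub>M (deltaA E a) (\<lambda>e. distr (D e) borel (\<lambda>w. min w (tau e)))
     in measure Y {y \<in> space Y. single_vertex y Map.empty l \<in> K})"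

lemma deltaA_subset: "deltaA E a \<subseteq> E" by (auto simp: deltaA_def)

lemma valid_sequenceD:
  assumes "valid_sequence a l" "(e, v) \<in> set l"
  shows "e \<in> E" "fst e = a" "v \<in> V e" "e \<in> deltaA E a" "v \<le> Max (V e)"
proof -
  show *: "e \<in> E" "fst e = a" "v \<in> V e" "e \<in> deltaA E a"
    using assms by (auto simp: valid_sequence_def deltaA_def)
  show "v \<le> Max (V e)" using * finite_V by simp
qed

text \<open>If the first pair of \<open>e\<close> had a smaller value, the pair with
  \<open>Max (V e)\<close> would have to precede it.\<close>

lemma proper_sequence_valid:
  assumes "valid_sequence a l"
  shows "proper_sequence V a l"
  unfolding proper_sequence_def leads_with_max_def
proof (intro conjI allI impI ballI)
  fix l1 e v l2 assume l: "l = l1 @ (e, v) # l2" and e: "e \<notin> fst ` set l1"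
  have ev: "(e, v) \<in> set l" by (simp add: l)
  note d = valid_sequenceD[OF assms ev]
  show "v = Max (V e)"
  proof (rule ccontr)
    assume "v \<noteq> Max (V e)"
    then have "Max (V e) \<in> V e" "Max (V e) > v" using d finite_V[OF d(1)] by (auto intro: Max_in simp: less_le)
    moreover have "length l1 < length l" "l ! length l1 = (e, v)" by (auto simp: l)
    ultimately obtain j where "j < length l1" "l ! j = (e, Max (V e))"
      using assms unfolding valid_sequence_def by blast
    then have "(e, Max (V e)) \<in> set l1" by (metis l nth_append nth_mem)
    then show False using e by force
  qed
next
  fix p assume "p \<in> set l"
  then show "case p of (e, v) \<Rightarrow> v \<le> Max (V e) \<and> fst e = a"
    using valid_sequenceD(2,5)[OF assms, of "fst p" "snd p"] by (simp add: case_prod_unfold)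
qed

lemma approx_poi_subset:
  assumes "\<And>a. a \<in> A \<Longrightarrow> valid_sequence a (\<sigma> a)"
  shows "fst (approx_poi A E tau V x \<sigma> t X X') \<subseteq> E \<and> snd (approx_poi A E tau V x \<sigma> t X X') \<subseteq> E"
proof -
  let ?P = "\<lambda>a. process_vertex tau (load E V x) X X' (t a) (\<sigma> a)"
  have "fst (snd (fold ?P as s)) \<subseteq> E \<and> snd (snd (fold ?P as s)) \<subseteq> E"
    if "set as \<subseteq> A" "fst (snd s) \<subseteq> E \<and> snd (snd s) \<subseteq> E" for as s
    using that
  proof (induction as arbitrary: s)
    case (Cons a as)
    have "valid_sequence a (\<sigma> a)" using assms Cons.prems(1) by simp
    then have "fst ` set (\<sigma> a) \<subseteq> E" by (auto simp: valid_sequence_def deltaA_def)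
    then have "fst (snd (?P a s)) \<subseteq> E \<and> snd (snd (?P a s)) \<subseteq> E"
      using process_vertex_subset[of tau "load E V x" X X' "t a" "\<sigma> a" s] Cons.prems(2) by blast
    from Cons.IH[OF _ this] Cons.prems(1) show ?case by simp
  qed simp
  from this[of "arrival_order A t" "(Map.empty, {}, {})"]
  show ?thesis using arrival_order(2)[OF finite_A] by (simp add: approx_poi_def)
qed

text \<open>Comparisons of times, acceptance tests and value tests are all that a run consults. Over
  \<open>A\<close> and \<open>Sigma E V\<close> there are finitely many of them, which gives
  measurability of the whole algorithm.\<close>

lemma approx_poi_cong:
  assumes valid: "\<And>a. a \<in> A \<Longrightarrow> valid_sequence a (\<sigma> a)"
    and t: "\<And>a a'. a \<in> A \<Longrightarrow> a' \<in> A \<Longrightarrow> (t a \<le> t a') = (t2 a \<le> t2 a')"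
    and acc: "\<And>a p. a \<in> A \<Longrightarrow> p \<in> Sigma E V \<Longrightarrow> accepts (load E V x) (t a) p = accepts (load E V x) (t2 a) p"
    and X: "\<And>p. p \<in> Sigma E V \<Longrightarrow> matches tau X p = matches tau X2 p"
    and X': "\<And>p. p \<in> Sigma E V \<Longrightarrow> matches tau X' p = matches tau X2' p"
  shows "approx_poi A E tau V x \<sigma> t X X' = approx_poi A E tau V x \<sigma> t2 X2 X2'"
proof -
  let ?c = "load E V x"
  have "finite A" by (rule finite_A)
  have "\<exists>as. distinct as \<and> set as = A" using finite_distinct_list[OF finite_A] by blast
  from someI_ex[OF this] have ord: "arrival_order A t2 = arrival_order A t"
    unfolding arrival_order_def using t by (intro sort_key_cong_le) auto
  let ?f = "\<lambda>a. process_vertex tau ?c X X' (t a) (\<sigma> a)"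
  let ?g = "\<lambda>a. process_vertex tau ?c X2 X2' (t2 a) (\<sigma> a)"
  have "snd (fold ?f as (z, M, Q)) = snd (fold ?g as (z2, M, Q))"
    if "set as \<subseteq> A" "similar tau (Sigma E V) z z2" for as z z2 M Q
    using that
  proof (induction as arbitrary: z z2 M Q)
    case (Cons a as)
    have a: "a \<in> A" and as: "set as \<subseteq> A" using Cons.prems by auto
    have sub: "set (\<sigma> a) \<subseteq> Sigma E V"
      using valid[OF a] by (auto simp: valid_sequence_def deltaA_def)
    have pc: "similar tau (Sigma E V) (fst (?f a (z, M, Q))) (fst (?g a (z2, M, Q)))"
      "snd (?f a (z, M, Q)) = snd (?g a (z2, M, Q))"
      using process_vertex_cong[where l = "\<sigma> a" and S = "Sigma E V" and c = "?c" and t = "t a" and ?t2.0 = "t2 a"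
          and M = M and Q = Q, OF sub acc[OF a] X X' Cons.prems(2)] by auto
    obtain z' M' Q' where f: "?f a (z, M, Q) = (z', M', Q')" by (rule prod_cases3)
    then obtain z2' where g: "?g a (z2, M, Q) = (z2', M', Q')" using pc(2) by (metis prod.collapse snd_conv)
    show ?case using Cons.IH[OF as, of z' z2' M' Q'] pc(1) unfolding fold_simps f g by simp
  qed simp
  from this[of "arrival_order A t" Map.empty Map.empty "{}" "{}"]
  show ?thesis
    using arrival_order(2)[OF finite_A] unfolding approx_poi_def ord by (simp add: similar_def)
qed

lemma approx_poi_measurable:
  assumes valid: "\<And>a. a \<in> A \<Longrightarrow> valid_sequence a (\<sigma> a)"
    and t[measurable]: "\<And>a. a \<in> A \<Longrightarrow> (\<lambda>\<omega>. t \<omega> a) \<in> borel_measurable W"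
    and X[measurable]: "\<And>e. e \<in> E \<Longrightarrow> (\<lambda>\<omega>. X \<omega> e) \<in> borel_measurable W"
    and X'[measurable]: "\<And>e. e \<in> E \<Longrightarrow> (\<lambda>\<omega>. X' \<omega> e) \<in> borel_measurable W"
  shows "(\<lambda>\<omega>. approx_poi A E tau V x \<sigma> (t \<omega>) (X \<omega>) (X' \<omega>)) \<in> W \<rightarrow>\<^sub>M count_space UNIV"
proof -
  let ?c = "load E V x"
  define Ps where "Ps = (\<Union>a\<in>A. \<Union>a'\<in>A. {\<lambda>\<omega>. t \<omega> a \<le> t \<omega> a'})
    \<union> (\<Union>a\<in>A. \<Union>p\<in>Sigma E V. {\<lambda>\<omega>. accepts ?c (t \<omega> a) p})
    \<union> (\<Union>p\<in>Sigma E V. {\<lambda>\<omega>. matches tau (X \<omega>) p}) \<union> (\<Union>p\<in>Sigma E V. {\<lambda>\<omega>. matches tau (X' \<omega>) p})"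
  show ?thesis
  proof (rule measurable_finite_factor[of Ps])
    show "finite Ps" unfolding Ps_def using finite_A finite_Sigma_V by simp
    have m1: "Measurable.pred W (\<lambda>\<omega>. t \<omega> a \<le> t \<omega> a')" if "a \<in> A" "a' \<in> A" for a a'
      using that by measurable
    have m2: "Measurable.pred W (\<lambda>\<omega>. accepts ?c (t \<omega> a) (e, v))" if "a \<in> A" for a e v
      unfolding accepts_def case_prod_conv using that by measurable
    have m3: "Measurable.pred W (\<lambda>\<omega>. matches tau (X \<omega>) (e, v))"
      "Measurable.pred W (\<lambda>\<omega>. matches tau (X' \<omega>) (e, v))" if "e \<in> E" for e v
      unfolding matches_def case_prod_conv using that by measurable
    show "Measurable.pred W P" if "P \<in> Ps" for P
      using that unfolding Ps_def by (elim UnE UN_E) (auto intro: m1 m2 m3)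
    fix \<omega> \<omega>' assume *: "\<forall>P\<in>Ps. P \<omega> = P \<omega>'"
    have c1: "(t \<omega> a \<le> t \<omega> a') = (t \<omega>' a \<le> t \<omega>' a')" if "a \<in> A" "a' \<in> A" for a a'
    proof -
      have "(\<lambda>\<omega>. t \<omega> a \<le> t \<omega> a') \<in> Ps" using that unfolding Ps_def by blast
      from bspec[OF * this] show ?thesis .
    qed
    have c2: "accepts ?c (t \<omega> a) p = accepts ?c (t \<omega>' a) p" if "a \<in> A" "p \<in> Sigma E V" for a p
    proof -
      have "(\<lambda>\<omega>. accepts ?c (t \<omega> a) p) \<in> Ps" using that unfolding Ps_def by blast
      from bspec[OF * this] show ?thesis .
    qed
    have c3: "matches tau (X \<omega>) p = matches tau (X \<omega>') p" if "p \<in> Sigma E V" for p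
    proof -
      have "(\<lambda>\<omega>. matches tau (X \<omega>) p) \<in> Ps" using that unfolding Ps_def by blast
      from bspec[OF * this] show ?thesis .
    qed
    have c4: "matches tau (X' \<omega>) p = matches tau (X' \<omega>') p" if "p \<in> Sigma E V" for p
    proof -
      have "(\<lambda>\<omega>. matches tau (X' \<omega>) p) \<in> Ps" unfolding Ps_def by (rule UnI2) (use that in blast)
      from bspec[OF * this] show ?thesis .
    qed
    show "approx_poi A E tau V x \<sigma> (t \<omega>) (X \<omega>) (X' \<omega>) = approx_poi A E tau V x \<sigma> (t \<omega>') (X \<omega>') (X' \<omega>')"
      by (rule approx_poi_cong[OF valid c1 c2 c3 c4])
  qed
qed

text \<open>A bound for each single sample. A pair whose targets all hold is served, so its edge is
  matched and its value is the true capped weight. On the right, a matched edge yields at least its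
  capped weight, and a queried edge that is not matched has no excess.\<close>

lemma approx_poi_accounting:
  assumes valid: "\<And>a. a \<in> A \<Longrightarrow> valid_sequence a (\<sigma> a)"
    and cap: "\<And>e. e \<in> E \<Longrightarrow> X e > tau e \<Longrightarrow> V e \<noteq> {} \<Longrightarrow> tau e \<in> V e"
    and cons: "consistent tau V (load E V x) t \<sigma> (arrival_order A t) X X' r"
    and MQ: "approx_poi A E tau V x \<sigma> t X X' = (M, Q)"
  shows "(\<Sum>(e, v)\<in>Sigma E V. v * of_bool (\<forall>a\<in>A. r a \<in> target (load E V x) t (e, v) a))
    \<le> (\<Sum>e\<in>E. of_bool (e \<in> M) * X e - of_bool (e \<in> Q) * max (X e - tau e) 0)"
proof -
  let ?c = "load E V x" and ?as = "arrival_order A t"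
  note ao = arrival_order[OF finite_A, of t]
  obtain z M' Q' where "fold (\<lambda>a. process_vertex tau ?c X X' (t a) (\<sigma> a)) ?as (Map.empty, {}, {}) = (z, M', Q')"
    by (rule prod_cases3)
  then have fold: "fold (\<lambda>a. process_vertex tau ?c X X' (t a) (\<sigma> a)) ?as (Map.empty, {}, {}) = (z, M, Q)"
    using MQ unfolding approx_poi_def by simp
  have proper: "proper_sequence V a (\<sigma> a)" if "a \<in> set ?as" for a
    using valid proper_sequence_valid that ao(2) by simp
  \<comment> \<open>A weight above the cap makes \<open>tau e\<close> itself a value, and no value
    exceeds the cap.\<close>
  have cap': "Max (V e) = tau e" if "a \<in> set ?as" "(e, v) \<in> set (\<sigma> a)" "X e > tau e" for a e v
  proof -
    have "a \<in> A" using that ao(2) by simp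
    note d = valid_sequenceD[OF valid[OF this] that(2)]
    show ?thesis
      using cap[OF d(1) that(3)] d(3) V_bounds(2)[OF d(1)] finite_V[OF d(1)] by (intro Max_eqI) auto
  qed
  have run: "(\<forall>e. fst e \<notin> set ?as \<longrightarrow> z e = None)
      \<and> M = {e. fst e \<in> set ?as \<and> (\<exists>v. served ?c t ?as r (e, v))}
      \<and> snd ` M = taken ?c t r (set ?as)
      \<and> (\<forall>e\<in>Q. X e > tau e \<longrightarrow> e \<in> M)
      \<and> Q \<subseteq> (\<Union>a\<in>set ?as. fst ` set (\<sigma> a))"
  proof (rule fold_process_vertex[where post = "[]"])
    show "consistent tau V ?c t \<sigma> ?as X X' r" by (fact cons)
    show "fold (\<lambda>a. process_vertex tau ?c X X' (t a) (\<sigma> a)) ?as (Map.empty, {}, {}) = (z, M, Q)"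
      by (fact fold)
  qed (use ao(1) proper cap' in auto)
  have M: "M = {e. fst e \<in> A \<and> (\<exists>v. served ?c t ?as r (e, v))}" using run ao(2) by simp
  have QM: "e \<in> M" if "e \<in> Q" "X e > tau e" for e
    using run[THEN conjunct2, THEN conjunct2, THEN conjunct2, THEN conjunct1] that by blast
  have val: "v = min (X e) (tau e)" "e \<in> M" if "served ?c t ?as r (e, v)" "fst e \<in> A" for e v
  proof -
    show "e \<in> M" using that M by auto
    let ?Z = "merged (queried V ?c t ?as r) X X'"
    have acc: "accepts ?c (t (fst e)) (e, v)" and nt: "snd e \<notin> taken ?c t r (earlier ?as (fst e))"
      and re: "r (fst e) = Some (e, v)"
      using that by (auto simp: served_def)
    have "find (matches tau ?Z) (\<sigma> (fst e)) = Some (e, v)"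
      using cons re that(2) ao(2) by (simp add: consistent_def)
    then have in_set: "(e, v) \<in> set (\<sigma> (fst e))" and m: "matches tau ?Z (e, v)"
      using find_in_set by fastforce+
    have "v \<le> Max (V e)" using valid_sequenceD(5)[OF valid[OF that(2)] in_set] .
    \<comment> \<open>Acceptance is monotone in the value: accepting \<open>v\<close> implies
      accepting \<open>Max (V e)\<close>, so the weight behind the match is the true one.\<close>
    then have "queried V ?c t ?as r e" using acc nt by (auto simp: queried_def accepts_def)
    then show "v = min (X e) (tau e)" using m by (simp add: matches_def merged_def)
  qed
  have tgt: "served ?c t ?as r (e, v)" if "e \<in> E" "\<forall>a\<in>A. r a \<in> target ?c t (e, v) a" for e v
  proof -
    have eA: "fst e \<in> A" using that(1) E_subset by auto
    have "r (fst e) = Some (e, v)" "accepts ?c (t (fst e)) (e, v)"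
      using bspec[OF that(2) eA] by (auto simp: target_def)
    moreover have "snd e \<notin> taken ?c t r (earlier ?as (fst e))"
    proof
      assume "snd e \<in> taken ?c t r (earlier ?as (fst e))"
      then obtain a' where a': "a' \<in> earlier ?as (fst e)" "hits ?c (t a') (r a') (snd e)"
        by (auto simp: taken_def)
      note ea = earlier_arrival[OF finite_A eA a'(1)]
      show False using bspec[OF that(2) ea(1)] ea a'(2) by (auto simp: target_def)
    qed
    ultimately show ?thesis by (simp add: served_def)
  qed
  have "(\<Sum>v\<in>V e. v * of_bool (\<forall>a\<in>A. r a \<in> target ?c t (e, v) a))
      \<le> of_bool (e \<in> M) * X e - of_bool (e \<in> Q) * max (X e - tau e) 0" if e: "e \<in> E" for e
  proof -
    have eA: "fst e \<in> A" using e E_subset by auto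
    have "(\<Sum>v\<in>V e. v * of_bool (\<forall>a\<in>A. r a \<in> target ?c t (e, v) a)) \<le>
        (\<Sum>v\<in>V e. v * of_bool (v = min (X e) (tau e) \<and> e \<in> M))"
    proof (intro sum_mono mult_left_mono)
      fix v assume "v \<in> V e"
      then show "0 \<le> v" using V_bounds(1)[OF e] by (simp add: less_imp_le)
      show "(of_bool (\<forall>a\<in>A. r a \<in> target ?c t (e, v) a) :: real) \<le> of_bool (v = min (X e) (tau e) \<and> e \<in> M)"
        using val[OF tgt[OF e] eA, of v] by simp
    qed
    also have "\<dots> = (\<Sum>v\<in>V e. if v = min (X e) (tau e) then v * of_bool (e \<in> M) else 0)"
      by (intro sum.cong) auto
    also have "\<dots> = (if min (X e) (tau e) \<in> V e then min (X e) (tau e) * of_bool (e \<in> M) else 0)"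
      using finite_V[OF e] by (simp add: sum.delta)
    also have "\<dots> \<le> of_bool (e \<in> M) * min (X e) (tau e)"
    proof (cases "e \<in> M")
      case True
      then obtain v where s: "served ?c t ?as r (e, v)" using M by auto
      have "find (matches tau (merged (queried V ?c t ?as r) X X')) (\<sigma> (fst e)) = Some (e, v)"
        using cons s eA ao(2) by (simp add: consistent_def served_def)
      then have "(e, v) \<in> set (\<sigma> (fst e))" using find_in_set by fastforce
      then have "v \<in> V e" using valid_sequenceD(3)[OF valid[OF eA]] by blast
      then show ?thesis using val(1)[OF s eA] True by simp
    qed simp
    also have "\<dots> \<le> of_bool (e \<in> M) * X e - of_bool (e \<in> Q) * max (X e - tau e) 0"
      using QM[of e] by (cases "e \<in> M"; cases "e \<in> Q") (force simp: max_def min_def not_less)+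
    finally show ?thesis .
  qed
  then show ?thesis
    using finite_E finite_V by (subst sum.Sigma[symmetric]) (auto intro!: sum_mono)
qed

end

subsection \<open>Expected utility for given arrival times and sequences\<close>

context poi_instance
begin

lemma find_matches_measurable:
  assumes "\<And>e v. (e, v) \<in> set l \<Longrightarrow> e \<in> J"
  shows "(\<lambda>Z. find (matches tau Z) l) \<in> PiM J D \<rightarrow>\<^sub>M count_space UNIV"
proof (rule find_measurable)
  fix p assume "p \<in> set l"
  then have "fst p \<in> J" using assms[of "fst p" "snd p"] by simp
  then show "Measurable.pred (PiM J D) (\<lambda>Z. matches tau Z p)"
    unfolding matches_def case_prod_unfold by measurable
qed

lemma find_matches_cong:
  assumes "\<And>e v. (e, v) \<in> set l \<Longrightarrow> Z e = Z' e"
  shows "find (matches tau Z) l = find (matches tau Z') l"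
  using assms by (intro find_cong_set) (auto simp: matches_def)

text \<open>The capped weights around \<open>a\<close> are an image of the full weight vector. This
  puts the single-vertex runs of all vertices on one probability space.\<close>

lemma single_prob_eq:
  assumes "valid_sequence a l"
  shows "single_prob a l K = measure (PiM E D) {Z \<in> space (PiM E D). find (matches tau Z) l \<in> K}"
proof -
  let ?J = "deltaA E a" and ?N = "PiM E D"
  let ?g = "\<lambda>Z. \<lambda>e\<in>?J. min (Z e) (tau e)"
  let ?Y = "Pi\<^sub>M ?J (\<lambda>e. distr (D e) borel (\<lambda>w. min w (tau e)))"
  have Y: "?Y = distr ?N (PiM ?J (\<lambda>_. borel)) ?g"
    using distr_PiM_coordinatewise[OF finite_E deltaA_subset, of "\<lambda>e w. min w (tau e)" "\<lambda>_. borel" a] by simp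
  have sv: "single_vertex y Map.empty l = find (\<lambda>(e, v). y e = v) l" for y
    by (rule single_vertex_eq_find) simp
  have lJ: "fst p \<in> ?J" if "p \<in> set l" for p
    using valid_sequenceD(4)[OF assms, of "fst p" "snd p"] that by simp
  have m: "(\<lambda>y. find (\<lambda>(e, v). y e = v) l) \<in> PiM ?J (\<lambda>_. borel :: real measure) \<rightarrow>\<^sub>M count_space UNIV"
  proof (rule find_measurable)
    fix p assume "p \<in> set l"
    then have "fst p \<in> ?J" by (rule lJ)
    then show "Measurable.pred (PiM ?J (\<lambda>_. borel :: real measure)) (\<lambda>y. case p of (e, v) \<Rightarrow> y e = v)"
      unfolding case_prod_unfold by measurable
  qed
  have g: "?g \<in> ?N \<rightarrow>\<^sub>M PiM ?J (\<lambda>_. borel)"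
  proof (rule measurable_restrict)
    fix e assume "e \<in> ?J"
    then have "e \<in> E" using deltaA_subset by blast
    then show "(\<lambda>Z. min (Z e) (tau e)) \<in> borel_measurable ?N" by measurable
  qed
  have fg: "find (\<lambda>(e, v). ?g Z e = v) l = find (matches tau Z) l" for Z
    using lJ by (intro find_cong_set) (force simp: matches_def)
  let ?S = "{y \<in> space (PiM ?J (\<lambda>_. borel :: real measure)). find (\<lambda>(e, v). y e = v) l \<in> K}"
  have S: "?S \<in> sets (PiM ?J (\<lambda>_. borel))"
    using measurable_sets[OF m, of K] by (simp add: vimage_def Int_def conj_commute)
  have "single_prob a l K = measure ?Y ?S"
    unfolding single_prob_def Let_def Y sv by simp
  also have "\<dots> = measure ?N (?g -` ?S \<inter> space ?N)"
    unfolding Y by (rule measure_distr[OF g S])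
  also have "?g -` ?S \<inter> space ?N = {Z \<in> space ?N. find (matches tau Z) l \<in> K}"
    using measurable_space[OF g] fg by auto
  finally show ?thesis .
qed

text \<open>Lookups of different vertices of \<open>A\<close> read disjoint sets of edges.\<close>

lemma find_matches_indep:
  assumes valid: "\<And>a. a \<in> A \<Longrightarrow> valid_sequence a (\<sigma> a)"
  shows "measure (PiM E D) {Z \<in> space (PiM E D). \<forall>a\<in>A. find (matches tau Z) (\<sigma> a) \<in> K a} =
    (\<Prod>a\<in>A. single_prob a (\<sigma> a) (K a))"
proof -
  let ?N = "PiM E D"
  define S where "S a = {Y \<in> space (PiM (deltaA E a) D). find (matches tau Y) (\<sigma> a) \<in> K a}" for a
  have S: "S a \<in> sets (PiM (deltaA E a) D)" if "a \<in> A" for a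
    using measurable_sets[OF find_matches_measurable[of "\<sigma> a" "deltaA E a"], of "K a"]
      valid_sequenceD(4)[OF valid[OF that]]
    unfolding S_def by (simp add: vimage_def Int_def conj_commute)
  have eq: "restrict Z (deltaA E a) \<in> S a \<longleftrightarrow> find (matches tau Z) (\<sigma> a) \<in> K a"
    if "a \<in> A" "Z \<in> space ?N" for a Z
  proof -
    have "find (matches tau (restrict Z (deltaA E a))) (\<sigma> a) = find (matches tau Z) (\<sigma> a)"
      using valid_sequenceD(4)[OF valid[OF that(1)]] by (intro find_matches_cong) auto
    moreover have "restrict Z (deltaA E a) \<in> space (PiM (deltaA E a) D)"
      by (simp add: space_PiM)
    ultimately show ?thesis by (simp add: S_def)
  qed
  have "measure ?N {Z \<in> space ?N. \<forall>a\<in>A. restrict Z (deltaA E a) \<in> S a} =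
      (\<Prod>a\<in>A. measure ?N {Z \<in> space ?N. restrict Z (deltaA E a) \<in> S a})"
    by (rule measure_block_indep[OF finite_E finite_A deltaA_subset _ S])
      (auto simp: disjoint_family_on_def deltaA_def)
  moreover have "{Z \<in> space ?N. \<forall>a\<in>A. restrict Z (deltaA E a) \<in> S a} =
      {Z \<in> space ?N. \<forall>a\<in>A. find (matches tau Z) (\<sigma> a) \<in> K a}"
    using eq by (intro Collect_cong conj_cong ball_cong refl)
  moreover have "measure ?N {Z \<in> space ?N. restrict Z (deltaA E a) \<in> S a} = single_prob a (\<sigma> a) (K a)"
    if "a \<in> A" for a
    unfolding single_prob_eq[OF valid[OF that]] using eq[OF that]
    by (intro arg_cong[where f = "measure ?N"] Collect_cong conj_cong refl)
  ultimately show ?thesis by simp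
qed

text \<open>With \<open>r\<close> fixed, consistency says that lookups in a merged vector return
  \<open>r\<close>. The selection is then fixed too, so this vector has the law of the true weights
  by \<open>distr_merged\<close>, and the simulated weights disappear from the probability.\<close>

lemma consistent_prob:
  fixes c :: "'b \<Rightarrow> real" and t :: "'a \<Rightarrow> real" and r :: "'a \<Rightarrow> (('a \<times> 'b) \<times> real) option"
  assumes valid: "\<And>a. a \<in> A \<Longrightarrow> valid_sequence a (\<sigma> a)" and as: "set as = A"
  defines "W \<equiv> PiM E D \<Otimes>\<^sub>M PiM E D"
  defines "S \<equiv> {\<omega> \<in> space W. consistent tau V c t \<sigma> as (fst \<omega>) (snd \<omega>) r}"
  shows "S \<in> sets W"
    and "measure W S = measure (PiM E D) {Z \<in> space (PiM E D). \<forall>a\<in>A. find (matches tau Z) (\<sigma> a) = r a}"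
proof -
  let ?N = "PiM E D"
  let ?P = "queried V c t as r"
  let ?f = "\<lambda>\<omega>. \<lambda>e\<in>E. if ?P e then fst \<omega> e else snd \<omega> e"
  let ?T = "{Z \<in> space ?N. \<forall>a\<in>A. find (matches tau Z) (\<sigma> a) = r a}"
  have f: "?f \<in> W \<rightarrow>\<^sub>M ?N"
    unfolding W_def by (intro measurable_restrict) auto
  have T: "?T \<in> sets ?N"
  proof (rule sets.sets_Collect_finite_All[OF _ finite_A])
    fix a assume "a \<in> A"
    then show "{Z \<in> space ?N. find (matches tau Z) (\<sigma> a) = r a} \<in> sets ?N"
      using measurable_sets[OF find_matches_measurable[of "\<sigma> a" E], of "{r a}"] valid_sequenceD(1)[OF valid]
      by (simp add: vimage_def Int_def conj_commute)
  qed
  have eq: "find (matches tau (merged ?P (fst \<omega>) (snd \<omega>))) (\<sigma> a) = find (matches tau (?f \<omega>)) (\<sigma> a)"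
    if "a \<in> A" for a \<omega>
    using valid_sequenceD(1)[OF valid[OF that]] by (intro find_matches_cong) (auto simp: merged_def)
  have SfT: "S = ?f -` ?T \<inter> space W"
    using measurable_space[OF f] eq unfolding S_def consistent_def as by auto
  show "S \<in> sets W" unfolding SfT by (rule measurable_sets[OF f T])
  have "measure W S = measure (distr W ?N ?f) ?T"
    unfolding SfT by (rule measure_distr[OF f T, symmetric])
  then show "measure W S = measure ?N ?T"
    unfolding W_def distr_merged[OF finite_E] .
qed

text \<open>The events \<open>C r\<close> split the sample space by the unique consistent outcome
  vector. On \<open>C r\<close> the gain adjusted by the excess is almost surely at least
  \<open>G r\<close>, and \<open>C r\<close> has the probability of the event \<open>F r\<close>
  about plain lookups, which are independent across vertices. Summing over \<open>r\<close> collects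
  these probabilities into products over \<open>A\<close>.\<close>

lemma expected_utility_given_times:
  fixes t :: "'a \<Rightarrow> real"
  assumes valid: "\<And>a. a \<in> A \<Longrightarrow> valid_sequence a (\<sigma> a)"
  shows "(\<Sum>p\<in>Sigma E V. snd p * (\<Prod>a\<in>A. single_prob a (\<sigma> a) (target (load E V x) t p a)))
    \<le> (\<integral>(X, X'). poi_utility cost X (approx_poi A E tau V x \<sigma> t X X') \<partial>(PiM E D \<Otimes>\<^sub>M PiM E D))"
proof -
  let ?N = "PiM E D" and ?c = "load E V x" and ?as = "arrival_order A t"
  let ?W = "PiM E D \<Otimes>\<^sub>M PiM E D"
  note ao = arrival_order[OF finite_A, of t]
  interpret W: pair_prob_space ?N ?N ..
  define res where "res = (\<lambda>\<omega>. approx_poi A E tau V x \<sigma> t (fst \<omega>) (snd \<omega>))"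
  have res: "res \<in> ?W \<rightarrow>\<^sub>M count_space UNIV"
    unfolding res_def by (rule approx_poi_measurable[OF valid]) measurable
  have sub: "fst (res \<omega>) \<subseteq> E \<and> snd (res \<omega>) \<subseteq> E" for \<omega>
    unfolding res_def by (rule approx_poi_subset[OF valid])
  have Xm: "(\<lambda>\<omega>. fst \<omega> e) \<in> borel_measurable ?W" if "e \<in> E" for e
    using that by measurable
  have Xd: "distr ?W (D e) (\<lambda>\<omega>. fst \<omega> e) = D e" if "e \<in> E" for e
  proof -
    have "distr ?W (D e) (\<lambda>\<omega>. fst \<omega> e) = distr (distr ?W ?N fst) (D e) (\<lambda>X. X e)"
      using that by (subst distr_distr) (auto simp: comp_def)
    then show ?thesis using that by (simp add: P.distr_pair_fst PiM_component)
  qed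
  have indep: "(\<integral>\<omega>. of_bool (e \<in> snd (res \<omega>)) * max (fst \<omega> e - tau e) 0 \<partial>?W) =
      cost e * (\<integral>\<omega>. of_bool (e \<in> snd (res \<omega>)) \<partial>?W)" if e: "e \<in> E" for e
  proof -
    have b: "(\<lambda>\<omega>. of_bool (e \<in> snd (res \<omega>)) :: real) \<in> borel_measurable ?W"
      by (rule measurable_compose[OF res]) simp
    have i: "integrable ?W (\<lambda>\<omega>. of_bool (e \<in> snd (res \<omega>)) * max (fst \<omega> e - tau e) 0)"
      by (rule integrable_utility(3)[OF W.P.prob_space_axioms Xm Xd res sub e])
    have i': "integrable ?W (\<lambda>\<omega>. of_bool (e \<in> snd (res \<omega>)) :: real)"
      by (rule W.P.integrable_const_bound[where B = 1]) (use b in simp_all)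
    have "(\<integral>\<omega>. of_bool (e \<in> snd (res \<omega>)) * max (fst \<omega> e - tau e) 0 \<partial>?W) =
        (\<integral>X'. (\<integral>X. of_bool (e \<in> snd (res (X, X'))) * max (X e - tau e) 0 \<partial>?N) \<partial>?N)"
      using W.integral_snd[of "\<lambda>X X'. of_bool (e \<in> snd (res (X, X'))) * max (X e - tau e) 0 :: real"] i
      by (simp add: case_prod_unfold)
    also have "\<dots> = (\<integral>X'. (\<integral>X. of_bool (e \<in> snd (res (X, X'))) \<partial>?N) * cost e \<partial>?N)"
    proof (rule Bochner_Integration.integral_cong[OF refl])
      fix X' assume X': "X' \<in> space ?N"
      have "(\<lambda>X. of_bool (e \<in> snd (res (X, X'))) :: real) \<in> borel_measurable ?N"
        using measurable_compose[OF measurable_Pair2'[OF X'] b] by simp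
      then show "(\<integral>X. of_bool (e \<in> snd (res (X, X'))) * max (X e - tau e) 0 \<partial>?N) =
          (\<integral>X. of_bool (e \<in> snd (res (X, X'))) \<partial>?N) * cost e"
        by (rule integral_excess_indep[OF e]) (simp add: res_def approx_poi_query_indep[symmetric])
    qed
    also have "\<dots> = cost e * (\<integral>\<omega>. of_bool (e \<in> snd (res \<omega>)) \<partial>?W)"
      using W.integral_snd[of "\<lambda>X X'. of_bool (e \<in> snd (res (X, X'))) :: real"] i'
      by (simp add: case_prod_unfold mult.commute)
    finally show ?thesis .
  qed
  note acc = expected_utility_excess[OF W.P.prob_space_axioms Xm Xd res sub indep]
  \<comment> \<open>Outcome vectors are extensional on \<open>A\<close>, so agreement on
    \<open>A\<close> is equality and the sum over \<open>R\<close> meets the consistent vector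
    exactly once.\<close>
  define R where "R = PiE A (\<lambda>a. insert None (Some ` set (\<sigma> a)))"
  have finR: "finite R" unfolding R_def using finite_A by (intro finite_PiE) auto
  define G where "G r = (\<Sum>(e, v)\<in>Sigma E V. v * of_bool (\<forall>a\<in>A. r a \<in> target ?c t (e, v) a))" for r
  define C where "C r = {\<omega> \<in> space ?W. consistent tau V ?c t \<sigma> ?as (fst \<omega>) (snd \<omega>) r}" for r
  define F where "F r = {Z \<in> space ?N. \<forall>a\<in>A. find (matches tau Z) (\<sigma> a) = r a}" for r
  have C: "C r \<in> sets ?W" "measure ?W (C r) = measure ?N (F r)" for r
    using consistent_prob[OF valid ao(2), of ?c t r] by (simp_all add: C_def F_def)
  have proper: "proper_sequence V a (\<sigma> a)" if "a \<in> set ?as" for a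
    using valid proper_sequence_valid that ao(2) by simp
  have iC: "integrable ?W (indicat_real (C r))" for r
    by (intro integrable_real_indicator C) (simp add: W.P.emeasure_finite less_top[symmetric])
  have AEcap: "AE \<omega> in ?W. \<forall>e\<in>E. min (fst \<omega> e) (tau e) \<in> V e \<or> min (fst \<omega> e) (tau e) \<le> 0"
  proof (rule AE_finite_allI[OF finite_E])
    fix e assume e: "e \<in> E"
    have m: "(\<lambda>\<omega>. fst \<omega> e) \<in> ?W \<rightarrow>\<^sub>M D e" using Xm[OF e] by (simp cong: measurable_cong_sets add: sets_D)
    show "AE \<omega> in ?W. min (fst \<omega> e) (tau e) \<in> V e \<or> min (fst \<omega> e) (tau e) \<le> 0"
      using AE_distrD[OF m, unfolded Xd[OF e], OF cap_in_V[OF e]] .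
  qed
  have "(\<Sum>r\<in>R. measure ?N (F r) * G r) = (\<integral>\<omega>. (\<Sum>r\<in>R. indicat_real (C r) \<omega> * G r) \<partial>?W)"
    using iC C(1) by (subst Bochner_Integration.integral_sum) (auto simp: C(2) sets.Int_space_eq2)
  also have "\<dots> \<le> (\<integral>\<omega>. (\<Sum>e\<in>E. of_bool (e \<in> fst (res \<omega>)) * fst \<omega> e
        - of_bool (e \<in> snd (res \<omega>)) * max (fst \<omega> e - tau e) 0) \<partial>?W)"
  proof (rule integral_mono_AE[OF _ acc(1)])
    show "integrable ?W (\<lambda>\<omega>. \<Sum>r\<in>R. indicat_real (C r) \<omega> * G r)" using iC by auto
    show "AE \<omega> in ?W. (\<Sum>r\<in>R. indicat_real (C r) \<omega> * G r) \<le>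
        (\<Sum>e\<in>E. of_bool (e \<in> fst (res \<omega>)) * fst \<omega> e - of_bool (e \<in> snd (res \<omega>)) * max (fst \<omega> e - tau e) 0)"
      using AEcap AE_space
    proof eventually_elim
      case (elim \<omega>)
      \<comment> \<open>A value in \<open>V e\<close> forces the cap to be positive, so the capped
        weight \<open>tau e\<close> is not among the nonpositive exceptions and lies in
        \<open>V e\<close>.\<close>
      have cap: "tau e \<in> V e" if e: "e \<in> E" and gt: "fst \<omega> e > tau e" and ne: "V e \<noteq> {}" for e
      proof -
        obtain v where "v \<in> V e" using ne by auto
        then have "tau e > 0" using V_bounds[OF e] by force
        then show ?thesis using bspec[OF elim(1) e] gt by auto
      qed
      obtain r0 where r0: "consistent tau V ?c t \<sigma> ?as (fst \<omega>) (snd \<omega>) r0"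
        using consistent_exists[OF ao(1) proper] by blast
      define r where "r = restrict r0 A"
      have r: "consistent tau V ?c t \<sigma> ?as (fst \<omega>) (snd \<omega>) r"
        using r0 consistent_cong[of ?as r0 r] ao(2) by (simp add: r_def)
      have "r a \<in> insert None (Some ` set (\<sigma> a))" if "a \<in> A" for a
      proof (cases "r a")
        case (Some p)
        then have "find (matches tau (merged (queried V ?c t ?as r) (fst \<omega>) (snd \<omega>))) (\<sigma> a) = Some p"
          using r that ao(2) by (simp add: consistent_def)
        then show ?thesis using find_in_set Some by fastforce
      qed simp
      then have rR: "r \<in> R" unfolding R_def r_def by auto
      have uniq: "r' = r" if "r' \<in> R" "consistent tau V ?c t \<sigma> ?as (fst \<omega>) (snd \<omega>) r'" for r'
      proof (rule PiE_ext)
        show "r' \<in> PiE A (\<lambda>a. insert None (Some ` set (\<sigma> a)))" "r \<in> PiE A (\<lambda>a. insert None (Some ` set (\<sigma> a)))"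
          using that(1) rR by (auto simp: R_def)
        show "r' a = r a" if "a \<in> A" for a
          using consistent_unique[OF ao(1) proper \<open>consistent tau V ?c t \<sigma> ?as (fst \<omega>) (snd \<omega>) r'\<close> r] that ao(2) by simp
      qed
      have "(\<Sum>r'\<in>R. indicat_real (C r') \<omega> * G r') = (\<Sum>r'\<in>R. if r' = r then G r' else 0)"
      proof (intro sum.cong refl)
        fix r' assume "r' \<in> R"
        then have "\<omega> \<in> C r' \<longleftrightarrow> r' = r" using uniq r elim(2) unfolding C_def by blast
        then show "indicat_real (C r') \<omega> * G r' = (if r' = r then G r' else 0)"
          by (simp add: indicator_def)
      qed
      also have "\<dots> = G r" using rR finR by simp
      also have "\<dots> \<le> (\<Sum>e\<in>E. of_bool (e \<in> fst (res \<omega>)) * fst \<omega> e - of_bool (e \<in> snd (res \<omega>)) * max (fst \<omega> e - tau e) 0)"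
        unfolding G_def by (rule approx_poi_accounting[OF valid cap r]) (simp_all add: res_def)
      finally show ?case .
    qed
  qed
  also have "\<dots> = (\<integral>\<omega>. poi_utility cost (fst \<omega>) (res \<omega>) \<partial>?W)"
    by (rule acc(2)[symmetric])
  also have "\<dots> = (\<integral>(X, X'). poi_utility cost X (approx_poi A E tau V x \<sigma> t X X') \<partial>?W)"
    by (simp add: res_def case_prod_unfold)
  finally have lower: "(\<Sum>r\<in>R. measure ?N (F r) * G r) \<le> \<dots>" .
  have Fs: "F r \<in> sets ?N" for r
    unfolding F_def
  proof (rule sets.sets_Collect_finite_All[OF _ finite_A])
    fix a assume "a \<in> A"
    then show "{Z \<in> space ?N. find (matches tau Z) (\<sigma> a) = r a} \<in> sets ?N"
      using measurable_sets[OF find_matches_measurable[of "\<sigma> a" E], of "{r a}"] valid_sequenceD(1)[OF valid]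
      by (simp add: vimage_def Int_def conj_commute)
  qed
  \<comment> \<open>The disjoint events \<open>F r\<close> with every \<open>r a\<close> in
    \<open>K a\<close> unite to the event that all lookups fall into \<open>K\<close>, whose
    probability is a product.\<close>
  have tgt: "(\<Sum>r\<in>R. measure ?N (F r) * of_bool (\<forall>a\<in>A. r a \<in> K a)) = (\<Prod>a\<in>A. single_prob a (\<sigma> a) (K a))"
    for K
  proof -
    define R' where "R' = {r \<in> R. \<forall>a\<in>A. r a \<in> K a}"
    have "(\<Sum>r\<in>R. measure ?N (F r) * of_bool (\<forall>a\<in>A. r a \<in> K a)) = (\<Sum>r\<in>R'. measure ?N (F r))"
      unfolding R'_def using finR by (intro sum.mono_neutral_cong_right) auto
    also have "\<dots> = measure ?N (\<Union>r\<in>R'. F r)"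
    proof (rule P.finite_measure_finite_Union[symmetric])
      show "finite R'" using finR by (simp add: R'_def)
      show "disjoint_family_on F R'"
        unfolding disjoint_family_on_def
      proof (intro ballI impI)
        fix r r' assume r: "r \<in> R'" "r' \<in> R'" "r \<noteq> r'"
        then obtain a where "a \<in> A" "r a \<noteq> r' a"
          using PiE_ext[of r A "\<lambda>a. insert None (Some ` set (\<sigma> a))" r'] by (auto simp: R'_def R_def)
        then show "F r \<inter> F r' = {}" by (auto simp: F_def)
      qed
    qed (use Fs in auto)
    also have "(\<Union>r\<in>R'. F r) = {Z \<in> space ?N. \<forall>a\<in>A. find (matches tau Z) (\<sigma> a) \<in> K a}"
    proof (intro equalityI subsetI)
      fix Z assume "Z \<in> (\<Union>r\<in>R'. F r)"
      then show "Z \<in> {Z \<in> space ?N. \<forall>a\<in>A. find (matches tau Z) (\<sigma> a) \<in> K a}"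
        by (auto simp: F_def R'_def)
    next
      fix Z assume Z: "Z \<in> {Z \<in> space ?N. \<forall>a\<in>A. find (matches tau Z) (\<sigma> a) \<in> K a}"
      define r where "r = (\<lambda>a\<in>A. find (matches tau Z) (\<sigma> a))"
      have "find (matches tau Z) (\<sigma> a) \<in> insert None (Some ` set (\<sigma> a))" for a
        by (cases "find (matches tau Z) (\<sigma> a)") (auto dest: find_in_set)
      then have "r \<in> R'" using Z by (auto simp: r_def R'_def R_def)
      moreover have "Z \<in> F r" using Z by (auto simp: F_def r_def)
      ultimately show "Z \<in> (\<Union>r\<in>R'. F r)" by blast
    qed
    also have "measure ?N \<dots> = (\<Prod>a\<in>A. single_prob a (\<sigma> a) (K a))"
      by (rule find_matches_indep[OF valid])
    finally show ?thesis .
  qed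
  have "(\<Sum>r\<in>R. measure ?N (F r) * G r) =
      (\<Sum>p\<in>Sigma E V. snd p * (\<Sum>r\<in>R. measure ?N (F r) * of_bool (\<forall>a\<in>A. r a \<in> target ?c t p a)))"
    unfolding G_def by (subst sum_distrib_left, subst sum.swap) (simp add: sum_distrib_left case_prod_unfold mult_ac)
  with lower show ?thesis by (simp only: tgt)
qed

end

subsection \<open>The gain of a single vertex\<close>

abbreviation unit_uniform :: "real measure"
  where "unit_uniform \<equiv> uniform_measure lborel {0..1}"

lemma unit_uniform_eq: "unit_uniform = density lborel (\<lambda>x. ennreal (indicator {0..1} x))"
  unfolding uniform_measure_def by (intro density_cong) (auto simp: indicator_def)

lemma prob_space_unit_uniform: "prob_space unit_uniform"
  by (rule prob_space_uniform_measure) auto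

text \<open>Passes to the gauge integral, for which the fundamental theorem of calculus tolerates
  finitely many exceptional points.\<close>

lemma integral_unit_uniform:
  fixes f :: "real \<Rightarrow> real"
  assumes f: "f \<in> borel_measurable borel" and bound: "\<And>s. s \<in> {0..1} \<Longrightarrow> \<bar>f s\<bar> \<le> C"
  shows "(f has_integral (\<integral>s. f s \<partial>unit_uniform)) {0..1}"
proof -
  have "set_integrable lborel {0..1} f"
    unfolding set_integrable_def
  proof (rule Bochner_Integration.integrable_bound)
    show "integrable lborel (\<lambda>s. C * indicat_real {0..1::real} s)"
      by (intro integrable_mult_right integrable_real_indicator) auto
    show "(\<lambda>s. indicat_real {0..1} s *\<^sub>R f s) \<in> borel_measurable lborel" using f by simp
    show "AE s in lborel. norm (indicat_real {0..1} s *\<^sub>R f s) \<le> norm (C * indicat_real {0..1} s)"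
      using bound by (intro AE_I2) (force simp: indicator_def)
  qed
  from set_borel_integral_eq_integral[OF this]
  have "f integrable_on {0..1}" "integral {0..1} f = (\<integral>s. indicat_real {0..1} s *\<^sub>R f s \<partial>lborel)"
    by (auto simp: set_lebesgue_integral_def)
  moreover have "(\<integral>s. f s \<partial>unit_uniform) = (\<integral>s. indicat_real {0..1} s *\<^sub>R f s \<partial>lborel)"
    unfolding unit_uniform_eq using f by (intro integral_density) auto
  ultimately show ?thesis by (metis has_integral_integral)
qed

text \<open>The condition relaxes with time and holds at time 1, where the threshold is 0. The
  switch is either at 0 or where \<open>exp (s - 1) = 1 - v / c\<close>.\<close>

lemma acceptance_threshold:
  fixes c v :: real
  assumes c: "c > 0" and v: "v > 0"
  shows "\<exists>\<theta>\<in>{0..1}. \<forall>s\<in>{0..1}. (1 - exp (s - 1)) * c \<le> v \<longleftrightarrow> \<theta> \<le> s"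
proof (cases "(1 - exp (- 1)) * c \<le> v")
  case True
  have "(1 - exp (s - 1)) * c \<le> v" if "s \<in> {0..1}" for s
  proof -
    have "(1 - exp (s - 1)) * c \<le> (1 - exp (- 1)) * c"
      using that c by (intro mult_right_mono) auto
    then show ?thesis using True by linarith
  qed
  then show ?thesis by (intro bexI[of _ 0]) auto
next
  case False
  define u where "u = 1 - v / c"
  have u: "exp (- 1) < u" "u < 1"
    using False c v by (auto simp: u_def field_simps)
  then have u0: "0 < u" using exp_gt_zero[of "- 1 :: real"] by linarith
  have "- 1 < ln u" using u u0 by (metis exp_less_cancel_iff exp_ln)
  moreover have "ln u < 0" using u u0 by simp
  moreover have "(1 - exp (s - 1)) * c \<le> v \<longleftrightarrow> 1 + ln u \<le> s" for s
  proof -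
    have "(1 - exp (s - 1)) * c \<le> v \<longleftrightarrow> u \<le> exp (s - 1)"
      using c by (simp add: u_def field_simps)
    also have "\<dots> \<longleftrightarrow> ln u \<le> s - 1" using u0 ln_le_cancel_iff[of u "exp (s - 1)"] by simp
    finally show ?thesis by linarith
  qed
  ultimately show ?thesis by (intro bexI[of _ "1 + ln u"]) auto
qed

lemma integral_unit_uniform_hinge:
  assumes "t \<in> {0..1}" "\<theta> \<in> {0..1}"
  shows "(\<integral>s. of_bool (s \<le> t \<and> \<theta> \<le> s) \<partial>unit_uniform) = max 0 (t - \<theta>)"
proof -
  have "((\<lambda>s. of_bool (s \<le> t \<and> \<theta> \<le> s) :: real) has_integral (\<integral>s. of_bool (s \<le> t \<and> \<theta> \<le> s) \<partial>unit_uniform)) {0..1}"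
    by (rule integral_unit_uniform[where C = 1]) auto
  moreover have "((\<lambda>s. of_bool (s \<le> t \<and> \<theta> \<le> s) :: real) has_integral (max 0 (t - \<theta>))) {0..1}"
  proof -
    have "((\<lambda>s. 1 :: real) has_integral (max 0 (t - \<theta>))) {\<theta>..t}"
      using has_integral_const_real[of "1 :: real" \<theta> t] by (cases "\<theta> \<le> t") (auto simp: max_def)
    then have "((\<lambda>s. if s \<in> {\<theta>..t} then 1 else 0 :: real) has_integral (max 0 (t - \<theta>))) {0..1}"
      using assms by (subst has_integral_restrict) auto
    then show ?thesis by (rule has_integral_eq[rotated]) auto
  qed
  ultimately show ?thesis by (rule has_integral_unique)
qed

text \<open>
  With \<open>r s = (\<Prod>a\<in>A. 1 - P a s)\<close> the probability that a vertex of load \<open>c\<close> is still free at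
  time \<open>s\<close>, the gain rate is at least \<open>- c\<close> times the derivative of \<open>(1 - exp (s - 1)) * r s\<close>.
\<close>

lemma gain_lower_bound:
  fixes q :: "'a \<Rightarrow> real \<Rightarrow> real" and U :: "'a \<Rightarrow> real set" and c :: real
  assumes "finite A" and U: "\<And>a. a \<in> A \<Longrightarrow> finite (U a)" "\<And>a v. a \<in> A \<Longrightarrow> v \<in> U a \<Longrightarrow> 0 < v"
    and q: "\<And>a v. a \<in> A \<Longrightarrow> v \<in> U a \<Longrightarrow> 0 \<le> q a v"
    and "c > 0"
    and total: "(\<Sum>a\<in>A. \<Sum>v\<in>U a. q a v) \<le> 1" and value_ge: "c \<le> (\<Sum>a\<in>A. \<Sum>v\<in>U a. q a v * v)"
  defines "acc \<equiv> \<lambda>s v. (1 - exp (s - 1)) * c \<le> v"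
  defines "P \<equiv> \<lambda>a t. (\<integral>s. of_bool (s \<le> t) * (\<Sum>v\<in>U a. of_bool (acc s v) * q a v) \<partial>unit_uniform)"
  shows "(1 - 1 / exp 1) * c \<le>
    (\<integral>s. (\<Sum>a\<in>A. \<Sum>v\<in>U a. v * (of_bool (acc s v) * q a v * (\<Prod>a'\<in>A - {a}. 1 - P a' s))) \<partial>unit_uniform)"
    (is "_ \<le> (\<integral>s. ?g s \<partial>_)")
proof -
  have "\<forall>a\<in>A. \<forall>v\<in>U a. \<exists>\<theta>\<in>{0..1}. \<forall>s\<in>{0..1}. acc s v \<longleftrightarrow> \<theta> \<le> s"
    using acceptance_threshold[OF \<open>c > 0\<close>] U(2) unfolding acc_def by blast
  then obtain \<theta> where \<theta>: "\<And>a v. a \<in> A \<Longrightarrow> v \<in> U a \<Longrightarrow> \<theta> a v \<in> {0..1}"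
    "\<And>a v s. a \<in> A \<Longrightarrow> v \<in> U a \<Longrightarrow> s \<in> {0..1} \<Longrightarrow> acc s v \<longleftrightarrow> \<theta> a v \<le> s"
    by metis
  have acc_m[measurable]: "Measurable.pred borel (\<lambda>s. acc s v)" for v
    unfolding acc_def by measurable
  \<comment> \<open>Closed form of the blocking probability on the unit interval: a nonnegative
    combination of hinges at the switching times.\<close>
  define p where "p a t = (\<Sum>v\<in>U a. q a v * max 0 (t - \<theta> a v))" for a t
  have P_eq: "P a t = p a t" if a: "a \<in> A" and t: "t \<in> {0..1}" for a t
  proof -
    have i: "integrable unit_uniform (\<lambda>s. of_bool (s \<le> t \<and> \<theta> a v \<le> s) :: real)" for v
      by (rule finite_measure.integrable_const_bound[where B = 1])
        (use prob_space_unit_uniform prob_space.finite_measure in auto)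
    have "P a t = (\<integral>s. (\<Sum>v\<in>U a. q a v * of_bool (s \<le> t \<and> \<theta> a v \<le> s)) \<partial>unit_uniform)"
      unfolding P_def
    proof (rule integral_cong_AE)
      have "AE s in unit_uniform. s \<in> {0..1}"
        by (rule AE_uniform_measureI) auto
      then show "AE s in unit_uniform. of_bool (s \<le> t) * (\<Sum>v\<in>U a. of_bool (acc s v) * q a v) =
          (\<Sum>v\<in>U a. q a v * of_bool (s \<le> t \<and> \<theta> a v \<le> s))"
        by eventually_elim (use \<theta>(2)[OF a] in \<open>auto simp: sum_distrib_left intro!: sum.cong\<close>)
    qed auto
    also have "\<dots> = (\<Sum>v\<in>U a. q a v * (\<integral>s. of_bool (s \<le> t \<and> \<theta> a v \<le> s) \<partial>unit_uniform))"
      using i by simp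
    also have "\<dots> = p a t"
      unfolding p_def using integral_unit_uniform_hinge[OF t \<theta>(1)[OF a]] by (intro sum.cong) auto
    finally show ?thesis .
  qed
  have p01: "0 \<le> p a t" "p a t \<le> 1" if a: "a \<in> A" and t: "t \<in> {0..1}" for a t
  proof -
    show "0 \<le> p a t" unfolding p_def using q[OF a] by (intro sum_nonneg) auto
    have "p a t \<le> (\<Sum>v\<in>U a. q a v)"
      unfolding p_def
    proof (intro sum_mono mult_left_le)
      fix v assume "v \<in> U a"
      then show "max 0 (t - \<theta> a v) \<le> 1" "0 \<le> q a v" using q[OF a] \<theta>(1)[OF a, of v] t by auto
    qed
    also have "\<dots> \<le> (\<Sum>a\<in>A. \<Sum>v\<in>U a. q a v)"
      using q \<open>finite A\<close> by (intro member_le_sum[OF a]) (auto intro!: sum_nonneg)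
    finally show "p a t \<le> 1" using total by linarith
  qed
  define r where "r t = (\<Prod>a\<in>A. 1 - p a t)" for t
  define Q where "Q a t = (\<Sum>v\<in>U a. q a v * of_bool (\<theta> a v \<le> t))" for a t
  define R where "R a t = (\<Prod>a'\<in>A - {a}. 1 - p a' t)" for a t
  \<comment> \<open>Derivative of \<open>(1 - exp (t - 1)) * r t\<close> away from the kinks;
    \<open>- Q a t\<close> is the slope of the factor \<open>1 - p a t\<close>.\<close>
  define H' where "H' t = - exp (t - 1) * r t + (1 - exp (t - 1)) * (\<Sum>a\<in>A. - Q a t * R a t)" for t
  have H: "(H' has_integral (1 - exp (1 - 1)) * r 1 - (1 - exp (0 - 1)) * r 0) {0..1}"
  proof (rule fundamental_theorem_of_calculus_interior_strong)
    \<comment> \<open>The kinks sit at the switching times; off this finite set the product rule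
      applies.\<close>
    show "finite (\<Union>a\<in>A. \<theta> a ` U a)" using \<open>finite A\<close> U(1) by auto
    show "continuous_on {0..1} (\<lambda>t. (1 - exp (t - 1)) * r t)"
      unfolding r_def p_def by (intro continuous_intros)
    fix t assume "t \<in> {0<..<1} - (\<Union>a\<in>A. \<theta> a ` U a)"
    then have ne: "t \<noteq> \<theta> a v" if "a \<in> A" "v \<in> U a" for a v using that by auto
    have hinge: "((\<lambda>t. max 0 (t - d)) has_real_derivative of_bool (d \<le> t)) (at t)" if "t \<noteq> d" for d :: real
    proof (cases "d < t")
      case True
      have "((\<lambda>t. t - d) has_real_derivative 1) (at t)" by (auto intro!: derivative_eq_intros)
      then have "((\<lambda>t. max 0 (t - d)) has_real_derivative 1) (at t)"
        by (rule has_field_derivative_transform_within_open[of _ _ _ "{d<..}"]) (use True in auto)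
      then show ?thesis using True by simp
    next
      case False
      have "((\<lambda>t. 0 :: real) has_real_derivative 0) (at t)" by simp
      then have "((\<lambda>t. max 0 (t - d)) has_real_derivative 0) (at t)"
        by (rule has_field_derivative_transform_within_open[of _ _ _ "{..<d}"]) (use False that in auto)
      then show ?thesis using False that by simp
    qed
    have dp: "((\<lambda>t. 1 - p a t) has_real_derivative - Q a t) (at t)" if "a \<in> A" for a
    proof -
      have "(p a has_real_derivative Q a t) (at t)"
        unfolding p_def[abs_def] Q_def using hinge ne[OF that] by (intro DERIV_sum DERIV_cmult) auto
      from DERIV_diff[OF DERIV_const[of 1] this] show ?thesis by simp
    qed
    have "(r has_real_derivative (\<Sum>a\<in>A. - Q a t * R a t)) (at t)"
    proof -
      have "(r has_derivative (\<lambda>y. \<Sum>a\<in>A. (- Q a t * y) * R a t)) (at t)"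
        unfolding r_def[abs_def] R_def
        by (rule has_derivative_prod) (rule dp[unfolded has_field_derivative_def])
      moreover have "(\<lambda>y. \<Sum>a\<in>A. (- Q a t * y) * R a t) = (*) (\<Sum>a\<in>A. - Q a t * R a t)"
        unfolding fun_eq_iff sum_distrib_right by (intro allI sum.cong refl) (simp add: mult_ac)
      ultimately show ?thesis by (simp add: has_field_derivative_def)
    qed
    moreover have "((\<lambda>t. 1 - exp (t - 1)) has_real_derivative - exp (t - 1)) (at t)"
      by (auto intro!: derivative_eq_intros)
    ultimately have "((\<lambda>t. (1 - exp (t - 1)) * r t) has_real_derivative
        - exp (t - 1) * r t + (\<Sum>a\<in>A. - Q a t * R a t) * (1 - exp (t - 1))) (at t)"
      by (rule DERIV_mult[rotated])
    then show "((\<lambda>t. (1 - exp (t - 1)) * r t) has_vector_derivative H' t) (at t)"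
      by (simp add: H'_def has_real_derivative_iff_has_vector_derivative mult.commute)
  qed simp
  have "p a 0 = 0" if "a \<in> A" for a
    unfolding p_def using \<theta>(1)[OF that] by (intro sum.neutral) force
  then have "r 0 = 1" unfolding r_def by simp
  then have H: "((\<lambda>s. - c * H' s) has_integral (1 - 1 / exp 1) * c) {0..1}"
  proof -
    \<comment> \<open>At time 1 the factor \<open>1 - exp (t - 1)\<close> vanishes, and at time 0
      nothing is blocked, so only \<open>1 - exp (- 1)\<close> remains.\<close>
    have "- c * ((1 - exp (1 - 1)) * r 1 - (1 - exp (0 - 1)) * r 0) = (1 - 1 / exp 1) * c"
      using \<open>r 0 = 1\<close> by (simp add: exp_minus field_simps)
    then show ?thesis using has_integral_mult_right[OF H, of "- c"] by metis
  qed
  define g where "g s = (\<Sum>a\<in>A. \<Sum>v\<in>U a. v * (of_bool (acc s v) * q a v * R a s))" for s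
  have R01: "0 \<le> R a s" "R a s \<le> 1" "r s \<le> R a s" if "s \<in> {0..1}" "a \<in> A" for a s
  proof -
    show 0: "0 \<le> R a s" unfolding R_def using p01 that by (intro prod_nonneg) auto
    show "R a s \<le> 1" unfolding R_def using p01 that by (intro prod_le_1) auto
    have "r s = (1 - p a s) * R a s"
      unfolding r_def R_def using \<open>finite A\<close> that by (simp add: prod.remove)
    also have "\<dots> \<le> 1 * R a s" using 0 p01[OF that(2,1)] by (intro mult_right_mono) auto
    finally show "r s \<le> R a s" by simp
  qed
  have r0: "0 \<le> r s" if "s \<in> {0..1}" for s
    unfolding r_def using p01 that by (intro prod_nonneg) auto
  have le: "- c * H' s \<le> g s" if s: "s \<in> {0..1}" for s
  proof -
    define w where "w = (1 - exp (s - 1)) * c"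
    have w0: "0 \<le> w" using s \<open>c > 0\<close> by (simp add: w_def)
    \<comment> \<open>The values weighted by \<open>q\<close> sum to at least \<open>c\<close> and
      the probabilities to at most 1, so the total surplus of values over the current threshold
      \<open>w\<close> is at least \<open>c - w\<close>, which is
      \<open>exp (s - 1) * c\<close>.\<close>
    have "r s * (c - w) \<le> r s * ((\<Sum>a\<in>A. \<Sum>v\<in>U a. q a v * v) - w * (\<Sum>a\<in>A. \<Sum>v\<in>U a. q a v))"
      using mult_left_mono[OF total w0] value_ge r0[OF s] by (intro mult_left_mono) auto
    also have "\<dots> = (\<Sum>a\<in>A. \<Sum>v\<in>U a. (v - w) * q a v * r s)"
      by (simp add: sum_distrib_left sum_subtractf algebra_simps)
    \<comment> \<open>Accepted values have nonnegative surplus, and omitting the factor of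
      \<open>a\<close> from \<open>r\<close> only helps; rejected values have negative surplus and
      are dropped.\<close>
    also have "\<dots> \<le> (\<Sum>a\<in>A. \<Sum>v\<in>U a. (v - w) * (of_bool (acc s v) * q a v * R a s))"
    proof (intro sum_mono)
      fix a v assume av: "a \<in> A" "v \<in> U a"
      show "(v - w) * q a v * r s \<le> (v - w) * (of_bool (acc s v) * q a v * R a s)"
      proof (cases "acc s v")
        case True
        then have "0 \<le> (v - w) * q a v" using q[OF av] by (auto simp: acc_def w_def)
        from mult_left_mono[OF R01(3)[OF s av(1)] this] show ?thesis using True by (simp add: mult.assoc)
      next
        case False
        then have "(v - w) * (q a v * r s) \<le> 0"
          using q[OF av] r0[OF s] by (intro mult_nonpos_nonneg) (auto simp: acc_def w_def)
        then show ?thesis using False by (simp add: mult.assoc)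
      qed
    qed
    also have "\<dots> = g s - w * (\<Sum>a\<in>A. Q a s * R a s)"
    proof -
      have "Q a s * R a s = (\<Sum>v\<in>U a. of_bool (acc s v) * q a v * R a s)" if "a \<in> A" for a
        unfolding Q_def sum_distrib_right using \<theta>(2)[OF that _ s] by (intro sum.cong) auto
      then show ?thesis
        unfolding g_def by (simp add: left_diff_distrib sum_subtractf sum_distrib_left)
    qed
    finally have "r s * (c - w) + w * (\<Sum>a\<in>A. Q a s * R a s) \<le> g s" by linarith
    \<comment> \<open>The first summand comes from the derivative of the exponential, the second
      from the derivative of \<open>r\<close>.\<close>
    moreover have "r s * (c - w) + w * (\<Sum>a\<in>A. Q a s * R a s) = - c * H' s"
      by (simp add: H'_def w_def sum_negf algebra_simps)
    ultimately show ?thesis by simp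
  qed
  have g_bound: "\<bar>g s\<bar> \<le> (\<Sum>a\<in>A. \<Sum>v\<in>U a. v * q a v)" if s: "s \<in> {0..1}" for s
  proof -
    have "0 \<le> g s"
      unfolding g_def using U(2) q R01[OF s] by (intro sum_nonneg mult_nonneg_nonneg) (auto simp: less_imp_le)
    moreover have "g s \<le> (\<Sum>a\<in>A. \<Sum>v\<in>U a. v * q a v)"
      unfolding g_def using U(2) q R01[OF s]
      by (intro sum_mono mult_left_mono) (auto simp: less_imp_le intro!: mult_right_le_one_le mult_left_le)
    ultimately show ?thesis by simp
  qed
  have g_m: "g \<in> borel_measurable borel"
    unfolding g_def R_def p_def by measurable
  have "(g has_integral (\<integral>s. g s \<partial>unit_uniform)) {0..1}"
    by (rule integral_unit_uniform[OF g_m g_bound])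
  then have "(1 - 1 / exp 1) * c \<le> (\<integral>s. g s \<partial>unit_uniform)"
    using has_integral_le[OF H] le by blast
  also have "(\<integral>s. g s \<partial>unit_uniform) = (\<integral>s. ?g s \<partial>unit_uniform)"
  proof (rule Bochner_Integration.integral_cong_AE)
    have "AE s in unit_uniform. s \<in> {0..1}" by (rule AE_uniform_measureI) auto
    then show eq: "AE s in unit_uniform. g s = ?g s"
      by eventually_elim (simp add: g_def R_def P_eq)
    show "g \<in> borel_measurable unit_uniform" using g_m by simp
    interpret UU: prob_space unit_uniform by (rule prob_space_unit_uniform)
    have "P a \<in> borel_measurable borel" for a
      unfolding P_def by measurable
    then show "?g \<in> borel_measurable unit_uniform" by measurable
  qed
  finally show ?thesis .
qed

subsection \<open>Averaging over sequences and arrival times\<close>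

context poi_instance
begin

text \<open>Empty off \<open>E\<close>, so that sums over edges become sums over all pairs of
  vertices and can be grouped by the vertex in \<open>B\<close>.\<close>

definition value_set :: "'a \<times> 'b \<Rightarrow> real set"
  where "value_set e = (if e \<in> E then V e else {})"

lemma finite_value_set: "finite (value_set e)"
  using finite_V by (simp add: value_set_def)

lemma sum_Sigma_V:
  fixes f :: "('a \<times> 'b) \<times> real \<Rightarrow> real"
  shows "(\<Sum>p\<in>Sigma E V. f p) = (\<Sum>b\<in>B. \<Sum>a\<in>A. \<Sum>v\<in>value_set (a, b). f ((a, b), v))"
proof -
  have "(\<Sum>p\<in>Sigma E V. f p) = (\<Sum>e\<in>E. \<Sum>v\<in>V e. f (e, v))"
    using finite_E finite_V by (subst sum.Sigma) auto
  also have "\<dots> = (\<Sum>e\<in>A \<times> B. \<Sum>v\<in>value_set e. f (e, v))"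
    using E_subset finite_A finite_B by (intro sum.mono_neutral_cong_left) (auto simp: value_set_def finite_V)
  also have "\<dots> = (\<Sum>a\<in>A. \<Sum>b\<in>B. \<Sum>v\<in>value_set (a, b). f ((a, b), v))"
    by (simp add: sum.cartesian_product case_prod_unfold)
  also have "\<dots> = (\<Sum>b\<in>B. \<Sum>a\<in>A. \<Sum>v\<in>value_set (a, b). f ((a, b), v))"
    by (rule sum.swap)
  finally show ?thesis .
qed

lemma sum_Sigma_deltaB:
  fixes f :: "('a \<times> 'b) \<times> real \<Rightarrow> real"
  shows "(\<Sum>p\<in>Sigma (deltaB E b) V. f p) = (\<Sum>a\<in>A. \<Sum>v\<in>value_set (a, b). f ((a, b), v))"
proof -
  have fin: "finite (deltaB E b)" by (rule finite_subset[OF _ finite_E]) (auto simp: deltaB_def)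
  have "(\<Sum>p\<in>Sigma (deltaB E b) V. f p) = (\<Sum>e\<in>deltaB E b. \<Sum>v\<in>V e. f (e, v))"
    using fin finite_V by (subst sum.Sigma) (auto simp: deltaB_def)
  also have "\<dots> = (\<Sum>e\<in>(\<lambda>a. (a, b)) ` A. \<Sum>v\<in>value_set e. f (e, v))"
    using E_subset finite_A by (intro sum.mono_neutral_cong_left) (auto simp: value_set_def deltaB_def finite_V)
  also have "\<dots> = (\<Sum>a\<in>A. \<Sum>v\<in>value_set (a, b). f ((a, b), v))"
    by (subst sum.reindex) (auto simp: inj_on_def)
  finally show ?thesis .
qed

lemma single_prob_bounds:
  assumes "valid_sequence a l"
  shows "0 \<le> single_prob a l K" "single_prob a l K \<le> 1" "single_prob a l UNIV = 1" "single_prob a l {} = 0"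
  unfolding single_prob_eq[OF assms] by (simp_all add: P.prob_space)

lemma single_prob_compl_and_sum:
  assumes l: "valid_sequence a l"
  shows "single_prob a l {r. \<not> Q r} = 1 - single_prob a l {r. Q r}"
    and "single_prob a l {r. \<exists>v. r = Some ((a, b), v) \<and> \<Phi> v} =
      (\<Sum>v\<in>value_set (a, b). of_bool (\<Phi> v) * single_prob a l {Some ((a, b), v)})"
proof -
  let ?N = "PiM E D"
  define fl where "fl Z = find (matches tau Z) l" for Z
  have fl: "fl \<in> ?N \<rightarrow>\<^sub>M count_space UNIV"
    unfolding fl_def using valid_sequenceD(1)[OF l] by (intro find_matches_measurable) auto
  define \<mu> where "\<mu> = distr ?N (count_space UNIV) fl"
  interpret \<mu>: prob_space \<mu> unfolding \<mu>_def by (rule P.prob_space_distr[OF fl])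
  have sets_\<mu>: "sets \<mu> = UNIV" "space \<mu> = UNIV" by (auto simp: \<mu>_def)
  have sp: "single_prob a l K = measure \<mu> K" for K
  proof -
    have "measure \<mu> K = measure ?N (fl -` K \<inter> space ?N)"
      unfolding \<mu>_def by (rule measure_distr[OF fl]) simp
    also have "fl -` K \<inter> space ?N = {Z \<in> space ?N. find (matches tau Z) l \<in> K}" by (auto simp: fl_def)
    finally show ?thesis unfolding single_prob_eq[OF l] by simp
  qed
  have "measure \<mu> (space \<mu> - {r. Q r}) = 1 - measure \<mu> {r. Q r}"
    by (rule \<mu>.prob_compl) (simp add: sets_\<mu>)
  then show "single_prob a l {r. \<not> Q r} = 1 - single_prob a l {r. Q r}"
    by (simp add: sp sets_\<mu> set_diff_eq)
  let ?S = "(\<lambda>v. Some ((a, b), v)) ` {v \<in> value_set (a, b). \<Phi> v}"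
  have "fl Z \<in> {r. \<exists>v. r = Some ((a, b), v) \<and> \<Phi> v} \<longleftrightarrow> fl Z \<in> ?S" for Z
  proof -
    have "v \<in> value_set (a, b)" if "fl Z = Some ((a, b), v)" for v
    proof -
      have "((a, b), v) \<in> set l" using find_in_set that unfolding fl_def by fastforce
      then show ?thesis using valid_sequenceD(1,3)[OF l] by (auto simp: value_set_def)
    qed
    then show ?thesis by blast
  qed
  then have "single_prob a l {r. \<exists>v. r = Some ((a, b), v) \<and> \<Phi> v} = single_prob a l ?S"
    unfolding single_prob_eq[OF l] fl_def by simp
  also have "\<dots> = (\<Sum>r\<in>?S. measure \<mu> {r})"
    unfolding sp using finite_value_set by (intro \<mu>.finite_measure_eq_sum_singleton) (auto simp: sets_\<mu>)
  also have "\<dots> = (\<Sum>v\<in>{v \<in> value_set (a, b). \<Phi> v}. single_prob a l {Some ((a, b), v)})"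
    by (subst sum.reindex) (auto simp: inj_on_def sp)
  also have "\<dots> = (\<Sum>v\<in>value_set (a, b). of_bool (\<Phi> v) * single_prob a l {Some ((a, b), v)})"
    using finite_value_set by (intro sum.mono_neutral_cong_left) auto
  finally show "single_prob a l {r. \<exists>v. r = Some ((a, b), v) \<and> \<Phi> v} =
      (\<Sum>v\<in>value_set (a, b). of_bool (\<Phi> v) * single_prob a l {Some ((a, b), v)})" .
qed

text \<open>The probability of \<open>target\<close> at \<open>a\<close>, with \<open>s\<close> the
  time of the vertex of \<open>p\<close> and \<open>u\<close> the time of \<open>a\<close>. It is
  affine in \<open>q a\<close>, so one expression serves for a fixed sequence and, after taking
  expectations, for a random one.\<close>

definition factor ::
    "('b \<Rightarrow> real) \<Rightarrow> ('a \<Rightarrow> ('a \<times> 'b) \<times> real \<Rightarrow> real) \<Rightarrow> ('a \<times> 'b) \<times> real \<Rightarrow> 'a \<Rightarrow> real \<Rightarrow> real \<Rightarrow> real"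
  where "factor c q p a s u = (if a = fst (fst p) then of_bool (accepts c s p) * q a p
    else 1 - of_bool (u \<le> s) * (\<Sum>v\<in>value_set (a, snd (fst p)).
      of_bool (accepts c u ((a, snd (fst p)), v)) * q a ((a, snd (fst p)), v)))"

lemma single_prob_target:
  assumes l: "valid_sequence a l"
  shows "single_prob a l (target c t p a) =
    factor c (\<lambda>a p. single_prob a l {Some p}) p a (t (fst (fst p))) (t a)"
proof (cases "a = fst (fst p)")
  case True
  then have "target c t p a = (if accepts c (t a) p then {Some p} else {})" by (auto simp: target_def)
  then show ?thesis using True single_prob_bounds(4)[OF l] by (simp add: factor_def)
next
  case False
  let ?b = "snd (fst p)"
  have h: "hits c (t a) r ?b \<longleftrightarrow> (\<exists>e v. r = Some (e, v) \<and> snd e = ?b \<and> accepts c (t a) (e, v))" for r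
    by (simp add: hits_def)
  let ?H = "{r. \<exists>v. r = Some ((a, ?b), v) \<and> accepts c (t a) ((a, ?b), v)}"
  have "single_prob a l {r. hits c (t a) r ?b} = single_prob a l ?H"
  proof -
    have "find (matches tau Z) l \<in> {r. hits c (t a) r ?b} \<longleftrightarrow> find (matches tau Z) l \<in> ?H" for Z
    proof -
      have "fst e = a" if "find (matches tau Z) l = Some (e, v)" for e v
        using valid_sequenceD(2)[OF l] find_in_set[OF that] by blast
      then show ?thesis unfolding mem_Collect_eq h by (metis prod.collapse fst_conv snd_conv)
    qed
    then show ?thesis unfolding single_prob_eq[OF l] by simp
  qed
  also have "\<dots> = (\<Sum>v\<in>value_set (a, ?b). of_bool (accepts c (t a) ((a, ?b), v)) * single_prob a l {Some ((a, ?b), v)})"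
    by (rule single_prob_compl_and_sum(2)[OF l])
  finally have hits: "single_prob a l {r. \<not> hits c (t a) r ?b} = 1 - \<dots>"
    using single_prob_compl_and_sum(1)[OF l] by simp
  have "target c t p a = (if t a \<le> t (fst (fst p)) then {r. \<not> hits c (t a) r ?b} else UNIV)"
    using False by (auto simp: target_def)
  then show ?thesis using False hits single_prob_bounds(3)[OF l] by (simp add: factor_def)
qed

lemma factor_measurable[measurable]:
  assumes [measurable]: "f \<in> borel_measurable W" "g \<in> borel_measurable W"
  shows "(\<lambda>\<omega>. factor c q p a (f \<omega>) (g \<omega>)) \<in> borel_measurable W"
proof -
  have [measurable]: "Measurable.pred W (\<lambda>\<omega>. accepts c (h \<omega>) p)" if [measurable]: "h \<in> borel_measurable W" for h p
    unfolding accepts_def case_prod_unfold by measurable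
  show ?thesis unfolding factor_def by measurable
qed

lemma valid_sequence_of_distribution:
  assumes "sequence_distribution E D tau V x a (S a)" "l \<in> set_pmf (S a)"
  shows "valid_sequence a l"
  using assms unfolding sequence_distribution_def valid_sequence_def by blast

lemma finite_set_pmf_sequences:
  assumes "sequence_distribution E D tau V x a (S a)"
  shows "finite (set_pmf (S a))"
proof (rule finite_subset)
  show "set_pmf (S a) \<subseteq> {l. set l \<subseteq> Sigma E V \<and> distinct l}"
    using assms by (auto simp: sequence_distribution_def deltaA_def)
  show "finite {l. set l \<subseteq> Sigma E V \<and> distinct l}"
    by (rule finite_subset_distinct[OF finite_Sigma_V])
qed

end

section \<open>Random sequences and averaged outcome probabilities\<close>

locale approx_poi_instance = poi_instance A B E D cost tau V
  for A :: "'a set" and B :: "'b set" and E D cost tau V +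
  fixes x :: "'a \<times> 'b \<Rightarrow> real \<Rightarrow> real" and S :: "'a \<Rightarrow> (('a \<times> 'b) \<times> real) list pmf"
  assumes feasible: "lp_feasible A B E D tau V x"
    and seq: "\<And>a. a \<in> A \<Longrightarrow> sequence_distribution E D tau V x a (S a)"
begin

abbreviation c where "c \<equiv> load E V x"

text \<open>Takes the place of \<open>x\<close> in the analysis: the total over the values of an
  edge is the same as for \<open>x\<close>, while the total weighted by values can only be
  larger.\<close>

definition q :: "'a \<Rightarrow> ('a \<times> 'b) \<times> real \<Rightarrow> real"
  where "q a p = measure_pmf.expectation (S a) (\<lambda>l. single_prob a l {Some p})"

lemma q_eq: "q a p = prob_single_vertex E D tau a (S a) (\<lambda>r. r = Some p)"
  by (simp add: q_def prob_single_vertex_def single_prob_def Let_def)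

lemma valid: "a \<in> A \<Longrightarrow> l \<in> set_pmf (S a) \<Longrightarrow> valid_sequence a l"
  using valid_sequence_of_distribution seq by blast

lemma integrable_S: "a \<in> A \<Longrightarrow> integrable (S a) (f :: _ \<Rightarrow> real)"
  using finite_set_pmf_sequences[OF seq] by (rule integrable_measure_pmf_finite)

lemma expectation_factor:
  assumes "a \<in> A"
  shows "measure_pmf.expectation (S a) (\<lambda>l. factor c (\<lambda>a p. single_prob a l {Some p}) p a s u) = factor c q p a s u"
  using integrable_S[OF assms] by (simp add: factor_def q_def)

lemma expectation_single_prob_sum:
  assumes "a \<in> A"
  shows "measure_pmf.expectation (S a) (\<lambda>l. single_prob a l {r. \<exists>v. r = Some ((a, b), v)}) =
    (\<Sum>v\<in>value_set (a, b). q a ((a, b), v))"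
proof -
  have "measure_pmf.expectation (S a) (\<lambda>l. single_prob a l {r. \<exists>v. r = Some ((a, b), v)}) =
      measure_pmf.expectation (S a) (\<lambda>l. \<Sum>v\<in>value_set (a, b). single_prob a l {Some ((a, b), v)})"
    using single_prob_compl_and_sum(2)[OF valid[OF assms], where \<Phi> = "\<lambda>_. True"]
    by (intro integral_cong_AE) (auto simp: AE_measure_pmf_iff)
  then show ?thesis using integrable_S[OF assms] by (simp add: q_def)
qed

lemma q_nonneg: "a \<in> A \<Longrightarrow> 0 \<le> q a p"
  unfolding q_def using single_prob_bounds(1)[OF valid]
  by (intro Bochner_Integration.integral_nonneg_AE) (auto simp: AE_measure_pmf_iff)

lemma sum_q: "a \<in> A \<Longrightarrow> (\<Sum>v\<in>value_set (a, b). q a ((a, b), v)) = (\<Sum>v\<in>value_set (a, b). x (a, b) v)"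
proof (cases "(a, b) \<in> E")
  case True
  assume a: "a \<in> A"
  have "(a, b) \<in> deltaA E a" using True by (simp add: deltaA_def)
  then have "prob_single_vertex E D tau a (S a) (\<lambda>r. \<exists>v. r = Some ((a, b), v)) = (\<Sum>v\<in>V (a, b). x (a, b) v)"
    using seq[OF a] unfolding sequence_distribution_def by blast
  moreover have "prob_single_vertex E D tau a (S a) (\<lambda>r. \<exists>v. r = Some ((a, b), v)) =
      measure_pmf.expectation (S a) (\<lambda>l. single_prob a l {r. \<exists>v. r = Some ((a, b), v)})"
    by (simp add: prob_single_vertex_def single_prob_def Let_def)
  ultimately show ?thesis using expectation_single_prob_sum[OF a] True by (simp add: value_set_def)
qed (simp add: value_set_def)

lemma sum_q_value:
  assumes a: "a \<in> A"
  shows "(\<Sum>v\<in>value_set (a, b). x (a, b) v * v) \<le> (\<Sum>v\<in>value_set (a, b). q a ((a, b), v) * v)"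
proof (cases "(a, b) \<in> E")
  case True
  then have "(a, b) \<in> deltaA E a" by (simp add: deltaA_def)
  then have "(\<Sum>v\<in>{v \<in> V (a, b). v \<ge> 0}. x (a, b) v * v) \<le>
      (\<Sum>v\<in>{v \<in> V (a, b). v \<ge> 0}. prob_single_vertex E D tau a (S a) (\<lambda>r. r = Some ((a, b), v)) * v)"
    using seq[OF a] unfolding sequence_distribution_def by blast
  \<comment> \<open>All values are positive, so the bound at \<open>w = 0\<close> speaks about all
    of them.\<close>
  moreover have "{v \<in> V (a, b). v \<ge> 0} = V (a, b)" using V_bounds(1)[OF True] by (auto simp: less_imp_le)
  ultimately show ?thesis using True by (simp add: value_set_def q_eq)
qed (simp add: value_set_def)

lemma factor_single_bounds:
  assumes "a \<in> A" "l \<in> set_pmf (S a)"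
  shows "0 \<le> factor c (\<lambda>a p. single_prob a l {Some p}) p a s u"
    "factor c (\<lambda>a p. single_prob a l {Some p}) p a s u \<le> 1"
proof -
  have l: "valid_sequence a l" by (rule valid[OF assms])
  \<comment> \<open>A factor is the probability of a target for suitable times: \<open>s\<close> at
    the vertex of \<open>p\<close> and \<open>u\<close> everywhere else.\<close>
  have "factor c (\<lambda>a p. single_prob a l {Some p}) p a s u =
      single_prob a l (target c (\<lambda>a'. if a' = fst (fst p) then s else u) p a)"
    using single_prob_target[OF l, of c "\<lambda>a'. if a' = fst (fst p) then s else u" p]
    by (cases "a = fst (fst p)") (simp_all add: factor_def)
  then show "0 \<le> factor c (\<lambda>a p. single_prob a l {Some p}) p a s u"
    "factor c (\<lambda>a p. single_prob a l {Some p}) p a s u \<le> 1"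
    using single_prob_bounds(1,2)[OF l] by simp_all
qed

lemma factor_bounds:
  assumes a: "a \<in> A"
  shows "0 \<le> factor c q p a s u" "factor c q p a s u \<le> 1"
proof -
  show "0 \<le> factor c q p a s u"
    unfolding expectation_factor[OF a, symmetric] using factor_single_bounds(1)[OF a]
    by (intro Bochner_Integration.integral_nonneg_AE) (auto simp: AE_measure_pmf_iff)
  have "measure_pmf.expectation (S a) (\<lambda>l. factor c (\<lambda>a p. single_prob a l {Some p}) p a s u) \<le>
      measure_pmf.expectation (S a) (\<lambda>_. 1 :: real)"
    using factor_single_bounds(2)[OF a] integrable_S[OF a]
    by (intro integral_mono_AE) (auto simp: AE_measure_pmf_iff)
  then show "factor c q p a s u \<le> 1" unfolding expectation_factor[OF a] by simp
qed

end

lemma (in finite_measure) integrable_bounded_real: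
  fixes f :: "'a \<Rightarrow> real"
  assumes "f \<in> borel_measurable M" "\<And>x. x \<in> space M \<Longrightarrow> \<bar>f x\<bar> \<le> C"
  shows "integrable M f"
  using assms by (intro integrable_const_bound[where B = C]) auto

context approx_poi_instance
begin

abbreviation arrival_times :: "('a \<Rightarrow> real) measure"
  where "arrival_times \<equiv> PiM A (\<lambda>_. unit_uniform)"

lemma prod_arrival_times: "product_prob_space (\<lambda>_ :: 'a. unit_uniform)"
  by (rule product_prob_spaceI) (rule prob_space_unit_uniform)

lemma prob_space_arrival_times: "prob_space arrival_times"
  by (intro prob_space_PiM prob_space_unit_uniform)

lemma V_nonneg: "p \<in> Sigma E V \<Longrightarrow> 0 \<le> snd p"
  using V_bounds(1) by (force simp: less_imp_le)

lemma E_fst: "p \<in> Sigma E V \<Longrightarrow> fst (fst p) \<in> A"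
  using E_subset by auto

lemma prod_factor_bounds:
  assumes "\<And>a. a \<in> A \<Longrightarrow> 0 \<le> f a" "\<And>a. a \<in> A \<Longrightarrow> f a \<le> (1 :: real)"
  shows "\<bar>\<Prod>a\<in>A. f a\<bar> \<le> 1"
proof -
  have "0 \<le> (\<Prod>a\<in>A. f a)" "(\<Prod>a\<in>A. f a) \<le> 1"
    using assms by (auto intro: prod_nonneg prod_le_1)
  then show ?thesis by simp
qed

lemma utility_given_sequences:
  assumes v: "\<And>a. a \<in> A \<Longrightarrow> \<sigma> a \<in> set_pmf (S a)"
  defines "L \<equiv> \<lambda>t. \<Sum>p\<in>Sigma E V. snd p * (\<Prod>a\<in>A.
    factor c (\<lambda>a' p. single_prob a' (\<sigma> a) {Some p}) p a (t (fst (fst p))) (t a))"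
  shows "integrable arrival_times L"
    and "(\<integral>t. L t \<partial>arrival_times) \<le> (\<integral>(t, X, X'). poi_utility cost X (approx_poi A E tau V x \<sigma> t X X')
        \<partial>(arrival_times \<Otimes>\<^sub>M (PiM E D \<Otimes>\<^sub>M PiM E D)))"
proof -
  let ?N = "PiM E D" and ?W = "arrival_times \<Otimes>\<^sub>M (PiM E D \<Otimes>\<^sub>M PiM E D)"
  interpret T: prob_space arrival_times by (rule prob_space_arrival_times)
  interpret NN: pair_prob_space ?N ?N ..
  interpret W: pair_prob_space arrival_times "?N \<Otimes>\<^sub>M ?N" ..
  have val: "valid_sequence a (\<sigma> a)" if "a \<in> A" for a using valid[OF that v[OF that]] .
  show iL: "integrable arrival_times L"
  proof (rule T.integrable_bounded_real[where C = "\<Sum>p\<in>Sigma E V. snd p * 1"])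
    show "L \<in> borel_measurable arrival_times"
      unfolding L_def
    proof (intro borel_measurable_sum borel_measurable_times borel_measurable_const borel_measurable_prod factor_measurable)
      fix p a assume "p \<in> Sigma E V" "a \<in> A"
      then show "(\<lambda>t. t (fst (fst p))) \<in> borel_measurable arrival_times" "(\<lambda>t. t a) \<in> borel_measurable arrival_times"
        using E_fst[of p] measurable_component_singleton[of _ A "\<lambda>_. unit_uniform"]
        by (auto simp: measurable_def)
    qed
    show "\<bar>L t\<bar> \<le> (\<Sum>p\<in>Sigma E V. snd p * 1)" for t
      unfolding L_def
    proof (rule order_trans[OF sum_abs], rule sum_mono)
      fix p assume p: "p \<in> Sigma E V"
      have "\<bar>\<Prod>a\<in>A. factor c (\<lambda>a' p. single_prob a' (\<sigma> a) {Some p}) p a (t (fst (fst p))) (t a)\<bar> \<le> 1"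
      proof (rule prod_factor_bounds)
        fix a assume a: "a \<in> A"
        have "factor c (\<lambda>a' p. single_prob a' (\<sigma> a) {Some p}) p a (t (fst (fst p))) (t a) =
            single_prob a (\<sigma> a) (target c t p a)"
          using single_prob_target[OF val[OF a], of c t p] by simp
        then show "0 \<le> factor c (\<lambda>a' p. single_prob a' (\<sigma> a) {Some p}) p a (t (fst (fst p))) (t a)"
          "factor c (\<lambda>a' p. single_prob a' (\<sigma> a) {Some p}) p a (t (fst (fst p))) (t a) \<le> 1"
          using single_prob_bounds(1,2)[OF val[OF a]] by simp_all
      qed
      then show "\<bar>snd p * (\<Prod>a\<in>A. factor c (\<lambda>a' p. single_prob a' (\<sigma> a) {Some p}) p a (t (fst (fst p))) (t a))\<bar> \<le> snd p * 1"
        using V_nonneg[OF p] unfolding abs_mult by (intro mult_mono) auto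
    qed
  qed
  define res where "res = (\<lambda>\<omega>. approx_poi A E tau V x \<sigma> (fst \<omega>) (fst (snd \<omega>)) (snd (snd \<omega>)))"
  have Xm: "(\<lambda>\<omega>. fst (snd \<omega>) e) \<in> borel_measurable ?W" "(\<lambda>\<omega>. snd (snd \<omega>) e) \<in> borel_measurable ?W"
    if "e \<in> E" for e
    using that by measurable
  have tm: "(\<lambda>\<omega>. fst \<omega> a) \<in> borel_measurable ?W" if "a \<in> A" for a
  proof -
    have "(\<lambda>\<omega>. fst \<omega> a) \<in> ?W \<rightarrow>\<^sub>M unit_uniform" using that by measurable
    then show ?thesis by (simp add: measurable_def)
  qed
  have res: "res \<in> ?W \<rightarrow>\<^sub>M count_space UNIV"
    unfolding res_def by (rule approx_poi_measurable[OF val tm Xm])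
  have sub: "fst (res \<omega>) \<subseteq> E \<and> snd (res \<omega>) \<subseteq> E" for \<omega>
    unfolding res_def by (rule approx_poi_subset[OF val])
  have Xd: "distr ?W (D e) (\<lambda>\<omega>. fst (snd \<omega>) e) = D e" if "e \<in> E" for e
  proof -
    have "distr ?W (D e) (\<lambda>\<omega>. fst (snd \<omega>) e) =
        distr (distr (distr ?W (?N \<Otimes>\<^sub>M ?N) snd) ?N fst) (D e) (\<lambda>X. X e)"
      using that by (simp add: distr_distr comp_def)
    also have "distr ?W (?N \<Otimes>\<^sub>M ?N) snd = ?N \<Otimes>\<^sub>M ?N"
      by (rule distr_pair_snd[OF prob_space_arrival_times NN.P.prob_space_axioms])
    finally show ?thesis using that by (simp add: P.distr_pair_fst PiM_component)
  qed
  have iu: "integrable ?W (\<lambda>\<omega>. poi_utility cost (fst (snd \<omega>)) (res \<omega>))"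
    by (rule integrable_utility(4)[OF W.P.prob_space_axioms Xm(1) Xd res sub])
  have "(\<integral>t. L t \<partial>arrival_times) \<le> (\<integral>t. (\<integral>\<omega>. poi_utility cost (fst \<omega>) (res (t, \<omega>)) \<partial>(?N \<Otimes>\<^sub>M ?N)) \<partial>arrival_times)"
  proof (rule integral_mono[OF iL])
    show "integrable arrival_times (\<lambda>t. \<integral>\<omega>. poi_utility cost (fst \<omega>) (res (t, \<omega>)) \<partial>(?N \<Otimes>\<^sub>M ?N))"
      using W.integrable_fst'[OF iu] by simp
    fix t
    have "L t = (\<Sum>p\<in>Sigma E V. snd p * (\<Prod>a\<in>A. single_prob a (\<sigma> a) (target c t p a)))"
      unfolding L_def using single_prob_target[OF val, of _ c t]
      by (intro sum.cong refl arg_cong2[where f = times] prod.cong) (simp add: factor_def)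
    also have "\<dots> \<le> (\<integral>(X, X'). poi_utility cost X (approx_poi A E tau V x \<sigma> t X X') \<partial>(?N \<Otimes>\<^sub>M ?N))"
      by (rule expected_utility_given_times[OF val])
    finally show "L t \<le> (\<integral>\<omega>. poi_utility cost (fst \<omega>) (res (t, \<omega>)) \<partial>(?N \<Otimes>\<^sub>M ?N))"
      by (simp add: res_def case_prod_unfold)
  qed
  also have "\<dots> = (\<integral>\<omega>. poi_utility cost (fst (snd \<omega>)) (res \<omega>) \<partial>?W)"
    using W.integral_fst'[OF iu] by simp
  finally show "(\<integral>t. L t \<partial>arrival_times) \<le> (\<integral>(t, X, X'). poi_utility cost X (approx_poi A E tau V x \<sigma> t X X') \<partial>?W)"
    by (simp add: res_def case_prod_unfold)
qed

text \<open>Sequences are drawn independently and each factor involves the sequence of one vertex,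
  so the expected product is the product of expectations, and affinity replaces the single sequence
  by \<open>q\<close>. The support is finite, hence exchanging with the time integral concerns a
  finite sum.\<close>

lemma approx_poi_utility_ge:
  "(\<integral>t. (\<Sum>p\<in>Sigma E V. snd p * (\<Prod>a\<in>A. factor c q p a (t (fst (fst p))) (t a))) \<partial>arrival_times)
    \<le> approx_poi_utility A E D cost tau V x S"
proof -
  let ?S = "Pi_pmf A [] S"
  define F where "F = set_pmf ?S"
  have setF: "\<sigma> a \<in> set_pmf (S a)" if "\<sigma> \<in> F" "a \<in> A" for \<sigma> a
    using that finite_A by (auto simp: F_def set_Pi_pmf PiE_dflt_def)
  have finF: "finite F"
  proof -
    have "finite (set_pmf (S a))" if "a \<in> A" for a
      using seq[OF that] by (rule finite_set_pmf_sequences[where x = x and a = a and S = S])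
    then show ?thesis unfolding F_def using finite_A by (simp add: set_Pi_pmf finite_PiE_dflt)
  qed
  define L where "L \<sigma> t = (\<Sum>p\<in>Sigma E V. snd p * (\<Prod>a\<in>A.
    factor c (\<lambda>a' p. single_prob a' (\<sigma> a) {Some p}) p a (t (fst (fst p))) (t a)))"
    for \<sigma> :: "'a \<Rightarrow> (('a \<times> 'b) \<times> real) list" and t
  define U where "U \<sigma> = (\<integral>(t, X, X'). poi_utility cost X (approx_poi A E tau V x \<sigma> t X X')
        \<partial>(arrival_times \<Otimes>\<^sub>M (PiM E D \<Otimes>\<^sub>M PiM E D)))" for \<sigma>
  have L: "integrable arrival_times (L \<sigma>)" "(\<integral>t. L \<sigma> t \<partial>arrival_times) \<le> U \<sigma>" if "\<sigma> \<in> F" for \<sigma>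
    using utility_given_sequences[of \<sigma>] setF[OF that] unfolding L_def U_def by auto
  have "(\<Sum>p\<in>Sigma E V. snd p * (\<Prod>a\<in>A. factor c q p a (t (fst (fst p))) (t a))) = (\<Sum>\<sigma>\<in>F. L \<sigma> t * pmf ?S \<sigma>)" for t
  proof -
    have "(\<Prod>a\<in>A. factor c q p a (t (fst (fst p))) (t a)) = (\<Sum>\<sigma>\<in>F. (\<Prod>a\<in>A.
        factor c (\<lambda>a' p. single_prob a' (\<sigma> a) {Some p}) p a (t (fst (fst p))) (t a)) * pmf ?S \<sigma>)" for p
    proof -
      have "(\<Prod>a\<in>A. factor c q p a (t (fst (fst p))) (t a)) = (\<Prod>a\<in>A. measure_pmf.expectation (S a)
          (\<lambda>l. factor c (\<lambda>a' p. single_prob a' l {Some p}) p a (t (fst (fst p))) (t a)))"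
        using expectation_factor by simp
      also have "\<dots> = measure_pmf.expectation ?S (\<lambda>\<sigma>. \<Prod>a\<in>A.
          factor c (\<lambda>a' p. single_prob a' (\<sigma> a) {Some p}) p a (t (fst (fst p))) (t a))"
        using factor_single_bounds(1) by (intro expectation_prod_Pi_pmf[symmetric] finite_A integrable_S) auto
      also have "\<dots> = (\<Sum>\<sigma>\<in>F. (\<Prod>a\<in>A.
          factor c (\<lambda>a' p. single_prob a' (\<sigma> a) {Some p}) p a (t (fst (fst p))) (t a)) * pmf ?S \<sigma>)"
        using finF by (intro integral_measure_pmf_real) (auto simp: F_def)
      finally show ?thesis .
    qed
    then show ?thesis
      unfolding L_def by (simp add: sum_distrib_left sum_distrib_right mult.assoc sum.swap[of _ F])
  qed
  then have "(\<integral>t. (\<Sum>p\<in>Sigma E V. snd p * (\<Prod>a\<in>A. factor c q p a (t (fst (fst p))) (t a))) \<partial>arrival_times) =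
      (\<Sum>\<sigma>\<in>F. (\<integral>t. L \<sigma> t \<partial>arrival_times) * pmf ?S \<sigma>)"
    using L(1) by simp
  also have "\<dots> \<le> (\<Sum>\<sigma>\<in>F. U \<sigma> * pmf ?S \<sigma>)"
    using L(2) by (intro sum_mono mult_right_mono) auto
  also have "\<dots> = measure_pmf.expectation ?S U"
    using finF by (intro integral_measure_pmf_real[symmetric]) (auto simp: F_def)
  also have "\<dots> = approx_poi_utility A E D cost tau V x S"
    unfolding approx_poi_utility_def U_def ..
  finally show ?thesis .
qed

text \<open>The probability that \<open>a\<close> arrives by time \<open>t\<close> and its
  single-vertex run outputs an acceptable edge to \<open>b\<close>, whether or not \<open>b\<close>
  is still free; it is the \<open>P\<close> of \<open>gain_lower_bound\<close>.\<close>

definition blocked :: "'b \<Rightarrow> 'a \<Rightarrow> real \<Rightarrow> real"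
  where "blocked b a t = (\<integral>s. of_bool (s \<le> t) * (\<Sum>v\<in>value_set (a, b).
    of_bool ((1 - exp (s - 1)) * c b \<le> v) * q a ((a, b), v)) \<partial>unit_uniform)"

lemma blocked_measurable[measurable]: "blocked b a \<in> borel_measurable borel"
proof -
  interpret UU: prob_space unit_uniform by (rule prob_space_unit_uniform)
  show ?thesis unfolding blocked_def by measurable
qed

lemma factor_integral:
  assumes a: "a \<in> A" "a \<noteq> fst (fst p)"
  shows "integrable unit_uniform (factor c q p a s)"
    and "(\<integral>u. factor c q p a s u \<partial>unit_uniform) = 1 - blocked (snd (fst p)) a s"
proof -
  interpret UU: prob_space unit_uniform by (rule prob_space_unit_uniform)
  have m: "factor c q p a s \<in> borel_measurable unit_uniform" by measurable
  show i: "integrable unit_uniform (factor c q p a s)"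
    by (rule UU.integrable_bounded_real[OF m, of 1]) (use factor_bounds[OF a(1)] in \<open>simp add: abs_of_nonneg\<close>)
  let ?h = "\<lambda>u. of_bool (u \<le> s) * (\<Sum>v\<in>value_set (a, snd (fst p)).
      of_bool ((1 - exp (u - 1)) * c (snd (fst p)) \<le> v) * q a ((a, snd (fst p)), v))"
  have eq: "factor c q p a s u = 1 - ?h u" for u
    using a(2) by (simp add: factor_def accepts_def)
  have "integrable unit_uniform (\<lambda>u. 1 - factor c q p a s u)" using i by simp
  then have "integrable unit_uniform ?h" unfolding eq by simp
  then have "(\<integral>u. 1 - ?h u \<partial>unit_uniform) = 1 - (\<integral>u. ?h u \<partial>unit_uniform)"
    by (subst Bochner_Integration.integral_diff) (simp_all add: UU.prob_space)
  then show "(\<integral>u. factor c q p a s u \<partial>unit_uniform) = 1 - blocked (snd (fst p)) a s"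
    unfolding eq blocked_def .
qed

lemma blocked_bounds:
  assumes "a \<in> A"
  shows "0 \<le> 1 - blocked b a s"
proof -
  interpret UU: prob_space unit_uniform by (rule prob_space_unit_uniform)
  have "blocked b a s \<le> (\<integral>u. 1 \<partial>unit_uniform)"
    unfolding blocked_def
  proof (rule integral_mono')
    show "integrable unit_uniform (\<lambda>u. 1 :: real)" by simp
    fix u :: real
    have "(\<Sum>v\<in>value_set (a, b). of_bool ((1 - exp (u - 1)) * c b \<le> v) * q a ((a, b), v)) \<le>
        (\<Sum>v\<in>value_set (a, b). q a ((a, b), v))"
      using q_nonneg[OF assms] by (intro sum_mono) auto
    also have "\<dots> \<le> 1"
    proof -
      have "single_prob a l {r. \<exists>v. r = Some ((a, b), v)} \<le> 1" if "l \<in> set_pmf (S a)" for l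
        using single_prob_bounds(2)[OF valid[OF assms that]] .
      then have "measure_pmf.expectation (S a) (\<lambda>l. single_prob a l {r. \<exists>v. r = Some ((a, b), v)}) \<le>
          measure_pmf.expectation (S a) (\<lambda>_. 1)"
        using integrable_S[OF assms] by (intro integral_mono_AE) (auto simp: AE_measure_pmf_iff)
      then show ?thesis by (simp add: expectation_single_prob_sum[OF assms])
    qed
    finally show "of_bool (u \<le> s) * (\<Sum>v\<in>value_set (a, b). of_bool ((1 - exp (u - 1)) * c b \<le> v) * q a ((a, b), v)) \<le> (1 :: real)"
      by simp
  qed simp
  then show ?thesis by (simp add: UU.prob_space)
qed

text \<open>Conditioning on the arrival time \<open>s\<close> of the vertex of \<open>p\<close>: the
  other times are independent, each enters only its own factor, and that factor averages to
  \<open>1 - blocked\<close>.\<close>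

lemma integral_arrival_times_factor:
  assumes p: "p \<in> Sigma E V"
  shows "integrable arrival_times (\<lambda>t. \<Prod>a\<in>A. factor c q p a (t (fst (fst p))) (t a))"
    and "(\<integral>t. (\<Prod>a\<in>A. factor c q p a (t (fst (fst p))) (t a)) \<partial>arrival_times) =
      (\<integral>s. of_bool (accepts c s p) * q (fst (fst p)) p *
        (\<Prod>a\<in>A - {fst (fst p)}. 1 - blocked (snd (fst p)) a s) \<partial>unit_uniform)"
proof -
  let ?a = "fst (fst p)" and ?U = "\<lambda>_ :: 'a. unit_uniform"
  define I where "I = A - {?a}"
  have aA: "?a \<in> A" by (rule E_fst[OF p])
  have I: "finite I" "?a \<notin> I" "A = insert ?a I" using finite_A aA by (auto simp: I_def)
  have IA: "a \<in> A" "a \<noteq> ?a" if "a \<in> I" for a using that by (auto simp: I_def)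
  interpret T: product_prob_space ?U A by (rule prod_arrival_times)
  interpret UU: prob_space unit_uniform by (rule prob_space_unit_uniform)
  interpret TI: prob_space "PiM I ?U" by (intro prob_space_PiM prob_space_unit_uniform)
  have comp: "(\<lambda>t. t a) \<in> borel_measurable (PiM J ?U)" if "a \<in> J" for J a
    using measurable_component_singleton[OF that, of ?U] by (simp add: measurable_def)
  let ?f = "\<lambda>t. \<Prod>a\<in>A. factor c q p a (t ?a) (t a)"
  have fm: "?f \<in> borel_measurable arrival_times"
    using comp[of _ A] aA by (intro borel_measurable_prod factor_measurable) auto
  show i: "integrable arrival_times ?f"
    by (rule T.P.integrable_bounded_real[OF fm prod_factor_bounds]) (use factor_bounds in auto)
  let ?g = "\<lambda>y s. factor c q p ?a s s * (\<Prod>a\<in>I. factor c q p a s (y a))"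
  interpret P2: pair_prob_space "PiM I ?U" unit_uniform ..
  have gi: "integrable (PiM I ?U \<Otimes>\<^sub>M unit_uniform) (case_prod ?g)"
  proof (rule P2.P.integrable_bounded_real[where C = 1])
    have s: "(\<lambda>\<omega>. snd \<omega>) \<in> borel_measurable (PiM I ?U \<Otimes>\<^sub>M unit_uniform)"
      using measurable_snd[of "PiM I ?U" unit_uniform] by (simp add: measurable_def)
    have y: "(\<lambda>\<omega>. fst \<omega> a) \<in> borel_measurable (PiM I ?U \<Otimes>\<^sub>M unit_uniform)" if "a \<in> I" for a
      using measurable_compose[OF measurable_fst comp[OF that]] .
    show "case_prod ?g \<in> borel_measurable (PiM I ?U \<Otimes>\<^sub>M unit_uniform)"
      unfolding case_prod_unfold
      using s y by (intro borel_measurable_times borel_measurable_prod factor_measurable) auto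
    fix \<omega>
    have "0 \<le> (\<Prod>a\<in>I. factor c q p a (snd \<omega>) (fst \<omega> a))"
      by (rule prod_nonneg) (rule factor_bounds(1)[OF IA(1)])
    moreover have "(\<Prod>a\<in>I. factor c q p a (snd \<omega>) (fst \<omega> a)) \<le> 1"
      by (rule prod_le_1) (intro conjI factor_bounds IA(1))
    ultimately show "\<bar>case_prod ?g \<omega>\<bar> \<le> 1"
      using factor_bounds[OF aA] by (simp add: case_prod_unfold abs_mult abs_of_nonneg mult_le_one)
  qed
  have "(\<integral>t. ?f t \<partial>arrival_times) = (\<integral>y. (\<integral>s. ?g y s \<partial>unit_uniform) \<partial>PiM I ?U)"
  proof -
    have "(\<integral>t. ?f t \<partial>arrival_times) = (\<integral>y. (\<integral>s. ?f (y(?a := s)) \<partial>unit_uniform) \<partial>PiM I ?U)"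
      using T.product_integral_insert[OF I(1,2), of ?f] i unfolding I(3)[symmetric] by simp
    moreover have "?f (y(?a := s)) = ?g y s" for y s
    proof -
      have "?f (y(?a := s)) = (\<Prod>a\<in>insert ?a I. factor c q p a s ((y(?a := s)) a))"
        unfolding I(3)[symmetric] by simp
      also have "\<dots> = factor c q p ?a s s * (\<Prod>a\<in>I. factor c q p a s ((y(?a := s)) a))"
        using I(1,2) by simp
      also have "(\<Prod>a\<in>I. factor c q p a s ((y(?a := s)) a)) = (\<Prod>a\<in>I. factor c q p a s (y a))"
        using I(2) by (intro prod.cong) auto
      finally show ?thesis .
    qed
    ultimately show ?thesis by simp
  qed
  also have "\<dots> = (\<integral>s. (\<integral>y. ?g y s \<partial>PiM I ?U) \<partial>unit_uniform)"
    using P2.Fubini_integral[OF gi] by simp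
  also have "\<dots> = (\<integral>s. of_bool (accepts c s p) * q ?a p * (\<Prod>a\<in>A - {?a}. 1 - blocked (snd (fst p)) a s) \<partial>unit_uniform)"
  proof (rule Bochner_Integration.integral_cong[OF refl])
    fix s
    have "(\<integral>y. ?g y s \<partial>PiM I ?U) = factor c q p ?a s s * (\<integral>y. (\<Prod>a\<in>I. factor c q p a s (y a)) \<partial>PiM I ?U)"
      by simp
    also have "(\<integral>y. (\<Prod>a\<in>I. factor c q p a s (y a)) \<partial>PiM I ?U) = (\<Prod>a\<in>I. \<integral>u. factor c q p a s u \<partial>unit_uniform)"
      by (rule T.product_integral_prod[OF I(1)]) (rule factor_integral(1)[OF IA])
    also have "\<dots> = (\<Prod>a\<in>I. 1 - blocked (snd (fst p)) a s)"
      by (rule prod.cong[OF refl]) (rule factor_integral(2)[OF IA])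
    finally show "(\<integral>y. ?g y s \<partial>PiM I ?U) =
        of_bool (accepts c s p) * q ?a p * (\<Prod>a\<in>A - {?a}. 1 - blocked (snd (fst p)) a s)"
      by (simp add: factor_def I_def)
  qed
  finally show "(\<integral>t. ?f t \<partial>arrival_times) =
    (\<integral>s. of_bool (accepts c s p) * q ?a p * (\<Prod>a\<in>A - {?a}. 1 - blocked (snd (fst p)) a s) \<partial>unit_uniform)" .
qed

lemma load_eq: "c b = (\<Sum>a\<in>A. \<Sum>v\<in>value_set (a, b). x (a, b) v * v)"
  using sum_Sigma_deltaB[of "\<lambda>p. x (fst p) (snd p) * snd p" b] by (simp add: load_def case_prod_unfold)

text \<open>An instance of \<open>gain_lower_bound\<close>. The constraint of the linear program at
  \<open>b\<close> for the set of all its pairs bounds the total output probability by 1, and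
  \<open>sum_q_value\<close> keeps the expected value at least at the load.\<close>

lemma gain_of_vertex:
  assumes b: "b \<in> B"
  shows "(1 - 1 / exp 1) * c b \<le> (\<Sum>a\<in>A. \<Sum>v\<in>value_set (a, b).
    v * (\<integral>t. (\<Prod>a'\<in>A. factor c q ((a, b), v) a' (t a) (t a')) \<partial>arrival_times))"
proof -
  interpret UU: prob_space unit_uniform by (rule prob_space_unit_uniform)
  define \<phi> where "\<phi> a v s = of_bool ((1 - exp (s - 1)) * c b \<le> v) * q a ((a, b), v) *
    (\<Prod>a'\<in>A - {a}. 1 - blocked b a' s)" for a v s
  have pos: "0 < v" if "v \<in> value_set (a, b)" for a v
    using that V_bounds(1) by (auto simp: value_set_def split: if_splits)
  have mem: "((a, b), v) \<in> Sigma E V" if "v \<in> value_set (a, b)" for a v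
    using that by (auto simp: value_set_def split: if_splits)
  have int: "(\<integral>t. (\<Prod>a'\<in>A. factor c q ((a, b), v) a' (t a) (t a')) \<partial>arrival_times) = (\<integral>s. \<phi> a v s \<partial>unit_uniform)"
    if "v \<in> value_set (a, b)" for a v
    using integral_arrival_times_factor(2)[OF mem[OF that]] by (simp add: \<phi>_def accepts_def)
  have \<phi>0: "0 \<le> \<phi> a v s" if "a \<in> A" for a v s
    unfolding \<phi>_def using q_nonneg[OF that] blocked_bounds by (intro mult_nonneg_nonneg prod_nonneg) auto
  show ?thesis
  proof (cases "0 < c b")
    case True
    have i\<phi>: "integrable unit_uniform (\<phi> a v)" if "a \<in> A" for a v
    proof (rule UU.integrable_bounded_real)
      show "\<phi> a v \<in> borel_measurable unit_uniform" unfolding \<phi>_def by measurable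
      show "\<bar>\<phi> a v s\<bar> \<le> q a ((a, b), v)" for s
      proof -
        have "blocked b a' s \<ge> 0" if "a' \<in> A" for a'
          unfolding blocked_def using q_nonneg[OF that]
          by (intro Bochner_Integration.integral_nonneg mult_nonneg_nonneg sum_nonneg) auto
        then have "(\<Prod>a'\<in>A - {a}. 1 - blocked b a' s) \<le> 1"
          using blocked_bounds by (intro prod_le_1) auto
        moreover have "0 \<le> (\<Prod>a'\<in>A - {a}. 1 - blocked b a' s)"
          using blocked_bounds by (intro prod_nonneg) auto
        ultimately show ?thesis
          using \<phi>0[OF that, of v s] q_nonneg[OF that, of "((a, b), v)"]
          by (simp add: \<phi>_def mult_left_le)
      qed
    qed
    have "(1 - 1 / exp 1) * c b \<le> (\<integral>s. (\<Sum>a\<in>A. \<Sum>v\<in>value_set (a, b). v * \<phi> a v s) \<partial>unit_uniform)"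
      unfolding \<phi>_def blocked_def
    proof (rule gain_lower_bound[OF finite_A finite_value_set pos _ True, where q = "\<lambda>a v. q a ((a, b), v)"])
      show "0 \<le> q a ((a, b), v)" if "a \<in> A" for a v using q_nonneg[OF that] .
      have "(\<Sum>a\<in>A. \<Sum>v\<in>value_set (a, b). q a ((a, b), v)) = (\<Sum>a\<in>A. \<Sum>v\<in>value_set (a, b). x (a, b) v)"
        using sum_q by simp
      also have "\<dots> = (\<Sum>(e, v)\<in>Sigma (deltaB E b) V. x e v)"
        using sum_Sigma_deltaB[of "\<lambda>p. x (fst p) (snd p)" b] by (simp add: case_prod_unfold)
      also have "\<dots> \<le> prob_some E D tau (Sigma (deltaB E b) V)"
        using feasible b unfolding lp_feasible_def by blast
      also have "\<dots> \<le> 1" by (simp add: prob_some_def)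
      finally show "(\<Sum>a\<in>A. \<Sum>v\<in>value_set (a, b). q a ((a, b), v)) \<le> 1" .
      show "c b \<le> (\<Sum>a\<in>A. \<Sum>v\<in>value_set (a, b). q a ((a, b), v) * v)"
        unfolding load_eq by (intro sum_mono sum_q_value)
    qed
    also have "\<dots> = (\<Sum>a\<in>A. \<Sum>v\<in>value_set (a, b). v * (\<integral>s. \<phi> a v s \<partial>unit_uniform))"
      using i\<phi> by simp
    finally show ?thesis using int by simp
  next
    \<comment> \<open>The threshold argument divides by the load; when the load is not positive, a
      nonnegative gain suffices.\<close>
    case False
    then have "(1 - 1 / exp 1) * c b \<le> 0"
      by (intro mult_nonneg_nonpos) (auto simp: field_simps)
    also have "0 \<le> (\<Sum>a\<in>A. \<Sum>v\<in>value_set (a, b). v * (\<integral>s. \<phi> a v s \<partial>unit_uniform))"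
      using \<phi>0 pos by (intro sum_nonneg mult_nonneg_nonneg Bochner_Integration.integral_nonneg) (auto simp: less_imp_le)
    finally show ?thesis using int by simp
  qed
qed

text \<open>Every edge has exactly one endpoint in \<open>B\<close>, so the loads add up to the
  value of the linear program and the gains can be summed vertex by vertex.\<close>

lemma approx_poi_utility_ge_lp_value:
  "(1 - 1 / exp 1) * lp_value E V x \<le> approx_poi_utility A E D cost tau V x S"
proof -
  have "lp_value E V x = (\<Sum>b\<in>B. c b)"
    using sum_Sigma_V[of "\<lambda>p. x (fst p) (snd p) * snd p"] by (simp add: lp_value_def load_eq case_prod_unfold)
  then have "(1 - 1 / exp 1) * lp_value E V x = (\<Sum>b\<in>B. (1 - 1 / exp 1) * c b)"
    by (simp add: sum_distrib_left)
  also have "\<dots> \<le> (\<Sum>b\<in>B. \<Sum>a\<in>A. \<Sum>v\<in>value_set (a, b).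
      v * (\<integral>t. (\<Prod>a'\<in>A. factor c q ((a, b), v) a' (t a) (t a')) \<partial>arrival_times))"
    by (rule sum_mono) (rule gain_of_vertex)
  also have "\<dots> = (\<Sum>p\<in>Sigma E V. snd p * (\<integral>t. (\<Prod>a\<in>A. factor c q p a (t (fst (fst p))) (t a)) \<partial>arrival_times))"
    by (simp add: sum_Sigma_V)
  also have "\<dots> = (\<integral>t. (\<Sum>p\<in>Sigma E V. snd p * (\<Prod>a\<in>A. factor c q p a (t (fst (fst p))) (t a))) \<partial>arrival_times)"
    using integral_arrival_times_factor(1) by (subst Bochner_Integration.integral_sum) auto
  also have "\<dots> \<le> approx_poi_utility A E D cost tau V x S"
    by (rule approx_poi_utility_ge)
  finally show ?thesis .
qed

end

theorem theorem2:
  fixes A :: "'a set" and B :: "'b set" and E :: "('a \<times> 'b) set"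
    and D :: "'a \<times> 'b \<Rightarrow> real measure"
    and cost tau :: "'a \<times> 'b \<Rightarrow> real"
    and V :: "'a \<times> 'b \<Rightarrow> real set"
    and x :: "'a \<times> 'b \<Rightarrow> real \<Rightarrow> real"
    and S :: "'a \<Rightarrow> (('a \<times> 'b) \<times> real) list pmf"
  assumes "finite A" and "finite B" and "E \<subseteq> A \<times> B"
    and "\<And>e. e \<in> E \<Longrightarrow> prob_space (D e)"
    and "\<And>e. e \<in> E \<Longrightarrow> sets (D e) = sets borel"
    and "\<And>e. e \<in> E \<Longrightarrow> AE w in D e. 0 \<le> w"
    and "\<And>e. e \<in> E \<Longrightarrow> 0 \<le> cost e"
    and "\<And>e. e \<in> E \<Longrightarrow> has_bochner_integral (D e) (\<lambda>w. max (w - tau e) 0) (cost e)"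
    and "\<And>e. e \<in> E \<Longrightarrow> finite (V e)"
    and "\<And>e. e \<in> E \<Longrightarrow> AE w in D e. min w (tau e) \<in> V e \<or> min w (tau e) \<le> 0"
    and "\<And>e v. e \<in> E \<Longrightarrow> v \<in> V e \<Longrightarrow> prob_value D tau e v > 0"
    and "\<And>e. e \<in> E \<Longrightarrow> (\<Sum>v\<in>V e. prob_value D tau e v) < 1"
    and "lp_optimal A B E D tau V x"
    and "\<And>a. a \<in> A \<Longrightarrow> sequence_distribution E D tau V x a (S a)"
  shows "approx_poi_utility A E D cost tau V x S \<ge> (1 - 1 / exp 1) * OPT E D cost"
proof -
  \<comment> \<open>Outside \<open>E\<close> nothing is assumed about \<open>D\<close>; a point mass there makes every \<open>D e\<close> a probability space.\<close>
  define D' where "D' e = (if e \<in> E then D e else return borel 0)" for e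
  have D'[simp]: "D' e = D e" if "e \<in> E" for e using that by (simp add: D'_def)
  have PiM': "PiM J D' = PiM J D" if "J \<subseteq> E" for J
    using that by (intro PiM_cong) auto
  have sub: "deltaA E a \<subseteq> E" for a by (auto simp: deltaA_def)
  have PiM_Y: "PiM (deltaA E a) (\<lambda>e. distr (D' e) borel (\<lambda>w. min w (tau e))) =
      PiM (deltaA E a) (\<lambda>e. distr (D e) borel (\<lambda>w. min w (tau e)))" for a
  proof (intro PiM_cong refl)
    fix e assume "e \<in> deltaA E a"
    then have "D' e = D e" using D' subsetD[OF sub] by blast
    then show "distr (D' e) borel (\<lambda>w. min w (tau e)) = distr (D e) borel (\<lambda>w. min w (tau e))" by simp
  qed
  have pv: "prob_value D' tau e v = prob_value D tau e v" if "e \<in> E" for e v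
    using that by (simp add: prob_value_def)
  have ps: "prob_some E D' tau F = prob_some E D tau F" for F
    by (simp add: prob_some_def PiM')
  have lf: "lp_feasible A B E D' tau V y = lp_feasible A B E D tau V y" for y
    by (simp add: lp_feasible_def ps)
  have sv: "prob_single_vertex E D' tau a = prob_single_vertex E D tau a" for a
    by (intro ext) (simp add: prob_single_vertex_def PiM_Y)
  have opt: "lp_optimal A B E D' tau V x"
    using assms(13) by (simp add: lp_optimal_def lf)
  have OPT: "OPT E D' cost = OPT E D cost"
    by (simp add: OPT_def expected_utility_def poi_algorithms_def PiM')
  have util: "approx_poi_utility A E D' cost tau V x S = approx_poi_utility A E D cost tau V x S"
    by (simp add: approx_poi_utility_def PiM')
  interpret approx_poi_instance A B E D' cost tau V x S
  proof (intro approx_poi_instance.intro poi_instance.intro approx_poi_instance_axioms.intro)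
    show "prob_space (D' e)" "sets (D' e) = sets borel" for e
      using assms(4,5) by (auto simp: D'_def prob_space_return)
    show "AE w in D' e. 0 \<le> w" "AE w in D' e. min w (tau e) \<in> V e \<or> min w (tau e) \<le> 0" if "e \<in> E" for e
      unfolding D'[OF that] by (fact assms(6)[OF that] assms(10)[OF that])+
    show "lp_feasible A B E D' tau V x" using opt by (simp add: lp_optimal_def)
    show "sequence_distribution E D' tau V x a (S a)" if "a \<in> A" for a
      using assms(14)[OF that] unfolding sequence_distribution_def sv .
  qed (use assms pv in simp_all)
  have "(1 - 1 / exp 1) * OPT E D cost \<le> (1 - 1 / exp 1) * lp_value E V x"
    using OPT_le_lp_value[OF opt] unfolding OPT by (intro mult_left_mono) (auto simp: field_simps)
  also have "\<dots> \<le> approx_poi_utility A E D cost tau V x S"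
    using approx_poi_utility_ge_lp_value unfolding util .
  finally show ?thesis .
qed

end
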